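(* Let $p$ be a prime number and let $G$ be a finite $p$-group. Then the following are equivalent: (i) for every outer $p$-automorphism $\phi$ of $G$, the subgroup $C_G(\phi)=\{x\in G \mid x^\phi=x\}$ has order $p$; (ii) $|G|\leq p^2$.
   Context: An automorphism of a group $G$ is called outer if it is not an inner automorphism (i.e. not conjugation by an element of $G$). An automorphism is called a $p$-automorphism if its order is a power of $p$. For an automorphism $\phi$ of $G$ and $x\in G$, $x^\phi$ denotes the image of $x$ under $\phi$. A finite $p$-group is a finite group whose order is a power of $p$ (the trivial group is allowed). Condition (i) holds vacuously if $G$ has no outer $p$-automorphism. *)

theory Defs
  imports
    "HOL-Computational_Algebra.Primes"
    "HOL-Algebra.Algebra"
begin

definition finite_p_group :: "nat \<Rightarrow> ('a, 'b) monoid_scheme \<Rightarrow> bool"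
  where "finite_p_group p G \<longleftrightarrow>
    group G \<and> finite (carrier G) \<and> (\<exists>n::nat. order G = p ^ n)"

text \<open>As in \<^const>\<open>auto\<close>, automorphisms are extensional on the carrier,
  so conjugation by \<open>g\<close> has to be restricted to the carrier.\<close>

definition inner_auto :: "('a, 'b) monoid_scheme \<Rightarrow> ('a \<Rightarrow> 'a) set"
  where "inner_auto G =
    {\<lambda>x \<in> carrier G. g \<otimes>\<^bsub>G\<^esub> x \<otimes>\<^bsub>G\<^esub> inv\<^bsub>G\<^esub> g | g. g \<in> carrier G}"

definition outer_auto :: "('a, 'b) monoid_scheme \<Rightarrow> ('a \<Rightarrow> 'a) set"
  where "outer_auto G = auto G - inner_auto G"

definition p_auto :: "nat \<Rightarrow> ('a, 'b) monoid_scheme \<Rightarrow> ('a \<Rightarrow> 'a) set"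
  where "p_auto p G =
    {\<phi> \<in> auto G. \<exists>k::nat. group.ord (AutoGroup G) \<phi> = p ^ k}"

definition fixed_subgroup :: "('a, 'b) monoid_scheme \<Rightarrow> ('a \<Rightarrow> 'a) \<Rightarrow> 'a set"
  where "fixed_subgroup G \<phi> = {x \<in> carrier G. \<phi> x = x}"

lemma (in group) subgroup_fixed_subgroup:
  assumes "\<phi> \<in> auto G"
  shows "subgroup (fixed_subgroup G \<phi>) G"
proof -
  have "\<phi> \<in> hom G G"
    using assms by (simp add: auto_def)
  then interpret group_hom G G \<phi>
    by unfold_locales
  show ?thesis
    by unfold_locales (auto simp: fixed_subgroup_def)
qed

lemma (in group) inner_auto_subset_auto: "inner_auto G \<subseteq> auto G"
proof
  fix \<phi> assume "\<phi> \<in> inner_auto G"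
  then obtain g where g: "g \<in> carrier G"
    and \<phi>: "\<phi> = (\<lambda>x \<in> carrier G. g \<otimes> x \<otimes> inv g)"
    by (auto simp: inner_auto_def)
  have "\<phi> \<in> Bij (carrier G)"
    using conjugation_is_bij[OF g] by (simp add: \<phi> Bij_def)
  moreover have "\<phi> \<in> hom G G"
    using g by (auto simp: \<phi> hom_def m_assoc inv_solve_left)
  ultimately show "\<phi> \<in> auto G"
    by (simp add: auto_def)
qed

end

theory Submission
  imports Defs "HOL-Number_Theory.Cong"
begin

text \<open>
  Automorphisms of \<open>p\<close>-power order fixing at least \<open>p\<^sup>2\<close> elements are inner as soon as all outer
  \<open>p\<close>-automorphisms have exactly \<open>p\<close> fixed points, so for \<open>|G| \<ge> p\<^sup>3\<close> it suffices to refine Gaschuetz'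
  theorem: some outer \<open>p\<close>-automorphism fixes at least \<open>p\<^sup>2\<close> elements.

  Suppose not, and let \<open>A\<close> be a maximal abelian normal subgroup. The automorphisms \<open>x \<mapsto> \<delta>(x) x\<close> given
  by derivations \<open>\<delta> : G/A \<rightarrow> A\<close> fix \<open>A\<close>, hence are inner: \<open>H\<^sup>1(G/A, A) = 0\<close>. This vanishing descends to
  all subgroups of \<open>G/A\<close>, and then \<open>G\<close> splits over \<open>A\<close>, so that \<open>A\<close> is not contained in some maximal
  subgroup \<open>M\<close>. Moving a generator of \<open>G/M\<close> by a central \<open>z\<close> of order \<open>p\<close> is an automorphism fixing \<open>M\<close>,
  hence it is conjugation by some \<open>h\<close>. Triviality of the cohomology of \<open>\<langle>h\<rangle>\<close> on \<open>A\<close> yields \<open>w \<in> A h\<close> of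
  order \<open>p\<close> such that \<open>\<langle>z, w\<rangle>\<close> is normal, and restricts the elements of order \<open>p\<close> in \<open>A\<close> so much that
  a maximal abelian normal subgroup containing \<open>\<langle>z, w\<rangle>\<close> cannot exist, except for \<open>p = 2\<close> and \<open>G\<close>
  dihedral of order 8, where the cyclic subgroup of order 4 gives the contradiction.
\<close>

section \<open>Fixed points of actions of p-groups\<close>

text \<open>The cohomology is only ever used along steps M < E of index p, where it reduces to
  counting. For the finite module C = C_A(M) of the cyclic group E/M the Herbrand quotient is 1, so
  the vanishing of H^1(E/M, C) forces all g-fixed elements of C to be norms, which says H^2(E/M, C)
  = 0. That group receives the transgression, so a homomorphism on M that is g-invariant up to
  conjugation extends to E. Derivations are encoded as homomorphisms so that one extension lemma
  serves to push rigidity down and to push a section of E -> E/A up. The bound p^2 is what |G| >=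
  p^3 can supply: a self-centralizing A and a subgroup M of index p both have at least p^2 elements.
  Elements of order p are restricted through (a w)^p = z^(i p(p-1)/2) a^p w^p, where w moves a by
  z^i. For odd p the power of z vanishes, so each a of order p in A is a power of z. The
  construction is run twice: the first run supplies two independent elements of order p, the second,
  over a subgroup containing both, forbids them. For p = 2 the power of z survives when w moves a,
  hence the separate case.\<close>

context group
begin

lemma inv_mult_cancel [simp]:
  assumes "x \<in> carrier G" "y \<in> carrier G"
  shows "inv x \<otimes> (x \<otimes> y) = y" "x \<otimes> (inv x \<otimes> y) = y"
  using assms by (simp_all flip: m_assoc)

lemmas group_normalize = m_assoc inv_mult_group

lemma pow_mult_swap:
  assumes "x \<in> carrier G" "y \<in> carrier G" "x \<otimes> y = y \<otimes> x"
  shows "x [^] (n::nat) \<otimes> y = y \<otimes> x [^] n"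
  using assms by (simp add: group_commutes_pow)

lemma subgroup_pow_mem:
  assumes "subgroup H G" "x \<in> H"
  shows "x [^] (n::nat) \<in> H"
  using assms by (induction n) (auto simp: subgroup.one_closed subgroup.m_closed)

text \<open>Orbits have p-power length, so those that are not single fixed points contribute
  multiples of p. The action is a bare function obeying the laws on S; each \<open>act g\<close> is
  restricted to S because elements of \<open>Bij S\<close> are extensional.\<close>

lemma card_fixed_points_cong:
  fixes act :: "'a \<Rightarrow> 'c \<Rightarrow> 'c" and p :: nat
  assumes "Factorial_Ring.prime p" "order G = p ^ n" "finite S"
    and one: "\<And>x. x \<in> S \<Longrightarrow> act \<one> x = x"
    and mult: "\<And>g h x. g \<in> carrier G \<Longrightarrow> h \<in> carrier G \<Longrightarrow> x \<in> S \<Longrightarrow> act (g \<otimes> h) x = act g (act h x)"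
    and closed: "\<And>g x. g \<in> carrier G \<Longrightarrow> x \<in> S \<Longrightarrow> act g x \<in> S"
  shows "[card S = card {x \<in> S. \<forall>g \<in> carrier G. act g x = x}] (mod p)"
proof -
  define \<phi> where "\<phi> g = restrict (act g) S" for g
  have "\<phi> g \<in> Bij S" if g: "g \<in> carrier G" for g
  proof -
    have "act (inv g) (act g x) = x" "act g (act (inv g) x) = x" if "x \<in> S" for x
      using g that mult[of "inv g" g x] mult[of g "inv g" x] one by auto
    then have "bij_betw (act g) S S"
      using g closed by (intro bij_betw_byWitness[where f' = "act (inv g)"]) auto
    then show ?thesis
      unfolding Bij_def \<phi>_def by (simp add: bij_betw_def inj_on_def)
  qed
  then have "\<phi> \<in> hom G (BijGroup S)"
    by (auto simp: hom_def BijGroup_def \<phi>_def compose_def mult closed fun_eq_iff restrict_def)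
  then interpret group_action G S \<phi>
    by (simp add: group_action_def group_hom_def group_hom_axioms_def group_BijGroup is_group)
  let ?F = "{x \<in> S. \<forall>g \<in> carrier G. act g x = x}"
  let ?O = "orbits G S \<phi>"
  have singleton: "{b \<in> ?O. card b = 1} = (\<lambda>x. {x}) ` ?F"
  proof (intro equalityI subsetI)
    fix b assume "b \<in> {b \<in> ?O. card b = 1}"
    then obtain x where x: "x \<in> S" "b = orbit G \<phi> x" "card b = 1"
      by (auto simp: orbits_def)
    then have ox: "b = {x}"
      using orbit_refl[of x] by (auto simp: card_1_singleton_iff)
    have "act g x = x" if "g \<in> carrier G" for g
    proof -
      have "\<phi> g x \<in> {x}"
        using that x ox unfolding orbit_def by blast
      then show ?thesis
        using x by (simp add: \<phi>_def)
    qed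
    then show "b \<in> (\<lambda>x. {x}) ` ?F"
      using x ox by auto
  next
    fix b assume "b \<in> (\<lambda>x. {x}) ` ?F"
    then obtain x where x: "x \<in> S" "\<forall>g \<in> carrier G. act g x = x" "b = {x}"
      by auto
    then have "orbit G \<phi> x = {x}"
      by (auto simp: orbit_def \<phi>_def intro!: exI[of _ \<one>])
    then show "b \<in> {b \<in> ?O. card b = 1}"
      using x by (auto simp: orbits_def)
  qed
  have finO: "finite ?O"
    unfolding orbits_def using assms(3) by simp
  have dvd: "p dvd card b" if "b \<in> ?O" "card b \<noteq> 1" for b
  proof -
    from that obtain x where x: "x \<in> S" "b = orbit G \<phi> x"
      by (auto simp: orbits_def)
    then have "card b dvd p ^ n"
      using orbit_stabilizer_theorem[of x] assms(2) by (metis dvd_triv_left)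
    then obtain i where "card b = p ^ i"
      using assms(1) divides_primepow_nat by blast
    with that show ?thesis
      by (cases i) auto
  qed
  have "card S = (\<Sum>b\<in>?O. card b)"
    using partition.disjoint_sum[OF orbit_partition assms(3), of "\<lambda>_. 1::nat"] by simp
  also have "\<dots> = (\<Sum>b\<in>{b \<in> ?O. card b = 1}. card b) + (\<Sum>b\<in>{b \<in> ?O. card b \<noteq> 1}. card b)"
  proof -
    have "?O = {b \<in> ?O. card b = 1} \<union> {b \<in> ?O. card b \<noteq> 1}"
      by blast
    then show ?thesis
      using finO sum.union_disjoint[of "{b \<in> ?O. card b = 1}" "{b \<in> ?O. card b \<noteq> 1}" card]
      by (metis (no_types, lifting) finite_Un disjoint_iff mem_Collect_eq)
  qed
  also have "(\<Sum>b\<in>{b \<in> ?O. card b = 1}. card b) = card {b \<in> ?O. card b = 1}"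
    by simp
  also have "card {b \<in> ?O. card b = 1} = card ?F"
    unfolding singleton by (simp add: card_image)
  finally have "card S = card ?F + (\<Sum>b\<in>{b \<in> ?O. card b \<noteq> 1}. card b)" .
  moreover have "p dvd (\<Sum>b\<in>{b \<in> ?O. card b \<noteq> 1}. card b)"
    by (rule dvd_sum) (use dvd in blast)
  then obtain q where "(\<Sum>b\<in>{b \<in> ?O. card b \<noteq> 1}. card b) = p * q" ..
  ultimately show ?thesis
    by (simp add: cong_def)
qed

end

text \<open>Iterating f is an action of the cyclic group of order p^k on S, so the orbit count
  applies.\<close>

lemma card_fixed_points_funpow_cong:
  assumes "Factorial_Ring.prime p" "finite S" "\<And>x. x \<in> S \<Longrightarrow> f x \<in> S"
    and "\<And>x. x \<in> S \<Longrightarrow> (f ^^ (p ^ k)) x = x"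
  shows "[card S = card {x \<in> S. f x = x}] (mod p)"
proof -
  let ?Z = "integer_mod_group (p ^ k)"
  have p0: "p ^ k > 0"
    using assms(1) by (simp add: prime_gt_0_nat)
  have nk: "nat (int p ^ k) = p ^ k"
    by (metis nat_int of_nat_power)
  have carr: "carrier ?Z = {0..<int (p ^ k)}"
    using p0 by (simp add: carrier_integer_mod_group)
  interpret Z: group ?Z
    by simp
  have closed: "(f ^^ n) x \<in> S" if "x \<in> S" for n x
    using that assms(3) by (induction n) auto
  have per: "(f ^^ (n + p ^ k * m)) x = (f ^^ n) x" if "x \<in> S" for n m x
  proof (induction m)
    case (Suc m)
    have "n + p ^ k * Suc m = (n + p ^ k * m) + p ^ k"
      by simp
    then show ?case
      using Suc that assms(4) by (simp only: funpow_add o_apply)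
  qed simp
  have md: "(f ^^ (n mod p ^ k)) x = (f ^^ n) x" if "x \<in> S" for n x
    using per[OF that, of "n mod p ^ k" "n div p ^ k"] by simp
  have "[card S = card {x \<in> S. \<forall>g \<in> carrier ?Z. (f ^^ nat g) x = x}] (mod p)"
  proof (rule Z.card_fixed_points_cong[where n = k])
    show "order ?Z = p ^ k"
      using nk by (simp add: order_def carr)
    fix g h x assume gh: "g \<in> carrier ?Z" "h \<in> carrier ?Z" and x: "x \<in> S"
    have "(f ^^ nat ((g + h) mod int (p ^ k))) x = (f ^^ (nat (g + h) mod p ^ k)) x"
      using gh carr nk by (simp add: nat_mod_distrib)
    also have "\<dots> = (f ^^ (nat g + nat h)) x"
      using md[OF x] gh carr by (simp add: nat_add_distrib)
    finally show "(f ^^ nat (g \<otimes>\<^bsub>?Z\<^esub> h)) x = (f ^^ nat g) ((f ^^ nat h) x)"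
      using gh by (simp add: mult_integer_mod_group funpow_add)
  qed (use assms closed in \<open>auto simp: one_integer_mod_group\<close>)
  moreover have "{x \<in> S. \<forall>g \<in> carrier ?Z. (f ^^ nat g) x = x} = {x \<in> S. f x = x}"
  proof (intro equalityI subsetI)
    fix x assume x: "x \<in> {x \<in> S. \<forall>g \<in> carrier ?Z. (f ^^ nat g) x = x}"
    show "x \<in> {x \<in> S. f x = x}"
    \<comment> \<open>For k = 0 the acting group is trivial and 1 is not one of its representatives;
      the period assumption then says directly that f fixes S.\<close>
    proof (cases "k = 0")
      case True
      then show ?thesis using x assms(4) by auto
    next
      case False
      then have "1 < p ^ k"
        using prime_gt_1_nat[OF assms(1)] by (intro one_less_power) auto
      then have "1 < int (p ^ k)"
        by linarith
      then have "1 \<in> carrier ?Z"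
        unfolding carr by (simp del: of_nat_power)
      then show ?thesis using x by fastforce
    qed
  next
    fix x assume x: "x \<in> {x \<in> S. f x = x}"
    then have "(f ^^ n) x = x" for n
      by (induction n) auto
    then show "x \<in> {x \<in> S. \<forall>g \<in> carrier ?Z. (f ^^ nat g) x = x}"
      using x by auto
  qed
  ultimately show ?thesis by simp
qed

section \<open>Finite p-groups and their central elements\<close>

locale p_group = group G for G (structure) +
  fixes p :: nat
  assumes prime_p: "Factorial_Ring.prime p"
    and finite_carrier: "finite (carrier G)"
    and order_power: "\<exists>n::nat. order G = p ^ n"
begin

lemma p_gt_1: "1 < p"
  using prime_p prime_gt_1_nat by blast

lemma p_group_restrict:
  assumes "subgroup H G"
  shows "p_group (G\<lparr>carrier := H\<rparr>) p"
proof -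
  interpret H: group "G\<lparr>carrier := H\<rparr>"
    using assms subgroup_imp_group by blast
  obtain n where "order G = p ^ n"
    using order_power by blast
  then have "card H dvd p ^ n"
    by (metis assms lagrange dvd_triv_right)
  then have "\<exists>n. card H = p ^ n"
    using divides_primepow_nat prime_p by blast
  moreover have "finite H"
    using assms finite_carrier finite_subset subgroup.subset by blast
  ultimately show ?thesis
    by unfold_locales (auto simp: prime_p order_def)
qed

lemma card_subgroup:
  assumes "subgroup H G"
  obtains n where "card H = p ^ n"
  using p_group.order_power[OF p_group_restrict[OF assms]] by (auto simp: order_def)

lemma p_group_Mod:
  assumes "N \<lhd> G"
  shows "p_group (G Mod N) p"
proof -
  interpret Q: group "G Mod N"
    using assms normal.factorgroup_is_group by blast
  have "order (G Mod N) * card N = order G"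
    using lagrange[OF normal_imp_subgroup[OF assms]] by (simp add: order_def FactGroup_def)
  moreover obtain n where "order G = p ^ n"
    using order_power by blast
  ultimately have "order (G Mod N) dvd p ^ n"
    by (metis dvd_triv_left)
  then have "\<exists>n. order (G Mod N) = p ^ n"
    using divides_primepow_nat prime_p by blast
  moreover have "finite (carrier (G Mod N))"
    by (simp add: FactGroup_def RCOSETS_def finite_carrier)
  ultimately show ?thesis
    by unfold_locales (auto simp: prime_p)
qed

lemma pow_card_one:
  assumes "x \<in> carrier G"
  obtains n where "x [^] (p ^ n) = \<one>"
  using assms order_power pow_order_eq_1 by metis

text \<open>Some x^(p^k) is the identity, so the sequence of these powers enters H; the last member
  outside H has its p-th power inside. For trivial H this is an element of order p.\<close>

lemma exists_last_power_not_mem: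
  assumes "subgroup H G" "x \<in> carrier G" "x \<notin> H"
  obtains k where "x [^] (p ^ k) \<notin> H" "x [^] (p ^ Suc k) \<in> H"
proof -
  obtain n where n: "x [^] (p ^ n) = \<one>"
    using assms pow_card_one by metis
  let ?P = "\<lambda>k. x [^] (p ^ k) \<in> H"
  have "?P n" "\<not> ?P 0"
    using n assms by (simp_all add: subgroup.one_closed)
  then have L: "?P (LEAST k. ?P k)" "(LEAST k. ?P k) \<noteq> 0"
    by (meson LeastI) (metis (mono_tags, lifting) LeastI \<open>?P n\<close> \<open>\<not> ?P 0\<close>)
  then obtain k where k: "(LEAST k. ?P k) = Suc k"
    by (metis not0_implies_Suc)
  with L have "?P (Suc k)" "\<not> ?P k"
    using not_less_Least[of k ?P] by auto
  then show ?thesis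
    using that by blast
qed

text \<open>The number of elements of B fixed under conjugation is divisible by p, so there is one
  besides the identity; a suitable power of it has order p.\<close>

lemma central_element:
  assumes "B \<lhd> G" "B \<noteq> {\<one>}"
  obtains z where "z \<in> B" "z \<noteq> \<one>" "z [^] p = \<one>" "\<And>y. y \<in> carrier G \<Longrightarrow> z \<otimes> y = y \<otimes> z"
proof -
  have B: "subgroup B G"
    using assms normal_imp_subgroup by blast
  then have sub: "B \<subseteq> carrier G" and one: "\<one> \<in> B"
    by (simp_all add: subgroup.subset subgroup.one_closed)
  have fin: "finite B"
    using sub finite_carrier finite_subset by blast
  obtain n where n: "order G = p ^ n"
    using order_power by blast
  let ?F = "{x \<in> B. \<forall>g\<in>carrier G. g \<otimes> x \<otimes> inv g = x}"
  have "[card B = card ?F] (mod p)"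
  proof (rule card_fixed_points_cong[OF prime_p n fin])
    fix g h x assume "g \<in> carrier G" "h \<in> carrier G" "x \<in> B"
    then show "g \<otimes> h \<otimes> x \<otimes> inv (g \<otimes> h) = g \<otimes> (h \<otimes> x \<otimes> inv h) \<otimes> inv g"
      using sub by (auto simp: group_normalize)
  next
    fix g x assume "g \<in> carrier G" "x \<in> B"
    then show "g \<otimes> x \<otimes> inv g \<in> B"
      using assms(1) by (simp add: normal.inv_op_closed2)
  qed (use sub in auto)
  moreover obtain k where k: "card B = p ^ k"
    using card_subgroup[OF B] .
  moreover have "k \<noteq> 0"
  proof
    assume "k = 0"
    then have "card B = 1"
      using k by simp
    then show False
      using one assms(2) by (metis card_1_singletonE singletonD)
  qed
  ultimately have "p dvd card ?F"
    using cong_dvd_iff[of "card B" "card ?F" p] by simp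
  moreover have F1: "\<one> \<in> ?F"
    using one by simp
  moreover have "finite ?F"
    using fin by simp
  then have "card ?F > 0"
    using F1 card_gt_0_iff by blast
  ultimately have "card ?F > 1"
    using p_gt_1 by (meson dvd_imp_le less_le_trans)
  then have "?F \<noteq> {\<one>}"
    by auto
  then obtain x where x: "x \<in> B" "x \<noteq> \<one>" "\<And>g. g \<in> carrier G \<Longrightarrow> g \<otimes> x \<otimes> inv g = x"
    using F1 by blast
  then have xc: "x \<in> carrier G"
    using sub by blast
  have comm: "x \<otimes> y = y \<otimes> x" if "y \<in> carrier G" for y
    using x(3)[OF that] that xc by (metis inv_solve_right m_closed)
  obtain k where k: "x [^] (p ^ k) \<notin> {\<one>}" "x [^] (p ^ Suc k) \<in> {\<one>}"
    using exists_last_power_not_mem[OF triv_subgroup xc] x(2) by blast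
  show ?thesis
  proof (rule that[of "x [^] (p ^ k)"])
    show "x [^] (p ^ k) \<in> B"
      using B x(1) by (rule subgroup_pow_mem)
    show "(x [^] (p ^ k)) [^] p = \<one>"
      using k xc by (simp add: nat_pow_pow mult.commute[of p])
    show "x [^] (p ^ k) \<otimes> y = y \<otimes> x [^] (p ^ k)" if "y \<in> carrier G" for y
      using pow_mult_swap[OF xc that comm[OF that]] .
    show "x [^] (p ^ k) \<noteq> \<one>"
      using k(1) by blast
  qed
qed

text \<open>The image of B in G/N is a nontrivial normal subgroup, so \<open>central_element\<close>
  applies there. Centrality of the coset is then read back as a commutator condition in G.\<close>

lemma relative_central_element:
  assumes "N \<lhd> G" "B \<lhd> G" "N \<subset> B"
  obtains x where "x \<in> B" "x \<notin> N" "x [^] p \<in> N"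
    "\<And>y. y \<in> carrier G \<Longrightarrow> y \<otimes> x \<otimes> inv y \<otimes> inv x \<in> N"
proof -
  interpret N: normal N G by (rule assms(1))
  interpret Q: p_group "G Mod N" p
    using assms(1) by (rule p_group_Mod)
  have hom: "group_hom G (G Mod N) (\<lambda>x. N #> x)"
    by (intro group_hom.intro group_hom_axioms.intro is_group Q.is_group N.r_coset_hom_Mod)
  have B: "subgroup B G"
    using assms normal_imp_subgroup by blast
  then have sub: "B \<subseteq> carrier G"
    by (simp add: subgroup.subset)
  have "(#>) N ` B \<lhd> G Mod N"
    by (rule normal.surj_hom_normal_subgroup[OF assms(2) hom]) (auto simp: FactGroup_def RCOSETS_def)
  moreover have mem: "N #> x = N \<longleftrightarrow> x \<in> N" if "x \<in> carrier G" for x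
    using that coset_join1[OF _ _ N.subgroup_axioms] coset_join2[OF _ N.subgroup_axioms] by auto
  moreover obtain b where b: "b \<in> B" "b \<notin> N"
    using assms(3) by blast
  then have "N #> b \<in> (#>) N ` B" "N #> b \<noteq> N"
    using mem sub by blast+
  ultimately obtain C where C: "C \<in> (#>) N ` B" "C \<noteq> N" "C [^]\<^bsub>G Mod N\<^esub> p = N"
    "\<And>D. D \<in> carrier (G Mod N) \<Longrightarrow> C \<otimes>\<^bsub>G Mod N\<^esub> D = D \<otimes>\<^bsub>G Mod N\<^esub> C"
    using Q.central_element[of "(#>) N ` B"] unfolding one_FactGroup by blast
  then obtain x where x: "x \<in> B" "C = N #> x"
    by blast
  have xc: "x \<in> carrier G"
    using x sub by blast
  show ?thesis
  proof (rule that[OF x(1)])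
    show "x \<notin> N"
      using C(2) x mem xc by blast
    have "N #> (x [^] p) = N"
      using C(3) x group_hom.hom_nat_pow[OF hom xc] by simp
    then show "x [^] p \<in> N"
      using mem xc by blast
    fix y assume y: "y \<in> carrier G"
    then have "N #> y \<in> carrier (G Mod N)"
      by (auto simp: FactGroup_def RCOSETS_def)
    from C(4)[OF this] have "N #> (x \<otimes> y) = N #> (y \<otimes> x)"
      using x xc y by (simp add: FactGroup_def N.rcos_sum)
    then have "(y \<otimes> x) \<otimes> inv (x \<otimes> y) \<in> N"
      using xc y rcos_self[OF _ N.subgroup_axioms, of "y \<otimes> x"]
        N.rcos_module_imp[OF is_group, of "x \<otimes> y" "y \<otimes> x"] by simp
    then show "y \<otimes> x \<otimes> inv y \<otimes> inv x \<in> N"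
      using xc y by (simp add: group_normalize)
  qed
qed

end

section \<open>Extending homomorphisms along steps of index p\<close>

context group
begin

definition centralizer :: "'a set \<Rightarrow> 'a set \<Rightarrow> 'a set"
  where "centralizer A S = {a \<in> A. \<forall>s \<in> S. a \<otimes> s = s \<otimes> a}"

lemma subgroup_centralizer:
  assumes "subgroup A G" "S \<subseteq> carrier G"
  shows "subgroup (centralizer A S) G"
proof (rule subgroupI)
  have A: "A \<subseteq> carrier G"
    using assms(1) by (rule subgroup.subset)
  then show "centralizer A S \<subseteq> carrier G"
    by (auto simp: centralizer_def)
  show "centralizer A S \<noteq> {}"
  proof -
    have "\<one> \<in> centralizer A S"
      using assms subgroup.one_closed[OF assms(1)] unfolding centralizer_def by (auto dest: subsetD)
    then show ?thesis by blast
  qed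
  fix a assume a: "a \<in> centralizer A S"
  then have aA: "a \<in> A" "a \<in> carrier G"
    using A by (auto simp: centralizer_def)
  have "inv a \<otimes> s = s \<otimes> inv a" if "s \<in> S" for s
  proof -
    have s: "s \<in> carrier G" "a \<otimes> s = s \<otimes> a"
      using that a assms(2) by (auto simp: centralizer_def)
    then have "inv a \<otimes> (s \<otimes> a) \<otimes> inv a = inv a \<otimes> (a \<otimes> s) \<otimes> inv a"
      by simp
    then show ?thesis
      using s(1) aA(2) by (simp add: m_assoc)
  qed
  then show "inv a \<in> centralizer A S"
    using aA assms(1) by (simp add: centralizer_def subgroup.m_inv_closed)
  fix b assume b: "b \<in> centralizer A S"
  then have bA: "b \<in> A" "b \<in> carrier G"
    using A by (auto simp: centralizer_def)
  have "a \<otimes> b \<otimes> s = s \<otimes> (a \<otimes> b)" if "s \<in> S" for s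
  proof -
    have s: "s \<in> carrier G" "a \<otimes> s = s \<otimes> a" "b \<otimes> s = s \<otimes> b"
      using that a b assms(2) by (auto simp: centralizer_def)
    have "a \<otimes> b \<otimes> s = a \<otimes> s \<otimes> b"
      using s(1,3) aA bA by (simp add: m_assoc)
    then show ?thesis
      using s aA bA by (simp flip: m_assoc)
  qed
  then show "a \<otimes> b \<in> centralizer A S"
    using aA bA assms(1) by (simp add: centralizer_def subgroup.m_closed)
qed

end

text \<open>E/M is cyclic of order p, generated by the class of g. Natural exponents suffice to list
  E because the group is finite.\<close>

definition (in p_group) cyclic_step :: "'a set \<Rightarrow> 'a \<Rightarrow> 'a set \<Rightarrow> bool"
  where "cyclic_step M g E \<longleftrightarrow> subgroup M G \<and> g \<in> carrier G \<and> g \<notin> M \<and> g [^] p \<in> M \<and>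
    (\<forall>m \<in> M. g \<otimes> m \<otimes> inv g \<in> M) \<and> E = {m \<otimes> g [^] (i::nat) |m i. m \<in> M}"

locale p_group_step = p_group +
  fixes M :: "'a set" and g :: 'a and E :: "'a set"
  assumes step: "cyclic_step M g E"
begin

lemma step_subgroup: "subgroup M G"
  and g_carrier [simp]: "g \<in> carrier G"
  and g_notin: "g \<notin> M"
  and g_pow_p: "g [^] p \<in> M"
  and g_conj: "\<And>m. m \<in> M \<Longrightarrow> g \<otimes> m \<otimes> inv g \<in> M"
  and E_eq: "E = {m \<otimes> g [^] (i::nat) |m i. m \<in> M}"
  using step by (auto simp: cyclic_step_def)

sublocale M: subgroup M G
  by (rule step_subgroup)

lemma g_pow_conj:
  assumes "m \<in> M"
  shows "g [^] (i::nat) \<otimes> m \<otimes> inv (g [^] i) \<in> M"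
proof (induction i)
  case (Suc i)
  have "g [^] Suc i \<otimes> m \<otimes> inv (g [^] Suc i) = g \<otimes> (g [^] i \<otimes> m \<otimes> inv (g [^] i)) \<otimes> inv g"
    unfolding nat_pow_Suc2[OF g_carrier] using assms by (simp add: group_normalize)
  then show ?case
    using g_conj[OF Suc.IH] by simp
qed (use assms in simp)

lemma step_mult:
  assumes "m \<in> M" "n \<in> M"
  shows "(m \<otimes> g [^] (i::nat)) \<otimes> (n \<otimes> g [^] (j::nat)) = (m \<otimes> (g [^] i \<otimes> n \<otimes> inv (g [^] i))) \<otimes> g [^] (i + j)"
  using assms by (simp add: group_normalize flip: nat_pow_mult)

lemma M_subset_E: "M \<subseteq> E"
proof
  fix m assume "m \<in> M"
  then have "m = m \<otimes> g [^] (0::nat)"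
    by simp
  with \<open>m \<in> M\<close> show "m \<in> E"
    unfolding E_eq by blast
qed

lemma g_in_E: "g \<in> E"
proof -
  have "g = \<one> \<otimes> g [^] (1::nat)"
    by simp
  then show ?thesis
    unfolding E_eq using M.one_closed by blast
qed

lemma E_subset: "E \<subseteq> carrier G"
  unfolding E_eq by auto

lemma subgroup_E: "subgroup E G"
proof (rule subgroupI[OF E_subset])
  show "E \<noteq> {}"
    using g_in_E by blast
  show mult: "x \<otimes> y \<in> E" if xy: "x \<in> E" "y \<in> E" for x y
  proof -
    obtain m i n j where "m \<in> M" "n \<in> M" "x = m \<otimes> g [^] (i::nat)" "y = n \<otimes> g [^] (j::nat)"
      using xy unfolding E_eq by blast
    then show ?thesis
      using step_mult[of m n i j] g_pow_conj[of n i] M.m_closed unfolding E_eq by blast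
  qed
  show "inv x \<in> E" if x: "x \<in> E" for x
  proof -
    have xc: "x \<in> carrier G"
      using x E_subset by blast
    \<comment> \<open>In a finite group the inverse is a natural power, so closure under products
      gives closure under inverses.\<close>
    have "x [^] n \<in> E" for n :: nat
    proof (induction n)
      case 0
      then show ?case
        using M_subset_E M.one_closed by auto
    qed (use mult x in simp)
    moreover obtain k where "x [^] (p ^ k) = \<one>"
      using pow_card_one[OF xc] .
    then have "inv x = x [^] (p ^ k - 1)"
      using xc p_gt_1 by (intro inv_equality) (simp_all flip: nat_pow_Suc)
    ultimately show ?thesis
      by simp
  qed
qed

lemma E_normalizes:
  assumes "x \<in> E" "m \<in> M"
  shows "x \<otimes> m \<otimes> inv x \<in> M"
proof -
  obtain n i where n: "n \<in> M" "x = n \<otimes> g [^] (i::nat)"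
    using assms(1) unfolding E_eq by blast
  then have "x \<otimes> m \<otimes> inv x = n \<otimes> (g [^] i \<otimes> m \<otimes> inv (g [^] i)) \<otimes> inv n"
    using assms(2) by (simp add: group_normalize)
  then show ?thesis
    using n g_pow_conj[OF assms(2)] by simp
qed

lemma inv_g_conj: "m \<in> M \<Longrightarrow> inv g \<otimes> m \<otimes> g \<in> M"
  using E_normalizes[of "inv g" m] subgroup.m_inv_closed[OF subgroup_E g_in_E] by simp

text \<open>If p does not divide k, Bezout expresses g through powers of g^k and g^p, which would
  place g in M.\<close>

lemma g_pow_mem_iff: "g [^] (k::nat) \<in> M \<longleftrightarrow> p dvd k"
proof
  assume k: "g [^] k \<in> M"
  show "p dvd k"
  proof (rule ccontr)
    assume "\<not> p dvd k"
    then have "coprime p k"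
      using prime_p prime_imp_coprime by blast
    moreover have "k \<noteq> 0"
      using \<open>\<not> p dvd k\<close> by (metis dvd_0_right)
    ultimately obtain u v where v: "k * u = p * v + 1"
      using bezout_nat[of k p] by (auto simp: coprime_iff_gcd_eq_1 gcd.commute)
    have "(g [^] k) [^] u = g \<otimes> (g [^] p) [^] v"
      using nat_pow_Suc2[OF g_carrier, of "p * v"] v by (simp add: nat_pow_pow del: nat_pow_Suc)
    moreover have "(g [^] k) [^] u \<in> M" "(g [^] p) [^] v \<in> M"
      using k g_pow_p by (simp_all add: subgroup_pow_mem step_subgroup)
    moreover have "g = g \<otimes> (g [^] p) [^] v \<otimes> inv ((g [^] p) [^] v)"
      by (simp add: m_assoc)
    ultimately have "g \<in> M"
      using M.m_closed M.m_inv_closed by metis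
    then show False
      using g_notin by simp
  qed
next
  assume "p dvd k"
  then obtain v where "k = p * v" ..
  then have "g [^] k = (g [^] p) [^] v"
    by (simp add: nat_pow_pow)
  then show "g [^] k \<in> M"
    using g_pow_p by (simp add: subgroup_pow_mem step_subgroup)
qed

text \<open>E is M with a generator g adjoined, subject to the rules for conjugating M by g and for
  the value of g^p in M. An image y for g only has to respect these two kinds of relations.\<close>

lemma hom_extension:
  assumes hom: "\<psi> \<in> hom (G\<lparr>carrier := M\<rparr>) G" and y: "y \<in> carrier G"
    and conj: "\<And>m. m \<in> M \<Longrightarrow> y \<otimes> \<psi> m = \<psi> (g \<otimes> m \<otimes> inv g) \<otimes> y"
    and pow: "\<psi> (g [^] p) = y [^] p"
  obtains \<psi>' where "\<psi>' \<in> hom (G\<lparr>carrier := E\<rparr>) G" "\<And>m i. m \<in> M \<Longrightarrow> \<psi>' (m \<otimes> g [^] (i::nat)) = \<psi> m \<otimes> y [^] i"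
proof -
  have psi: "\<psi> m \<in> carrier G" "\<psi> (m \<otimes> n) = \<psi> m \<otimes> \<psi> n" if "m \<in> M" "n \<in> M" for m n
    using hom that by (auto simp: hom_def)
  \<comment> \<open>Two representations of one element differ by a power of g lying in M, hence by
    some g^(pk), where \<open>\<psi>\<close> agrees with the powers of y.\<close>
  have well_defined_le: "\<psi> m \<otimes> y [^] i = \<psi> n \<otimes> y [^] j"
    if mn: "m \<in> M" "n \<in> M" "m \<otimes> g [^] i = n \<otimes> g [^] j" "i \<le> j" for m n and i j :: nat
  proof -
    obtain d where d: "j = d + i"
      using mn(4) le_Suc_ex add.commute by metis
    then have "m \<otimes> g [^] i = n \<otimes> g [^] d \<otimes> g [^] i"
      using mn by (simp add: m_assoc nat_pow_mult)
    then have m: "m = n \<otimes> g [^] d"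
      using mn by (simp add: r_cancel)
    then have gd: "g [^] d = inv n \<otimes> m"
      using mn by simp
    then have "g [^] d \<in> M"
      using mn by simp
    then obtain k where k: "d = p * k"
      using g_pow_mem_iff by blast
    have "\<psi> (g [^] (p * k)) = y [^] (p * k)" for k
    proof (induction k)
      case 0
      have "\<psi> \<one> \<otimes> \<psi> \<one> = \<psi> \<one>"
        using psi(2)[of \<one> \<one>] by simp
      then show ?case
        using psi(1)[of \<one> \<one>] by (simp add: l_cancel_one)
    next
      case (Suc k)
      have "g [^] (p * k) \<in> M"
        using g_pow_mem_iff by simp
      with Suc show ?case
        using psi(2)[OF g_pow_p] pow y by (simp add: flip: nat_pow_mult)
    qed
    then have "\<psi> m = \<psi> n \<otimes> y [^] d"
      using m k psi(2) mn \<open>g [^] d \<in> M\<close> by simp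
    then show ?thesis
      using d y mn psi(1) by (simp add: m_assoc nat_pow_mult)
  qed
  define \<psi>' where "\<psi>' x = (SOME u. \<exists>m\<in>M. \<exists>i::nat. x = m \<otimes> g [^] i \<and> u = \<psi> m \<otimes> y [^] i)" for x
  have \<psi>': "\<psi>' (m \<otimes> g [^] i) = \<psi> m \<otimes> y [^] i" if "m \<in> M" for m and i :: nat
  proof -
    have "\<exists>n\<in>M. \<exists>j::nat. m \<otimes> g [^] i = n \<otimes> g [^] j \<and> \<psi>' (m \<otimes> g [^] i) = \<psi> n \<otimes> y [^] j"
      unfolding \<psi>'_def by (rule someI[of _ "\<psi> m \<otimes> y [^] i"]) (use that in blast)
    then obtain n j where nj: "n \<in> M" "m \<otimes> g [^] i = n \<otimes> g [^] (j::nat)" "\<psi>' (m \<otimes> g [^] i) = \<psi> n \<otimes> y [^] j"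
      by blast
    then show ?thesis
      using well_defined_le[of m n i j] well_defined_le[of n m j i] that by (cases "i \<le> j") auto
  qed
  have swap: "y [^] i \<otimes> \<psi> m = \<psi> (g [^] i \<otimes> m \<otimes> inv (g [^] i)) \<otimes> y [^] i" if "m \<in> M" for m and i :: nat
  proof (induction i)
    case 0
    then show ?case
      using that psi by simp
  next
    case (Suc i)
    let ?n = "g [^] i \<otimes> m \<otimes> inv (g [^] i)"
    have n: "?n \<in> M" "g \<otimes> ?n \<otimes> inv g \<in> M"
      using g_pow_conj[OF that] g_conj by auto
    have "y [^] Suc i \<otimes> \<psi> m = y \<otimes> (y [^] i \<otimes> \<psi> m)"
      unfolding nat_pow_Suc2[OF y] using y psi that by (simp add: m_assoc)
    also have "\<dots> = (y \<otimes> \<psi> ?n) \<otimes> y [^] i"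
      using y psi(1)[OF n(1) n(1)] unfolding Suc.IH by (simp add: m_assoc)
    also have "\<dots> = \<psi> (g \<otimes> ?n \<otimes> inv g) \<otimes> (y \<otimes> y [^] i)"
      using y psi(1)[OF n(2) n(2)] unfolding conj[OF n(1)] by (simp add: m_assoc)
    also have "y \<otimes> y [^] i = y [^] Suc i"
      by (rule nat_pow_Suc2[OF y, symmetric])
    also have "g \<otimes> ?n \<otimes> inv g = g [^] Suc i \<otimes> m \<otimes> inv (g [^] Suc i)"
      unfolding nat_pow_Suc2[OF g_carrier] using that by (simp add: group_normalize)
    finally show ?case .
  qed
  have "\<psi>' \<in> hom (G\<lparr>carrier := E\<rparr>) G"
  proof (rule homI)
    fix x assume "x \<in> carrier (G\<lparr>carrier := E\<rparr>)"
    then show "\<psi>' x \<in> carrier G"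
      using \<psi>' psi y by (auto simp: E_eq)
    fix x' assume "x' \<in> carrier (G\<lparr>carrier := E\<rparr>)"
    with \<open>x \<in> carrier (G\<lparr>carrier := E\<rparr>)\<close>
    obtain m i n j where mn: "m \<in> M" "n \<in> M" "x = m \<otimes> g [^] (i::nat)" "x' = n \<otimes> g [^] (j::nat)"
      unfolding E_eq by auto
    have n': "g [^] i \<otimes> n \<otimes> inv (g [^] i) \<in> M"
      using g_pow_conj mn by blast
    have "\<psi>' (x \<otimes> x') = \<psi> m \<otimes> (\<psi> (g [^] i \<otimes> n \<otimes> inv (g [^] i)) \<otimes> y [^] i) \<otimes> y [^] j"
      using mn n' y psi step_mult[OF mn(1,2)] \<psi>'[of "m \<otimes> (g [^] i \<otimes> n \<otimes> inv (g [^] i))" "i + j"]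
      by (simp add: m_assoc nat_pow_mult)
    also have "\<dots> = \<psi>' x \<otimes> \<psi>' x'"
      unfolding swap[OF mn(2), of i, symmetric] using mn \<psi>' psi y by (simp add: m_assoc)
    finally show "\<psi>' (x \<otimes>\<^bsub>G\<lparr>carrier := E\<rparr>\<^esub> x') = \<psi>' x \<otimes> \<psi>' x'"
      by simp
  qed
  then show ?thesis
    using that \<psi>' by blast
qed

end

section \<open>Homomorphisms shifted by an abelian normal subgroup\<close>

text \<open>The nonempty fibres are cosets of the kernel. This is the first isomorphism theorem as a
  count, for a map that is multiplicative only on B.\<close>

lemma (in group) card_image_mult_card_kernel:
  assumes "subgroup B G" "finite B"
    and closed: "\<And>b. b \<in> B \<Longrightarrow> f b \<in> carrier G"
    and mult: "\<And>a b. a \<in> B \<Longrightarrow> b \<in> B \<Longrightarrow> f (a \<otimes> b) = f a \<otimes> f b"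
  shows "card (f ` B) * card {b \<in> B. f b = \<one>} = card B"
proof -
  interpret B: subgroup B G by fact
  have fibre: "card {c \<in> B. f c = f b} = card {c \<in> B. f c = \<one>}" if b: "b \<in> B" for b
  proof -
    have "bij_betw ((\<otimes>) b) {c \<in> B. f c = \<one>} {c \<in> B. f c = f b}"
    proof (rule bij_betw_byWitness[where f' = "(\<otimes>) (inv b)"])
      show "(\<otimes>) b ` {c \<in> B. f c = \<one>} \<subseteq> {c \<in> B. f c = f b}"
        using b mult closed by auto
      show "(\<otimes>) (inv b) ` {c \<in> B. f c = f b} \<subseteq> {c \<in> B. f c = \<one>}"
      proof clarsimp
        fix c assume c: "c \<in> B" "f c = f b"
        have "f b \<otimes> f (inv b \<otimes> c) = f b"
          using mult[of b "inv b \<otimes> c"] b c by simp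
        then show "inv b \<otimes> c \<in> B \<and> f (inv b \<otimes> c) = \<one>"
          using b c closed[of "inv b \<otimes> c"] closed[of b] by simp
      qed
    qed (use b in auto)
    then show ?thesis
      by (simp add: bij_betw_same_card)
  qed
  have "card B = (\<Sum>b\<in>B. 1)"
    by simp
  also have "\<dots> = (\<Sum>y\<in>f ` B. card {c \<in> B. f c = y})"
    using sum.image_gen[OF assms(2), of "\<lambda>_. 1::nat" f] by simp
  also have "\<dots> = (\<Sum>y\<in>f ` B. card {c \<in> B. f c = \<one>})"
    using fibre by (intro sum.cong) auto
  finally show ?thesis
    by simp
qed

lemma (in group) commutes_mult:
  assumes "x \<in> carrier G" "a \<in> carrier G" "b \<in> carrier G"
    and "x \<otimes> a = a \<otimes> x" "x \<otimes> b = b \<otimes> x"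
  shows "x \<otimes> (a \<otimes> b) = a \<otimes> b \<otimes> x"
proof -
  have "x \<otimes> (a \<otimes> b) = a \<otimes> (x \<otimes> b)"
    using assms(1-4) by (simp flip: m_assoc)
  then show ?thesis
    using assms by (simp add: m_assoc)
qed

text \<open>Meant for two endomorphisms of one finite group of order n: if the kernel of the second
  is no larger than the image of the first, then the kernel of the first is no larger than the image
  of the second.\<close>

lemma card_factor_le:
  fixes a b c d n :: nat
  assumes "a * b = n" "c * d = n" "d \<le> a" "0 < n"
  shows "b \<le> c"
proof (rule ccontr)
  assume "\<not> b \<le> c"
  then have "c * a < b * a"
    using assms by auto
  moreover have "c * d \<le> c * a"
    using assms(3) by simp
  ultimately show False
    using assms(1,2) by (simp add: mult.commute)
qed

locale p_group_module = p_group +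
  fixes A :: "'a set"
  assumes normal_A: "A \<lhd> G"
    and A_comm: "\<And>a b. a \<in> A \<Longrightarrow> b \<in> A \<Longrightarrow> a \<otimes> b = b \<otimes> a"
begin

lemma subgroup_A: "subgroup A G"
  using normal_A by (rule normal_imp_subgroup)

sublocale A: subgroup A G
  by (rule subgroup_A)

lemma A_conj: "x \<in> carrier G \<Longrightarrow> a \<in> A \<Longrightarrow> x \<otimes> a \<otimes> inv x \<in> A"
  using normal_A by (rule normal.inv_op_closed2)

lemma A_conj': "x \<in> carrier G \<Longrightarrow> a \<in> A \<Longrightarrow> inv x \<otimes> a \<otimes> x \<in> A"
  using normal_A by (rule normal.inv_op_closed1)

lemma A_comm_left: "a \<in> A \<Longrightarrow> b \<in> A \<Longrightarrow> x \<in> carrier G \<Longrightarrow> a \<otimes> (b \<otimes> x) = b \<otimes> (a \<otimes> x)"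
  using A_comm by (simp flip: m_assoc)

text \<open>\<open>shift_homs E\<close> encodes the derivations \<open>\<delta> : E \<rightarrow> A\<close> as the homomorphisms \<open>x \<mapsto> \<delta>(x) x\<close>, and
  \<open>rigid E\<close> says that \<open>H\<^sup>1(E/A, A) = 0\<close>.\<close>

definition shift_homs :: "'a set \<Rightarrow> ('a \<Rightarrow> 'a) set"
  where "shift_homs E = {\<psi> \<in> hom (G\<lparr>carrier := E\<rparr>) G. \<forall>x \<in> E. \<psi> x \<otimes> inv x \<in> A}"

definition rigid :: "'a set \<Rightarrow> bool"
  where "rigid E \<longleftrightarrow> (\<forall>\<psi> \<in> shift_homs E. (\<forall>a \<in> A. \<psi> a = a) \<longrightarrow>
    (\<exists>b \<in> A. \<forall>x \<in> E. \<psi> x = b \<otimes> x \<otimes> inv b))"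

lemma rigidD:
  assumes "rigid E" "\<psi> \<in> shift_homs E" "\<And>a. a \<in> A \<Longrightarrow> \<psi> a = a"
  obtains b where "b \<in> A" "\<And>x. x \<in> E \<Longrightarrow> \<psi> x = b \<otimes> x \<otimes> inv b"
  using assms(1)[unfolded rigid_def, rule_format, OF assms(2,3)] by blast

lemma shift_homsI:
  assumes "\<And>x. x \<in> E \<Longrightarrow> \<psi> x \<in> carrier G"
    and "\<And>x y. x \<in> E \<Longrightarrow> y \<in> E \<Longrightarrow> \<psi> (x \<otimes> y) = \<psi> x \<otimes> \<psi> y"
    and "\<And>x. x \<in> E \<Longrightarrow> \<psi> x \<otimes> inv x \<in> A"
  shows "\<psi> \<in> shift_homs E"
  using assms by (auto simp: shift_homs_def hom_def)

lemma shift_homsD: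
  assumes "\<psi> \<in> shift_homs E"
  shows "x \<in> E \<Longrightarrow> \<psi> x \<in> carrier G"
    and "x \<in> E \<Longrightarrow> y \<in> E \<Longrightarrow> \<psi> (x \<otimes> y) = \<psi> x \<otimes> \<psi> y"
    and "x \<in> E \<Longrightarrow> \<psi> x \<otimes> inv x \<in> A"
  using assms by (auto simp: shift_homs_def hom_def)

lemma shift_homs_decomp:
  assumes "\<psi> \<in> shift_homs E" "x \<in> E" "E \<subseteq> carrier G"
  obtains u where "u \<in> A" "\<psi> x = u \<otimes> x"
proof -
  have x: "x \<in> carrier G" "\<psi> x \<in> carrier G"
    using assms shift_homsD(1) by auto
  then have "\<psi> x = \<psi> x \<otimes> inv x \<otimes> x"
    by (simp add: m_assoc)
  then show ?thesis
    using that shift_homsD(3)[OF assms(1,2)] by blast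
qed

text \<open>Derivations can be subtracted: \<open>\<chi>\<close> encodes the difference of the two
  shifts, which is again a derivation and vanishes on A, so rigidity makes it principal.\<close>

lemma rigid_conj:
  assumes rigid: "rigid E" and E: "subgroup E G" "A \<subseteq> E"
    and \<psi>: "\<psi> \<in> shift_homs E" "\<psi>' \<in> shift_homs E" "\<And>a. a \<in> A \<Longrightarrow> \<psi> a = \<psi>' a"
  obtains b where "b \<in> A" "\<And>x. x \<in> E \<Longrightarrow> \<psi> x = b \<otimes> \<psi>' x \<otimes> inv b"
proof -
  interpret E: subgroup E G by fact
  define \<chi> where "\<chi> x = \<psi> x \<otimes> inv (\<psi>' x) \<otimes> x" for x
  have closed: "\<psi> x \<in> carrier G" "\<psi>' x \<in> carrier G" if "x \<in> E" for x
    using that shift_homsD(1) \<psi> by auto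
  have c: "\<psi> x \<otimes> inv (\<psi>' x) \<in> A" and d: "inv (\<psi>' x) \<otimes> x \<in> A" if x: "x \<in> E" for x
  proof -
    obtain u where u: "u \<in> A" "\<psi> x = u \<otimes> x"
      using shift_homs_decomp[OF \<psi>(1) x] E.subset by blast
    obtain v where v: "v \<in> A" "\<psi>' x = v \<otimes> x"
      using shift_homs_decomp[OF \<psi>(2) x] E.subset by blast
    have "\<psi> x \<otimes> inv (\<psi>' x) = u \<otimes> inv v"
      using u v x by (simp add: group_normalize)
    then show "\<psi> x \<otimes> inv (\<psi>' x) \<in> A"
      using u v by simp
    have "inv (\<psi>' x) \<otimes> x = inv x \<otimes> inv v \<otimes> x"
      using u v x by (simp add: group_normalize)
    then show "inv (\<psi>' x) \<otimes> x \<in> A"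
      using v x A_conj' by simp
  qed
  have "\<chi> \<in> shift_homs E"
  proof (rule shift_homsI)
    fix x assume x: "x \<in> E"
    then show "\<chi> x \<in> carrier G"
      using closed by (simp add: \<chi>_def)
    show "\<chi> x \<otimes> inv x \<in> A"
      using x c[OF x] closed[OF x] by (simp add: \<chi>_def m_assoc)
    fix y assume y: "y \<in> E"
    have "\<chi> (x \<otimes> y) = \<psi> x \<otimes> ((\<psi> y \<otimes> inv (\<psi>' y)) \<otimes> (inv (\<psi>' x) \<otimes> x)) \<otimes> y"
      using x y closed shift_homsD(2)[OF \<psi>(1)] shift_homsD(2)[OF \<psi>(2)]
      by (simp add: \<chi>_def group_normalize)
    also have "\<dots> = \<psi> x \<otimes> ((inv (\<psi>' x) \<otimes> x) \<otimes> (\<psi> y \<otimes> inv (\<psi>' y))) \<otimes> y"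
      using A_comm[OF c[OF y] d[OF x]] by simp
    also have "\<dots> = \<chi> x \<otimes> \<chi> y"
      using x y closed by (simp add: \<chi>_def m_assoc)
    finally show "\<chi> (x \<otimes> y) = \<chi> x \<otimes> \<chi> y" .
  qed
  moreover have "\<chi> a = a" if "a \<in> A" for a
  proof -
    have "a \<in> E"
      using that E(2) by blast
    then show ?thesis
      using \<psi>(3)[OF that] closed[of a] by (simp add: \<chi>_def)
  qed
  ultimately obtain b where b: "b \<in> A" "\<And>x. x \<in> E \<Longrightarrow> \<chi> x = b \<otimes> x \<otimes> inv b"
    using rigidD[OF rigid] by blast
  have "\<psi> x = b \<otimes> \<psi>' x \<otimes> inv b" if x: "x \<in> E" for x
  proof -
    have "inv (inv (\<psi>' x) \<otimes> x) \<in> A"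
      using d[OF x] by simp
    then have m: "inv x \<otimes> \<psi>' x \<in> A"
      using x closed[OF x] by (simp add: inv_mult_group)
    have "\<psi> x = \<chi> x \<otimes> (inv x \<otimes> \<psi>' x)"
      using x closed[OF x] by (simp add: \<chi>_def m_assoc)
    also have "\<dots> = b \<otimes> x \<otimes> (inv b \<otimes> (inv x \<otimes> \<psi>' x))"
      using b x closed[OF x] by (simp add: m_assoc)
    also have "inv b \<otimes> (inv x \<otimes> \<psi>' x) = (inv x \<otimes> \<psi>' x) \<otimes> inv b"
      using A_comm[OF _ m] b by simp
    also have "b \<otimes> x \<otimes> ((inv x \<otimes> \<psi>' x) \<otimes> inv b) = b \<otimes> \<psi>' x \<otimes> inv b"
      using b x closed[OF x] by (simp add: m_assoc)
    finally show ?thesis .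
  qed
  then show ?thesis
    using that b(1) by blast
qed

text \<open>In module notation, \<open>pnorm g n a\<close> is \<open>(1 + g + \<dots> + g\<^sup>n\<^sup>-\<^sup>1) a\<close>.\<close>

definition pnorm :: "'a \<Rightarrow> nat \<Rightarrow> 'a \<Rightarrow> 'a"
  where "pnorm g n a = (a \<otimes> g) [^] n \<otimes> inv (g [^] n)"

lemma pnorm_0 [simp]: "pnorm g 0 a = \<one>"
  by (simp add: pnorm_def)

lemma pnorm_Suc:
  assumes "a \<in> carrier G" "g \<in> carrier G"
  shows "pnorm g (Suc n) a = a \<otimes> (g \<otimes> pnorm g n a \<otimes> inv g)"
  unfolding pnorm_def nat_pow_Suc2[OF assms(2)] nat_pow_Suc2[OF m_closed[OF assms]]
  using assms by (simp add: group_normalize)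

lemma pnorm_mem:
  assumes "a \<in> A" "g \<in> carrier G"
  shows "pnorm g n a \<in> A"
proof (induction n)
  case (Suc n)
  then show ?case
    using assms by (simp add: pnorm_Suc A_conj)
qed simp

lemma pnorm_mult:
  assumes "a \<in> A" "b \<in> A" "g \<in> carrier G"
  shows "pnorm g n (a \<otimes> b) = pnorm g n a \<otimes> pnorm g n b"
proof (induction n)
  case (Suc n)
  have mem: "pnorm g n a \<in> A" "pnorm g n b \<in> A"
    using pnorm_mem assms by auto
  have "pnorm g (Suc n) (a \<otimes> b) = a \<otimes> (b \<otimes> (g \<otimes> pnorm g n a \<otimes> inv g)) \<otimes> (g \<otimes> pnorm g n b \<otimes> inv g)"
    using assms mem by (simp add: pnorm_Suc Suc m_assoc)
  also have "b \<otimes> (g \<otimes> pnorm g n a \<otimes> inv g) = (g \<otimes> pnorm g n a \<otimes> inv g) \<otimes> b"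
    using A_comm[OF assms(2) A_conj[OF assms(3) mem(1)]] .
  also have "a \<otimes> \<dots> \<otimes> (g \<otimes> pnorm g n b \<otimes> inv g) = pnorm g (Suc n) a \<otimes> pnorm g (Suc n) b"
    using assms mem by (simp add: pnorm_Suc m_assoc)
  finally show ?case .
qed simp

lemma pnorm_pow_eq:
  assumes "a \<in> carrier G" "g \<in> carrier G"
  shows "(a \<otimes> g) [^] n = pnorm g n a \<otimes> g [^] n"
  using assms by (simp add: pnorm_def m_assoc)

end

section \<open>Norms and the extension problem over one step of index p\<close>

locale module_step = p_group_module G p A + p_group_step G p M g E
  for G (structure) and p A M g E +
  assumes A_subset_M: "A \<subseteq> M"
begin

text \<open>g normalizes both A and M, so C_A(M) is a module for E/M.\<close>

lemma centralizer_conj: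
  assumes "b \<in> centralizer A M"
  shows "g \<otimes> b \<otimes> inv g \<in> centralizer A M"
proof -
  have b: "b \<in> A" "\<And>m. m \<in> M \<Longrightarrow> b \<otimes> m = m \<otimes> b"
    using assms by (auto simp: centralizer_def)
  have "g \<otimes> b \<otimes> inv g \<otimes> m = m \<otimes> (g \<otimes> b \<otimes> inv g)" if m: "m \<in> M" for m
  proof -
    have "g \<otimes> b \<otimes> inv g \<otimes> m = g \<otimes> (b \<otimes> (inv g \<otimes> m \<otimes> g)) \<otimes> inv g"
      using b(1) m by (simp add: m_assoc)
    also have "b \<otimes> (inv g \<otimes> m \<otimes> g) = (inv g \<otimes> m \<otimes> g) \<otimes> b"
      using b(2) inv_g_conj[OF m] by blast
    also have "g \<otimes> \<dots> \<otimes> inv g = m \<otimes> (g \<otimes> b \<otimes> inv g)"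
      using b(1) m by (simp add: m_assoc)
    finally show ?thesis .
  qed
  then show ?thesis
    using b(1) A_conj by (simp add: centralizer_def)
qed

sublocale C: subgroup "centralizer A M" G
  using subgroup_centralizer subgroup_A M.subset by blast

lemma centralizer_subset: "centralizer A M \<subseteq> A"
  by (auto simp: centralizer_def)

lemma pnorm_centralizer:
  assumes "b \<in> centralizer A M"
  shows "pnorm g n b \<in> centralizer A M"
proof (induction n)
  case (Suc n)
  then show ?case
    using assms by (simp add: pnorm_Suc centralizer_conj)
qed (simp add: C.one_closed)

text \<open>g^p lies in M and acts trivially on C_A(M), so multiplying by g only permutes the terms
  of the norm. The calculation splits (b g)^(p+1) once with the extra factor on the right and once
  with it on the left.\<close>

lemma pnorm_fixed:
  assumes b: "b \<in> centralizer A M"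
  shows "pnorm g p b \<otimes> g = g \<otimes> pnorm g p b"
proof -
  have bA: "b \<in> A" "b \<in> carrier G"
    using b centralizer_subset by auto
  have mem: "pnorm g p b \<in> A" "pnorm g p b \<in> carrier G"
    using pnorm_mem[OF bA(1)] by auto
  have gp: "b \<otimes> g [^] p = g [^] p \<otimes> b"
    using b g_pow_p by (simp add: centralizer_def)
  have "pnorm g p b \<otimes> (g [^] p \<otimes> (b \<otimes> g)) = (b \<otimes> g) [^] Suc p"
    using bA mem by (simp add: pnorm_pow_eq m_assoc)
  also have "\<dots> = b \<otimes> g \<otimes> (pnorm g p b \<otimes> g [^] p)"
    unfolding nat_pow_Suc2[OF m_closed[OF bA(2) g_carrier]] using bA by (simp add: pnorm_pow_eq)
  also have "g [^] p \<otimes> (b \<otimes> g) = b \<otimes> g \<otimes> g [^] p"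
  proof -
    have "g [^] p \<otimes> (b \<otimes> g) = b \<otimes> (g [^] p \<otimes> g)"
      using gp bA by (simp flip: m_assoc)
    then show ?thesis
      using bA pow_mult_swap[of g g p] by (simp add: m_assoc)
  qed
  finally have "(pnorm g p b \<otimes> (b \<otimes> g)) \<otimes> g [^] p = (b \<otimes> g \<otimes> pnorm g p b) \<otimes> g [^] p"
    using bA mem by (simp add: m_assoc)
  then have "pnorm g p b \<otimes> (b \<otimes> g) = b \<otimes> g \<otimes> pnorm g p b"
    using bA mem by simp
  then have "b \<otimes> (pnorm g p b \<otimes> g) = b \<otimes> (g \<otimes> pnorm g p b)"
    using A_comm_left[OF mem(1) bA(1) g_carrier] bA mem by (simp add: m_assoc)
  then show ?thesis
    using bA mem by simp
qed

text \<open>Norm one means (c g)^p = g^p, so fixing M and sending g to c g defines a homomorphism on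
  E. Rigidity makes it conjugation by some b in A, and b centralizes M because M is fixed. In other
  words H^1(E/M, C_A(M)) = 0.\<close>

lemma rigid_norm_kernel:
  assumes rigid: "rigid E" and c: "c \<in> centralizer A M" "pnorm g p c = \<one>"
  obtains b where "b \<in> centralizer A M" "c = b \<otimes> g \<otimes> inv b \<otimes> inv g"
proof -
  have cA: "c \<in> A" "c \<in> carrier G" "\<And>m. m \<in> M \<Longrightarrow> c \<otimes> m = m \<otimes> c"
    using c(1) centralizer_subset by (auto simp: centralizer_def)
  have "c \<otimes> g \<otimes> m = g \<otimes> m \<otimes> inv g \<otimes> (c \<otimes> g)" if "m \<in> M" for m
  proof -
    have "c \<otimes> g \<otimes> m = c \<otimes> (g \<otimes> m \<otimes> inv g) \<otimes> g"
      using that cA(2) by (simp add: m_assoc)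
    then show ?thesis
      unfolding cA(3)[OF g_conj[OF that]] using that cA(2) by (simp add: m_assoc)
  qed
  moreover have "g [^] p = (c \<otimes> g) [^] p"
    using pnorm_pow_eq[OF cA(2) g_carrier, of p] c(2) by simp
  moreover have "(\<lambda>x. x) \<in> hom (G\<lparr>carrier := M\<rparr>) G"
    by (auto simp: hom_def)
  ultimately obtain \<psi> where \<psi>: "\<psi> \<in> hom (G\<lparr>carrier := E\<rparr>) G"
    "\<And>m i. m \<in> M \<Longrightarrow> \<psi> (m \<otimes> g [^] (i::nat)) = m \<otimes> (c \<otimes> g) [^] i"
    using hom_extension[of "\<lambda>x. x", OF _ m_closed[OF cA(2) g_carrier]] by blast
  have fix_M: "\<psi> m = m" if "m \<in> M" for m
    using \<psi>(2)[OF that, of 0] that by simp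
  have "\<psi> \<in> shift_homs E"
  proof (rule shift_homsI)
    fix x assume "x \<in> E"
    then obtain m i where x: "m \<in> M" "x = m \<otimes> g [^] (i::nat)"
      unfolding E_eq by blast
    have "\<psi> x \<otimes> inv x = m \<otimes> pnorm g i c \<otimes> inv m"
      unfolding x \<psi>(2)[OF x(1)] pnorm_pow_eq[OF cA(2) g_carrier]
      using x(1) pnorm_mem[OF cA(1) g_carrier, of i] by (simp add: group_normalize)
    then show "\<psi> x \<otimes> inv x \<in> A"
      using x(1) pnorm_mem[OF cA(1) g_carrier, of i] A_conj by simp
  qed (use \<psi>(1) in \<open>simp_all add: hom_def Pi_iff\<close>)
  then obtain b where b: "b \<in> A" "\<And>x. x \<in> E \<Longrightarrow> \<psi> x = b \<otimes> x \<otimes> inv b"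
    using rigidD[OF rigid _ fix_M] A_subset_M by blast
  have "b \<otimes> m = m \<otimes> b" if "m \<in> M" for m
  proof -
    have "b \<otimes> m \<otimes> inv b = m"
      using b(2)[of m] fix_M[OF that] that M_subset_E by auto
    then have "b \<otimes> m \<otimes> inv b \<otimes> b = m \<otimes> b"
      by simp
    then show ?thesis
      using b(1) that by (simp add: m_assoc)
  qed
  then have "b \<in> centralizer A M"
    using b(1) by (simp add: centralizer_def)
  moreover have "c = b \<otimes> g \<otimes> inv b \<otimes> inv g"
  proof -
    have "c \<otimes> g = b \<otimes> g \<otimes> inv b"
      using \<psi>(2)[OF M.one_closed, of 1] b(2)[OF g_in_E] cA(2) by simp
    then have "c \<otimes> g \<otimes> inv g = b \<otimes> g \<otimes> inv b \<otimes> inv g"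
      by simp
    then show ?thesis
      using cA(2) by (simp add: m_assoc)
  qed
  ultimately show ?thesis
    using that by blast
qed

text \<open>The kernel and the image of \<open>b \<mapsto> g b - b\<close> on \<open>C = centralizer A M\<close> have complementary sizes,
  and so do those of the norm; rigidity identifies the kernel of the norm with the image of
  \<open>b \<mapsto> g b - b\<close>, which forces the norm to hit every fixed point of \<open>g\<close>.\<close>

lemma rigid_norm_surj:
  assumes rigid: "rigid E" and c: "c \<in> centralizer A M" "c \<otimes> g = g \<otimes> c"
  obtains b where "b \<in> centralizer A M" "pnorm g p b = c"
proof -
  let ?C = "centralizer A M" and ?F = "{c \<in> centralizer A M. c \<otimes> g = g \<otimes> c}"
  let ?\<kappa> = "\<lambda>b. b \<otimes> g \<otimes> inv b \<otimes> inv g"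
  have fin: "finite ?C"
    using finite_carrier C.subset finite_subset by blast
  have k1: "card (?\<kappa> ` ?C) * card {b \<in> ?C. ?\<kappa> b = \<one>} = card ?C"
  proof (rule card_image_mult_card_kernel[OF C.subgroup_axioms fin])
    fix a b assume ab: "a \<in> ?C" "b \<in> ?C"
    then have A: "a \<in> A" "b \<in> A" "g \<otimes> inv b \<otimes> inv g \<in> A" "g \<otimes> inv a \<otimes> inv g \<in> A"
      using centralizer_subset A_conj by auto
    have "?\<kappa> (a \<otimes> b) = a \<otimes> (b \<otimes> ((g \<otimes> inv b \<otimes> inv g) \<otimes> (g \<otimes> inv a \<otimes> inv g)))"
      using A by (simp add: group_normalize)
    also have "\<dots> = a \<otimes> ((g \<otimes> inv a \<otimes> inv g) \<otimes> (b \<otimes> (g \<otimes> inv b \<otimes> inv g)))"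
      using A A_comm[OF A(3,4)] A_comm_left[OF A(2,4)] by simp
    finally show "?\<kappa> (a \<otimes> b) = ?\<kappa> a \<otimes> ?\<kappa> b"
      using A by (simp add: m_assoc)
  qed auto
  have k2: "{b \<in> ?C. ?\<kappa> b = \<one>} = ?F"
  proof -
    have "?\<kappa> b = \<one> \<longleftrightarrow> b \<otimes> g = g \<otimes> b" if "b \<in> ?C" for b
    proof -
      have bc: "b \<in> carrier G"
        using that by simp
      have "?\<kappa> b = (b \<otimes> g) \<otimes> inv (g \<otimes> b)"
        using bc by (simp add: group_normalize)
      then show ?thesis
        using bc by (simp add: inv_solve_right')
    qed
    then show ?thesis
      by blast
  qed
  have k3: "card (pnorm g p ` ?C) * card {b \<in> ?C. pnorm g p b = \<one>} = card ?C"
  proof (rule card_image_mult_card_kernel[OF C.subgroup_axioms fin])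
    fix b assume "b \<in> ?C"
    then show "pnorm g p b \<in> carrier G"
      by (rule C.mem_carrier[OF pnorm_centralizer])
    fix a assume "a \<in> ?C"
    with \<open>b \<in> ?C\<close> show "pnorm g p (a \<otimes> b) = pnorm g p a \<otimes> pnorm g p b"
      using centralizer_subset by (intro pnorm_mult g_carrier) blast+
  qed
  have "{b \<in> ?C. pnorm g p b = \<one>} \<subseteq> ?\<kappa> ` ?C"
  proof
    fix b assume "b \<in> {b \<in> ?C. pnorm g p b = \<one>}"
    then obtain a where "a \<in> ?C" "b = ?\<kappa> a"
      using rigid_norm_kernel[OF rigid, of b] by blast
    then show "b \<in> ?\<kappa> ` ?C"
      by simp
  qed
  then have k4: "card {b \<in> ?C. pnorm g p b = \<one>} \<le> card (?\<kappa> ` ?C)"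
    using fin by (intro card_mono) auto
  have "card ?C > 0"
    using fin C.one_closed card_gt_0_iff[of ?C] by blast
  with k4 have "card ?F \<le> card (pnorm g p ` ?C)"
    by (rule card_factor_le[OF k1[unfolded k2] k3])
  moreover have "pnorm g p ` ?C \<subseteq> ?F"
    using pnorm_centralizer pnorm_fixed by blast
  ultimately have "pnorm g p ` ?C = ?F"
    using fin by (intro card_seteq) auto
  then have "c \<in> pnorm g p ` ?C"
    using c by simp
  then show ?thesis
    using that by (elim imageE) simp
qed

text \<open>The natural image of g is y = a^-1 g, which already has the right conjugation action;
  only c = psi(g^p) y^-p stands in the way. It lies in C_A(M) and commutes with g, hence it is the
  norm of some b, and b y has the right p-th power. This is the transgression into H^2(E/M, C_A(M)).
  The values of \<open>\<psi>\<close> on A stay arbitrary, so derivations and sections are covered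
  alike.\<close>

lemma rigid_extend:
  assumes rigid: "rigid E" and \<psi>: "\<psi> \<in> shift_homs M" and a: "a \<in> A"
    and conj: "\<And>m. m \<in> M \<Longrightarrow> g \<otimes> \<psi> (inv g \<otimes> m \<otimes> g) \<otimes> inv g = a \<otimes> \<psi> m \<otimes> inv a"
  obtains \<psi>' where "\<psi>' \<in> shift_homs E" "\<And>m. m \<in> M \<Longrightarrow> \<psi>' m = \<psi> m"
proof -
  define y where "y = inv a \<otimes> g"
  have ac: "a \<in> carrier G" and y: "y \<in> carrier G"
    using a by (auto simp: y_def)
  have psi: "\<psi> m \<in> carrier G" "\<psi> (m \<otimes> n) = \<psi> m \<otimes> \<psi> n" if "m \<in> M" "n \<in> M" for m n
    using that shift_homsD[OF \<psi>] by auto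
  have y_conj: "y \<otimes> \<psi> m = \<psi> (g \<otimes> m \<otimes> inv g) \<otimes> y" if m: "m \<in> M" for m
  proof -
    have "inv g \<otimes> (g \<otimes> m \<otimes> inv g) \<otimes> g = m"
      using m by (simp add: m_assoc)
    then have "g \<otimes> \<psi> m \<otimes> inv g = a \<otimes> \<psi> (g \<otimes> m \<otimes> inv g) \<otimes> inv a"
      using conj[OF g_conj[OF m]] by simp
    then have "inv a \<otimes> (g \<otimes> \<psi> m \<otimes> inv g) \<otimes> g = inv a \<otimes> (a \<otimes> \<psi> (g \<otimes> m \<otimes> inv g) \<otimes> inv a) \<otimes> g"
      by simp
    then show ?thesis
      using ac psi[OF m m] psi[OF g_conj[OF m] g_conj[OF m]] by (simp add: y_def m_assoc)
  qed
  have y_pow_conj: "y [^] i \<otimes> \<psi> m = \<psi> (g [^] i \<otimes> m \<otimes> inv (g [^] i)) \<otimes> y [^] i" if m: "m \<in> M" for m and i :: nat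
  proof (induction i)
    case (Suc i)
    let ?n = "g [^] i \<otimes> m \<otimes> inv (g [^] i)"
    have n: "?n \<in> M" "g \<otimes> ?n \<otimes> inv g \<in> M"
      using g_pow_conj[OF m] g_conj by auto
    have "y [^] Suc i \<otimes> \<psi> m = y \<otimes> (y [^] i \<otimes> \<psi> m)"
      unfolding nat_pow_Suc2[OF y] using y psi m by (simp add: m_assoc)
    also have "\<dots> = (y \<otimes> \<psi> ?n) \<otimes> y [^] i"
      using y psi(1)[OF n(1) n(1)] unfolding Suc.IH by (simp add: m_assoc)
    also have "\<dots> = \<psi> (g \<otimes> ?n \<otimes> inv g) \<otimes> y [^] Suc i"
      unfolding nat_pow_Suc2[OF y] using y psi(1)[OF n(2) n(2)] unfolding y_conj[OF n(1)] by (simp add: m_assoc)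
    also have "g \<otimes> ?n \<otimes> inv g = g [^] Suc i \<otimes> m \<otimes> inv (g [^] Suc i)"
      unfolding nat_pow_Suc2[OF g_carrier] using m by (simp add: group_normalize)
    finally show ?case .
  qed (use m psi in simp)
  obtain u where u: "u \<in> A" "\<psi> (g [^] p) = u \<otimes> g [^] p"
    using shift_homs_decomp[OF \<psi> g_pow_p] M.subset by blast
  have yp: "y [^] p = pnorm g p (inv a) \<otimes> g [^] p" and na: "pnorm g p (inv a) \<in> A"
    using pnorm_pow_eq[of "inv a" g p] pnorm_mem[of "inv a" g p] a by (auto simp: y_def)
  define c where "c = \<psi> (g [^] p) \<otimes> inv (y [^] p)"
  have "c = u \<otimes> inv (pnorm g p (inv a))"
    unfolding c_def yp u using u(1) na by (simp add: group_normalize)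
  then have cA: "c \<in> A" "c \<in> carrier G"
    using u na by auto
  have c_psi: "c \<otimes> \<psi> m = \<psi> m \<otimes> c" if m: "m \<in> M" for m
  proof -
    let ?m = "inv (g [^] p) \<otimes> m \<otimes> g [^] p"
    have m': "?m \<in> M"
      using m g_pow_p by simp
    have "g [^] p \<otimes> ?m \<otimes> inv (g [^] p) = m"
      using m by (simp add: m_assoc)
    then have "y [^] p \<otimes> \<psi> ?m = \<psi> m \<otimes> y [^] p"
      using y_pow_conj[OF m', of p] by simp
    moreover have "\<psi> (g [^] p) \<otimes> \<psi> ?m = \<psi> m \<otimes> \<psi> (g [^] p)"
      using psi(2)[OF g_pow_p m'] psi(2)[OF m g_pow_p] m by (simp add: m_assoc)
    ultimately have 1: "\<psi> (g [^] p) \<otimes> \<psi> ?m = \<psi> m \<otimes> \<psi> (g [^] p)" "y [^] p \<otimes> \<psi> ?m = \<psi> m \<otimes> y [^] p"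
      by auto
    have pc: "\<psi> (g [^] p) \<in> carrier G" "\<psi> ?m \<in> carrier G" "\<psi> m \<in> carrier G"
      using psi(1) g_pow_p m m' by auto
    have 2: "\<psi> ?m \<otimes> inv (y [^] p) = inv (y [^] p) \<otimes> \<psi> m"
    proof -
      have "inv (y [^] p) \<otimes> (y [^] p \<otimes> \<psi> ?m) \<otimes> inv (y [^] p) = inv (y [^] p) \<otimes> (\<psi> m \<otimes> y [^] p) \<otimes> inv (y [^] p)"
        using 1 by simp
      then show ?thesis
        using y pc by (simp add: m_assoc)
    qed
    have "c \<otimes> \<psi> m = \<psi> (g [^] p) \<otimes> (inv (y [^] p) \<otimes> \<psi> m)"
      using y pc by (simp add: c_def m_assoc)
    also have "\<dots> = (\<psi> (g [^] p) \<otimes> \<psi> ?m) \<otimes> inv (y [^] p)"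
      using y pc unfolding 2[symmetric] by (simp add: m_assoc)
    also have "\<dots> = \<psi> m \<otimes> c"
      using y pc unfolding 1 by (simp add: c_def m_assoc)
    finally show ?thesis .
  qed
  \<comment> \<open>psi(m) and m differ by an element of A, which commutes with c, so commuting with
    one is commuting with the other.\<close>
  have "c \<otimes> m = m \<otimes> c" if m: "m \<in> M" for m
  proof -
    obtain v where v: "v \<in> A" "\<psi> m = v \<otimes> m"
      using shift_homs_decomp[OF \<psi> m] M.subset by blast
    have "v \<otimes> (c \<otimes> m) = v \<otimes> (m \<otimes> c)"
      using c_psi[OF m] A_comm_left[OF cA(1) v(1)] cA v m by (simp add: m_assoc)
    then show ?thesis
      using cA v m by simp
  qed
  then have cC: "c \<in> centralizer A M"
    using cA by (simp add: centralizer_def)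
  have "y \<otimes> \<psi> (g [^] p) = \<psi> (g [^] p) \<otimes> y"
  proof -
    have "g \<otimes> g [^] p = g [^] p \<otimes> g"
      using pow_mult_swap[of g g p] by simp
    then have "g \<otimes> g [^] p \<otimes> inv g = g [^] p"
      by (simp add: m_assoc)
    then show ?thesis
      using y_conj[OF g_pow_p] by simp
  qed
  moreover have "y \<otimes> inv (y [^] p) = inv (y [^] p) \<otimes> y"
  proof -
    have "inv (y [^] p) \<otimes> (y [^] p \<otimes> y) \<otimes> inv (y [^] p) = inv (y [^] p) \<otimes> (y \<otimes> y [^] p) \<otimes> inv (y [^] p)"
      using pow_mult_swap[OF y y] by simp
    then show ?thesis
      using y by (simp add: m_assoc)
  qed
  ultimately have "y \<otimes> c = c \<otimes> y"
    using commutes_mult[OF y psi(1)[OF g_pow_p g_pow_p], of "inv (y [^] p)"] y by (simp add: c_def)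
  then have "inv a \<otimes> (g \<otimes> c) = inv a \<otimes> (c \<otimes> g)"
    using A_comm_left[OF cA(1), of "inv a" g] a cA by (simp add: y_def m_assoc)
  then have "c \<otimes> g = g \<otimes> c"
    using ac cA by simp
  then obtain b where b: "b \<in> centralizer A M" "pnorm g p b = c"
    using rigid_norm_surj[OF rigid cC] by blast
  then have bA: "b \<in> A" "b \<in> carrier G" "\<And>m. m \<in> M \<Longrightarrow> b \<otimes> m = m \<otimes> b"
    using centralizer_subset by (auto simp: centralizer_def)
  have by_eq: "b \<otimes> y = (b \<otimes> inv a) \<otimes> g" and ba: "b \<otimes> inv a \<in> A"
    using a bA by (auto simp: y_def m_assoc)
  \<comment> \<open>b commutes with A and with M, hence with the image of \<open>\<psi>\<close>, so
    the correction by b leaves the conjugation relation intact.\<close>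
  have hconj: "b \<otimes> y \<otimes> \<psi> m = \<psi> (g \<otimes> m \<otimes> inv g) \<otimes> (b \<otimes> y)" if m: "m \<in> M" for m
  proof -
    let ?n = "g \<otimes> m \<otimes> inv g"
    have n: "?n \<in> M"
      using g_conj[OF m] .
    obtain v where v: "v \<in> A" "\<psi> ?n = v \<otimes> ?n"
      using shift_homs_decomp[OF \<psi> n] M.subset by blast
    have "b \<otimes> \<psi> ?n = v \<otimes> (b \<otimes> ?n)"
      unfolding v using A_comm_left[OF bA(1) v(1) M.mem_carrier[OF n]] .
    also have "\<dots> = \<psi> ?n \<otimes> b"
      unfolding v(2) bA(3)[OF n] using v(1) bA(2) M.mem_carrier[OF n] by (simp add: m_assoc)
    finally have "b \<otimes> \<psi> ?n = \<psi> ?n \<otimes> b" .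
    moreover have "b \<otimes> y \<otimes> \<psi> m = b \<otimes> \<psi> ?n \<otimes> y"
      using bA(2) y psi(1)[OF m m] psi(1)[OF n n] y_conj[OF m] by (simp add: m_assoc)
    ultimately show ?thesis
      using bA(2) y psi(1)[OF n n] by (simp add: m_assoc)
  qed
  have "(b \<otimes> y) [^] p = pnorm g p b \<otimes> pnorm g p (inv a) \<otimes> g [^] p"
    unfolding by_eq using pnorm_pow_eq[OF A.mem_carrier[OF ba] g_carrier, of p]
      pnorm_mult[of b "inv a" g p] bA a by simp
  also have "\<dots> = c \<otimes> y [^] p"
    unfolding b(2) yp using cA na by (simp add: m_assoc)
  also have "\<dots> = \<psi> (g [^] p)"
    unfolding c_def using y psi(1)[OF g_pow_p g_pow_p] by (simp add: m_assoc)
  finally have hpow: "\<psi> (g [^] p) = (b \<otimes> y) [^] p" ..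
  have "\<psi> \<in> hom (G\<lparr>carrier := M\<rparr>) G"
    using \<psi> by (simp add: shift_homs_def)
  then obtain \<psi>' where \<psi>': "\<psi>' \<in> hom (G\<lparr>carrier := E\<rparr>) G"
    "\<And>m i. m \<in> M \<Longrightarrow> \<psi>' (m \<otimes> g [^] (i::nat)) = \<psi> m \<otimes> (b \<otimes> y) [^] i"
    using hom_extension[OF _ m_closed[OF bA(2) y] hconj hpow] by blast
  have "\<psi>' m = \<psi> m" if "m \<in> M" for m
    using \<psi>'(2)[OF that, of 0] that psi(1) by simp
  moreover have "\<psi>' \<in> shift_homs E"
  proof (rule shift_homsI)
    fix x assume "x \<in> E"
    then obtain m i where x: "m \<in> M" "x = m \<otimes> g [^] (i::nat)"
      unfolding E_eq by blast
    obtain v where v: "v \<in> A" "\<psi> m = v \<otimes> m"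
      using shift_homs_decomp[OF \<psi> x(1)] M.subset by blast
    let ?n = "pnorm g i (b \<otimes> inv a)"
    have n: "?n \<in> A"
      using pnorm_mem[OF ba] by simp
    have "\<psi>' x \<otimes> inv x = v \<otimes> (m \<otimes> ?n \<otimes> inv m)"
      unfolding x \<psi>'(2)[OF x(1)] v by_eq pnorm_pow_eq[OF A.mem_carrier[OF ba] g_carrier]
      using x(1) v(1) n by (simp add: group_normalize)
    then show "\<psi>' x \<otimes> inv x \<in> A"
      using x(1) v(1) A_conj[OF _ n] by simp
  qed (use \<psi>'(1) in \<open>simp_all add: hom_def Pi_iff\<close>)
  ultimately show ?thesis
    using that by blast
qed

definition conj_shift :: "('a \<Rightarrow> 'a) \<Rightarrow> 'a \<Rightarrow> 'a"
  where "conj_shift \<psi> m = g \<otimes> \<psi> (inv g \<otimes> m \<otimes> g) \<otimes> inv g"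

lemma conj_shift_homs:
  assumes "\<psi> \<in> shift_homs M"
  shows "conj_shift \<psi> \<in> shift_homs M"
proof (rule shift_homsI)
  fix m assume m: "m \<in> M"
  obtain v where v: "v \<in> A" "\<psi> (inv g \<otimes> m \<otimes> g) = v \<otimes> (inv g \<otimes> m \<otimes> g)"
    using shift_homs_decomp[OF assms inv_g_conj[OF m]] M.subset by blast
  then have eq: "conj_shift \<psi> m = g \<otimes> v \<otimes> inv g \<otimes> m"
    using m by (simp add: conj_shift_def m_assoc)
  then show "conj_shift \<psi> m \<in> carrier G"
    using v m by simp
  have "conj_shift \<psi> m \<otimes> inv m = g \<otimes> v \<otimes> inv g"
    unfolding eq using v m by (simp add: m_assoc)
  then show "conj_shift \<psi> m \<otimes> inv m \<in> A"
    using v A_conj by simp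
  fix n assume n: "n \<in> M"
  have "inv g \<otimes> (m \<otimes> n) \<otimes> g = (inv g \<otimes> m \<otimes> g) \<otimes> (inv g \<otimes> n \<otimes> g)"
    using m n by (simp add: m_assoc)
  then show "conj_shift \<psi> (m \<otimes> n) = conj_shift \<psi> m \<otimes> conj_shift \<psi> n"
    using inv_g_conj[OF m] inv_g_conj[OF n] shift_homsD[OF assms] by (simp add: conj_shift_def m_assoc)
qed

text \<open>A shift homomorphism trivial on A is a section of M -> M/A. Conjugating it by g gives
  another one, and rigidity of M makes the two conjugate under A, as \<open>rigid_extend\<close>
  demands.\<close>

lemma split_extend:
  assumes "rigid E" "rigid M" and \<psi>: "\<psi> \<in> shift_homs M" "\<And>a. a \<in> A \<Longrightarrow> \<psi> a = \<one>"
  obtains \<psi>' where "\<psi>' \<in> shift_homs E" "\<And>a. a \<in> A \<Longrightarrow> \<psi>' a = \<one>"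
proof -
  have "conj_shift \<psi> a = \<psi> a" if "a \<in> A" for a
    using that \<psi>(2) A_conj' by (simp add: conj_shift_def)
  then obtain b where b: "b \<in> A" "\<And>x. x \<in> M \<Longrightarrow> conj_shift \<psi> x = b \<otimes> \<psi> x \<otimes> inv b"
    using rigid_conj[OF assms(2) step_subgroup A_subset_M conj_shift_homs[OF \<psi>(1)] \<psi>(1)] by blast
  obtain \<psi>' where \<psi>': "\<psi>' \<in> shift_homs E" "\<And>m. m \<in> M \<Longrightarrow> \<psi>' m = \<psi> m"
    using rigid_extend[OF assms(1) \<psi>(1) b(1) b(2)[unfolded conj_shift_def]] by blast
  have "\<psi>' a = \<one>" if "a \<in> A" for a
    using \<psi>'(2)[of a] \<psi>(2)[OF that] A_subset_M that by auto
  then show ?thesis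
    by (rule that[OF \<psi>'(1)])
qed

end

section \<open>Descent of rigidity\<close>

lemma (in group) rcos_eq_iff:
  assumes "subgroup H G" "x \<in> carrier G" "y \<in> carrier G"
  shows "H #> x = H #> y \<longleftrightarrow> x \<otimes> inv y \<in> H"
proof
  assume "H #> x = H #> y"
  then have "x \<in> H #> y"
    using rcos_self[OF assms(2,1)] by simp
  then show "x \<otimes> inv y \<in> H"
    by (rule subgroup.rcos_module_imp[OF assms(1) is_group assms(3)])
next
  assume "x \<otimes> inv y \<in> H"
  then have "x \<in> H #> y"
    by (rule subgroup.rcos_module_rev[OF assms(1) is_group assms(3,2)])
  then show "H #> x = H #> y"
    using repr_independence[OF _ assms(3,1)] by simp
qed

text \<open>\<open>\<sigma>\<close> induces on G/N a map of p-power period that fixes the trivial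
  coset. The number of fixed cosets is divisible by p, so there is a second one.\<close>

lemma (in p_group) fixed_coset:
  assumes N: "N \<lhd> G" "N \<noteq> carrier G" and \<sigma>: "\<sigma> \<in> hom G G" "\<And>x. x \<in> N \<Longrightarrow> \<sigma> x \<in> N"
    and pow: "\<And>x. x \<in> carrier G \<Longrightarrow> \<exists>n \<in> N. (\<sigma> ^^ (p ^ k)) x = n \<otimes> x"
  obtains x n where "x \<in> carrier G" "x \<notin> N" "n \<in> N" "\<sigma> x = n \<otimes> x"
proof -
  interpret N: normal N G by (rule N(1))
  interpret Q: p_group "G Mod N" p
    using N(1) by (rule p_group_Mod)
  interpret \<sigma>: group_hom G G \<sigma>
    by (intro group_hom.intro group_hom_axioms.intro is_group \<sigma>(1))
  have N_sub: "subgroup N G"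
    by (rule N.subgroup_axioms)
  have carr: "carrier (G Mod N) = (#>) N ` carrier G"
    by (auto simp: FactGroup_def RCOSETS_def)
  have hom: "(\<lambda>x. N #> \<sigma> x) \<in> hom G (G Mod N)"
    using Group.hom_compose[OF \<sigma>(1) N.r_coset_hom_Mod] by (simp add: comp_def)
  have wd: "N #> \<sigma> x = N #> \<sigma> y" if "x \<in> carrier G" "y \<in> carrier G" "N #> x = N #> y" for x y
  proof -
    have "\<sigma> (x \<otimes> inv y) \<in> N"
      using that by (intro \<sigma>(2)) (simp add: rcos_eq_iff N_sub)
    then show ?thesis
      using that by (simp add: rcos_eq_iff N_sub)
  qed
  obtain \<tau> where \<tau>: "\<And>x. x \<in> carrier G \<Longrightarrow> \<tau> (N #> x) = N #> \<sigma> x"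
    using FactGroup_universal[OF hom N(1)] wd by metis
  have closed: "(\<sigma> ^^ n) x \<in> carrier G" if "x \<in> carrier G" for n x
    using that by (induction n) auto
  have \<tau>_pow: "(\<tau> ^^ n) (N #> x) = N #> (\<sigma> ^^ n) x" if "x \<in> carrier G" for n x
    using that by (induction n) (auto simp: \<tau> closed)
  let ?F = "{C \<in> carrier (G Mod N). \<tau> C = C}"
  have cong: "[card (carrier (G Mod N)) = card ?F] (mod p)"
  proof (rule card_fixed_points_funpow_cong[OF prime_p Q.finite_carrier, where k = k])
    fix C assume "C \<in> carrier (G Mod N)"
    then obtain x where x: "x \<in> carrier G" "C = N #> x"
      unfolding carr by blast
    then show "\<tau> C \<in> carrier (G Mod N)"
      by (simp add: \<tau> carr)
    obtain n where n: "n \<in> N" "(\<sigma> ^^ (p ^ k)) x = n \<otimes> x"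
      using pow[OF x(1)] by blast
    have "N #> (\<sigma> ^^ (p ^ k)) x = N #> x"
      unfolding n(2) using n(1) x(1) by (simp add: rcos_eq_iff N_sub m_assoc)
    then show "(\<tau> ^^ (p ^ k)) C = C"
      using x \<tau>_pow by simp
  qed
  obtain m where m: "card (carrier (G Mod N)) = p ^ m"
    using Q.order_power by (auto simp: order_def)
  obtain y where y: "y \<in> carrier G" "y \<notin> N"
    using N(2) N.subset by blast
  have "N #> y \<noteq> N"
    using coset_join1[OF _ y(1) N_sub] y(2) by blast
  have N_one: "N #> \<one> = N"
    by (rule coset_join2[OF one_closed N_sub N.one_closed])
  have "N \<in> (#>) N ` carrier G"
    using imageI[of \<one> "carrier G" "(#>) N"] N_one by simp
  moreover have "\<tau> N = N"
    using \<tau>[OF one_closed] N_one by simp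
  ultimately have NF: "N \<in> ?F"
    by (simp add: carr)
  have "m \<noteq> 0"
  proof
    assume "m = 0"
    then obtain C where C: "carrier (G Mod N) = {C}"
      using m card_1_singletonE[of "carrier (G Mod N)"] by auto
    have "N #> y \<in> carrier (G Mod N)"
      unfolding carr using y(1) by (rule imageI)
    then show False
      using NF \<open>N #> y \<noteq> N\<close> C by simp
  qed
  then have "p dvd card ?F"
    using cong cong_dvd_iff[of "card (carrier (G Mod N))" "card ?F" p] m by simp
  moreover have "finite ?F"
    using Q.finite_carrier by simp
  then have "card ?F > 0"
    using NF card_gt_0_iff[of ?F] by (metis (no_types) empty_iff)
  ultimately have "card ?F \<noteq> 1"
    using p_gt_1 by auto
  then have "?F \<noteq> {N}"
    by auto
  then obtain C where C: "C \<in> ?F" "C \<noteq> N"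
    using NF by (metis (no_types, lifting) insertCI singletonI subsetI subset_antisym singletonD)
  then have "C \<in> (#>) N ` carrier G"
    unfolding carr by simp
  then obtain x where x: "x \<in> carrier G" "C = N #> x"
    by (elim imageE)
  have "N #> \<sigma> x = N #> x"
    using C x \<tau> by simp
  then have "\<sigma> x \<otimes> inv x \<in> N"
    using x by (simp add: rcos_eq_iff N_sub)
  moreover have "x \<notin> N"
    using C(2) x coset_join2[OF x(1) N_sub] by blast
  moreover have "\<sigma> x = \<sigma> x \<otimes> inv x \<otimes> x"
    using x by (simp add: m_assoc)
  ultimately show ?thesis
    using that x(1) by blast
qed

section \<open>The group of derivations and the action of g on it\<close>

context module_step
begin

text \<open>A direct product of copies of A serves as ambient group, so that the derivations form a
  finite p-group to which \<open>fixed_coset\<close> applies.\<close>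

definition fun_group :: "('a \<Rightarrow> 'a) monoid"
  where "fun_group = product_group M (\<lambda>_. G\<lparr>carrier := A\<rparr>)"

text \<open>Multiplicative crossed homomorphisms; being trivial on A means that they come from
  M/A.\<close>

definition derivations :: "('a \<Rightarrow> 'a) set"
  where "derivations = {\<delta> \<in> M \<rightarrow>\<^sub>E A. (\<forall>x\<in>M. \<forall>y\<in>M. \<delta> (x \<otimes> y) = \<delta> x \<otimes> (x \<otimes> \<delta> y \<otimes> inv x)) \<and>
    (\<forall>a\<in>A. \<delta> a = \<one>)}"

text \<open>The coboundary of b: multiplying its value at x by x gives b x b^-1.\<close>

definition principal_der :: "'a \<Rightarrow> 'a \<Rightarrow> 'a"
  where "principal_der b = (\<lambda>x\<in>M. b \<otimes> (x \<otimes> inv b \<otimes> inv x))"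

lemma group_A: "group (G\<lparr>carrier := A\<rparr>)"
  by (rule subgroup_imp_group[OF subgroup_A])

lemma carrier_fun_group: "carrier fun_group = M \<rightarrow>\<^sub>E A"
  by (simp add: fun_group_def)

lemma mult_fun_group: "\<delta> \<otimes>\<^bsub>fun_group\<^esub> \<epsilon> = (\<lambda>x\<in>M. \<delta> x \<otimes> \<epsilon> x)"
  by (simp add: fun_group_def)

lemma inv_fun_group:
  assumes "\<delta> \<in> M \<rightarrow>\<^sub>E A"
  shows "inv\<^bsub>fun_group\<^esub> \<delta> = (\<lambda>x\<in>M. inv (\<delta> x))"
proof -
  have "inv\<^bsub>fun_group\<^esub> \<delta> = (\<lambda>x\<in>M. inv\<^bsub>G\<lparr>carrier := A\<rparr>\<^esub> (\<delta> x))"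
    unfolding fun_group_def by (rule inv_product_group) (use assms group_A in auto)
  also have "\<dots> = (\<lambda>x\<in>M. inv (\<delta> x))"
    using assms by (intro restrict_ext m_inv_consistent[OF subgroup_A]) auto
  finally show ?thesis .
qed

lemma p_group_fun_group: "p_group fun_group p"
proof -
  have group: "group fun_group"
    unfolding fun_group_def using group_A by simp
  have finM: "finite M" and finA: "finite A"
    using finite_carrier M.subset A.subset finite_subset by blast+
  obtain n where "card A = p ^ n"
    using card_subgroup[OF subgroup_A] .
  then have "order fun_group = p ^ (n * card M)"
    unfolding order_def carrier_fun_group using finM by (simp add: card_PiE power_mult)
  moreover have "finite (carrier fun_group)"
    unfolding carrier_fun_group using finM finA by (intro finite_PiE) auto
  ultimately show ?thesis
    using group prime_p by (simp add: p_group_def p_group_axioms_def) blast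
qed

lemma derivationsD:
  assumes "\<delta> \<in> derivations"
  shows "\<delta> \<in> M \<rightarrow>\<^sub>E A" "x \<in> M \<Longrightarrow> \<delta> x \<in> A"
    "x \<in> M \<Longrightarrow> y \<in> M \<Longrightarrow> \<delta> (x \<otimes> y) = \<delta> x \<otimes> (x \<otimes> \<delta> y \<otimes> inv x)"
    "a \<in> A \<Longrightarrow> \<delta> a = \<one>"
  using assms by (auto simp: derivations_def)

lemma derivationsI:
  assumes "\<And>x. x \<in> M \<Longrightarrow> \<delta> x \<in> A"
    "\<And>x y. x \<in> M \<Longrightarrow> y \<in> M \<Longrightarrow> \<delta> (x \<otimes> y) = \<delta> x \<otimes> (x \<otimes> \<delta> y \<otimes> inv x)"
    "\<And>a. a \<in> A \<Longrightarrow> \<delta> a = \<one>"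
  shows "restrict \<delta> M \<in> derivations"
  using assms A_subset_M by (auto simp: derivations_def)

lemma subgroup_derivations: "subgroup derivations fun_group"
proof -
  interpret F: p_group fun_group p
    by (rule p_group_fun_group)
  show ?thesis
  proof (rule F.subgroupI)
    show "derivations \<subseteq> carrier fun_group"
      using derivationsD(1) carrier_fun_group by blast
    have "restrict (\<lambda>x. \<one>) M \<in> derivations"
      by (rule derivationsI) simp_all
    then show "derivations \<noteq> {}"
      by blast
  next
    fix \<delta> assume d: "\<delta> \<in> derivations"
    have "restrict (\<lambda>x. inv (\<delta> x)) M \<in> derivations"
    proof (rule derivationsI)
      fix x y assume xy: "x \<in> M" "y \<in> M"
      then have A: "\<delta> x \<in> A" "\<delta> y \<in> A" "x \<otimes> inv (\<delta> y) \<otimes> inv x \<in> A"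
        using derivationsD(2)[OF d] A_conj by auto
      have "inv (\<delta> (x \<otimes> y)) = (x \<otimes> inv (\<delta> y) \<otimes> inv x) \<otimes> inv (\<delta> x)"
        using xy A(1,2) by (simp add: derivationsD(3)[OF d xy] group_normalize)
      then show "inv (\<delta> (x \<otimes> y)) = inv (\<delta> x) \<otimes> (x \<otimes> inv (\<delta> y) \<otimes> inv x)"
        using A_comm[OF A(3), of "inv (\<delta> x)"] A(1) by simp
    qed (use derivationsD[OF d] in auto)
    then show "inv\<^bsub>fun_group\<^esub> \<delta> \<in> derivations"
      using inv_fun_group[OF derivationsD(1)[OF d]] by simp
  next
    fix \<delta> \<epsilon> assume d: "\<delta> \<in> derivations" and e: "\<epsilon> \<in> derivations"
    have "restrict (\<lambda>x. \<delta> x \<otimes> \<epsilon> x) M \<in> derivations"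
    proof (rule derivationsI)
      fix x y assume xy: "x \<in> M" "y \<in> M"
      then have A: "\<delta> x \<in> A" "\<delta> y \<in> A" "\<epsilon> x \<in> A" "\<epsilon> y \<in> A" "x \<otimes> \<delta> y \<otimes> inv x \<in> A"
        using derivationsD(2)[OF d] derivationsD(2)[OF e] A_conj by auto
      have "\<delta> (x \<otimes> y) \<otimes> \<epsilon> (x \<otimes> y) = \<delta> x \<otimes> ((x \<otimes> \<delta> y \<otimes> inv x) \<otimes> \<epsilon> x) \<otimes> (x \<otimes> \<epsilon> y \<otimes> inv x)"
        using xy A(1-4) by (simp add: derivationsD(3)[OF d xy] derivationsD(3)[OF e xy] m_assoc)
      also have "(x \<otimes> \<delta> y \<otimes> inv x) \<otimes> \<epsilon> x = \<epsilon> x \<otimes> (x \<otimes> \<delta> y \<otimes> inv x)"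
        using A_comm[OF A(5,3)] .
      also have "\<delta> x \<otimes> (\<epsilon> x \<otimes> (x \<otimes> \<delta> y \<otimes> inv x)) \<otimes> (x \<otimes> \<epsilon> y \<otimes> inv x) =
          \<delta> x \<otimes> \<epsilon> x \<otimes> (x \<otimes> (\<delta> y \<otimes> \<epsilon> y) \<otimes> inv x)"
        using xy A(1-4) by (simp add: m_assoc)
      finally show "\<delta> (x \<otimes> y) \<otimes> \<epsilon> (x \<otimes> y) = \<delta> x \<otimes> \<epsilon> x \<otimes> (x \<otimes> (\<delta> y \<otimes> \<epsilon> y) \<otimes> inv x)" .
    qed (use derivationsD[OF d] derivationsD[OF e] in auto)
    then show "\<delta> \<otimes>\<^bsub>fun_group\<^esub> \<epsilon> \<in> derivations"
      by (simp add: mult_fun_group)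
  qed
qed

lemma principal_apply: "x \<in> M \<Longrightarrow> principal_der b x = b \<otimes> (x \<otimes> inv b \<otimes> inv x)"
  by (simp add: principal_der_def)

lemma principal_derivation:
  assumes b: "b \<in> A"
  shows "principal_der b \<in> derivations"
  unfolding principal_der_def
proof (rule derivationsI)
  fix x assume x: "x \<in> M"
  then show "b \<otimes> (x \<otimes> inv b \<otimes> inv x) \<in> A"
    using b A_conj by simp
  fix y assume y: "y \<in> M"
  show "b \<otimes> (x \<otimes> y \<otimes> inv b \<otimes> inv (x \<otimes> y)) =
    b \<otimes> (x \<otimes> inv b \<otimes> inv x) \<otimes> (x \<otimes> (b \<otimes> (y \<otimes> inv b \<otimes> inv y)) \<otimes> inv x)"
    using b x y by (simp add: group_normalize)
next
  fix a assume a: "a \<in> A"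
  then have "a \<otimes> inv b \<otimes> inv a = inv b"
    using A_comm[of a "inv b"] b by (simp add: m_assoc)
  then show "b \<otimes> (a \<otimes> inv b \<otimes> inv a) = \<one>"
    using b by simp
qed

lemma subgroup_principal: "subgroup (principal_der ` A) fun_group"
proof -
  interpret F: p_group fun_group p
    by (rule p_group_fun_group)
  have "principal_der \<in> hom (G\<lparr>carrier := A\<rparr>) fun_group"
  proof (rule homI)
    fix b assume b: "b \<in> carrier (G\<lparr>carrier := A\<rparr>)"
    then show "principal_der b \<in> carrier fun_group"
      using principal_derivation derivationsD(1) by (simp add: carrier_fun_group)
    fix c assume c: "c \<in> carrier (G\<lparr>carrier := A\<rparr>)"
    have "b \<otimes> c \<otimes> (x \<otimes> inv (b \<otimes> c) \<otimes> inv x) = b \<otimes> (x \<otimes> inv b \<otimes> inv x) \<otimes> (c \<otimes> (x \<otimes> inv c \<otimes> inv x))"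
      if x: "x \<in> M" for x
    proof -
      have A: "b \<in> A" "c \<in> A" "x \<otimes> inv b \<otimes> inv x \<in> A" "x \<otimes> inv c \<otimes> inv x \<in> A"
        using b c x A_conj by auto
      have "b \<otimes> c \<otimes> (x \<otimes> inv (b \<otimes> c) \<otimes> inv x) = b \<otimes> (c \<otimes> ((x \<otimes> inv c \<otimes> inv x) \<otimes> (x \<otimes> inv b \<otimes> inv x)))"
        using A(1,2) x by (simp add: group_normalize)
      also have "\<dots> = b \<otimes> (c \<otimes> ((x \<otimes> inv b \<otimes> inv x) \<otimes> (x \<otimes> inv c \<otimes> inv x)))"
        using A_comm[OF A(3,4)] by simp
      also have "\<dots> = b \<otimes> ((x \<otimes> inv b \<otimes> inv x) \<otimes> (c \<otimes> (x \<otimes> inv c \<otimes> inv x)))"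
        using A_comm_left[OF A(2,3) A.mem_carrier[OF A(4)]] by simp
      also have "\<dots> = b \<otimes> (x \<otimes> inv b \<otimes> inv x) \<otimes> (c \<otimes> (x \<otimes> inv c \<otimes> inv x))"
        using A by (intro m_assoc[symmetric]) auto
      finally show ?thesis .
    qed
    then show "principal_der (b \<otimes>\<^bsub>G\<lparr>carrier := A\<rparr>\<^esub> c) = principal_der b \<otimes>\<^bsub>fun_group\<^esub> principal_der c"
      by (simp add: mult_fun_group principal_der_def cong: restrict_cong)
  qed
  then interpret principal_der: group_hom "G\<lparr>carrier := A\<rparr>" fun_group principal_der
    by (intro group_hom.intro group_hom_axioms.intro group_A F.is_group)
  show ?thesis
    using principal_der.img_is_subgroup by simp
qed

definition conj_der :: "('a \<Rightarrow> 'a) \<Rightarrow> 'a \<Rightarrow> 'a"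
  where "conj_der \<delta> = (\<lambda>x\<in>M. g \<otimes> \<delta> (inv g \<otimes> x \<otimes> g) \<otimes> inv g)"

lemma conj_der_apply: "x \<in> M \<Longrightarrow> conj_der \<delta> x = g \<otimes> \<delta> (inv g \<otimes> x \<otimes> g) \<otimes> inv g"
  by (simp add: conj_der_def)

lemma conj_der_derivation:
  assumes d: "\<delta> \<in> derivations"
  shows "conj_der \<delta> \<in> derivations"
  unfolding conj_der_def
proof (rule derivationsI)
  fix x assume x: "x \<in> M"
  let ?x = "inv g \<otimes> x \<otimes> g"
  have x': "?x \<in> M"
    using inv_g_conj[OF x] .
  then show "g \<otimes> \<delta> ?x \<otimes> inv g \<in> A"
    using derivationsD(2)[OF d] A_conj by simp
  fix y assume y: "y \<in> M"
  let ?y = "inv g \<otimes> y \<otimes> g"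
  have y': "?y \<in> M"
    using inv_g_conj[OF y] .
  have "inv g \<otimes> (x \<otimes> y) \<otimes> g = ?x \<otimes> ?y"
    using x y by (simp add: m_assoc)
  then have "g \<otimes> \<delta> (inv g \<otimes> (x \<otimes> y) \<otimes> g) \<otimes> inv g = g \<otimes> (\<delta> ?x \<otimes> (?x \<otimes> \<delta> ?y \<otimes> inv ?x)) \<otimes> inv g"
    using derivationsD(3)[OF d x' y'] by simp
  also have "\<dots> = (g \<otimes> \<delta> ?x \<otimes> inv g) \<otimes> (x \<otimes> (g \<otimes> \<delta> ?y \<otimes> inv g) \<otimes> inv x)"
    using A.mem_carrier[OF derivationsD(2)[OF d x']] A.mem_carrier[OF derivationsD(2)[OF d y']] x y
    by (simp add: group_normalize)
  finally show "g \<otimes> \<delta> (inv g \<otimes> (x \<otimes> y) \<otimes> g) \<otimes> inv g =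
    (g \<otimes> \<delta> ?x \<otimes> inv g) \<otimes> (x \<otimes> (g \<otimes> \<delta> ?y \<otimes> inv g) \<otimes> inv x)" .
next
  fix a assume "a \<in> A"
  then show "g \<otimes> \<delta> (inv g \<otimes> a \<otimes> g) \<otimes> inv g = \<one>"
    using derivationsD(4)[OF d A_conj'[OF g_carrier]] by simp
qed

lemma conj_der_mult:
  assumes "\<delta> \<in> derivations" "\<epsilon> \<in> derivations"
  shows "conj_der (\<delta> \<otimes>\<^bsub>fun_group\<^esub> \<epsilon>) = conj_der \<delta> \<otimes>\<^bsub>fun_group\<^esub> conj_der \<epsilon>"
proof -
  have "g \<otimes> (\<delta> x \<otimes> \<epsilon> x) \<otimes> inv g = g \<otimes> \<delta> x \<otimes> inv g \<otimes> (g \<otimes> \<epsilon> x \<otimes> inv g)" if "x \<in> M" for x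
    using A.mem_carrier[OF derivationsD(2)[OF assms(1) that]] A.mem_carrier[OF derivationsD(2)[OF assms(2) that]]
    by (simp add: m_assoc)
  then show ?thesis
    using inv_g_conj by (simp add: conj_der_def mult_fun_group cong: restrict_cong)
qed

lemma conj_der_principal:
  assumes "b \<in> A"
  shows "conj_der (principal_der b) = principal_der (g \<otimes> b \<otimes> inv g)"
proof -
  have "g \<otimes> principal_der b (inv g \<otimes> x \<otimes> g) \<otimes> inv g = (g \<otimes> b \<otimes> inv g) \<otimes> (x \<otimes> inv (g \<otimes> b \<otimes> inv g) \<otimes> inv x)"
    if "x \<in> M" for x
    unfolding principal_apply[OF inv_g_conj[OF that]] using that assms by (simp add: group_normalize)
  then show ?thesis
    by (simp add: conj_der_def principal_der_def[of "g \<otimes> b \<otimes> inv g"] cong: restrict_cong)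
qed

lemma conj_der_funpow:
  assumes d: "\<delta> \<in> derivations" and x: "x \<in> M"
  shows "(conj_der ^^ i) \<delta> x = g [^] i \<otimes> \<delta> (inv (g [^] i) \<otimes> x \<otimes> g [^] i) \<otimes> inv (g [^] i)"
  using x
proof (induction i arbitrary: x)
  case 0
  then show ?case
    using A.mem_carrier[OF derivationsD(2)[OF d 0]] by simp
next
  case (Suc i)
  let ?y = "inv (g [^] i) \<otimes> (inv g \<otimes> x \<otimes> g) \<otimes> g [^] i"
  have "inv (g [^] Suc i) \<otimes> x \<otimes> g [^] Suc i = ?y"
    unfolding nat_pow_Suc2[OF g_carrier] using Suc.prems by (simp add: group_normalize)
  moreover have "inv (g [^] Suc i) \<otimes> x \<otimes> g [^] Suc i \<in> M"
    using E_normalizes[of "inv (g [^] Suc i)" x] Suc.prems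
      subgroup.m_inv_closed[OF subgroup_E subgroup_pow_mem[OF subgroup_E g_in_E, of "Suc i"]]
    by (simp del: nat_pow_Suc)
  ultimately have y: "?y \<in> M" "inv (g [^] Suc i) \<otimes> x \<otimes> g [^] Suc i = ?y"
    by simp_all
  have "(conj_der ^^ Suc i) \<delta> x = g \<otimes> (g [^] i \<otimes> \<delta> ?y \<otimes> inv (g [^] i)) \<otimes> inv g"
    using Suc.IH[OF inv_g_conj[OF Suc.prems]] Suc.prems by (simp add: conj_der_apply)
  also have "\<dots> = g [^] Suc i \<otimes> \<delta> ?y \<otimes> inv (g [^] Suc i)"
    unfolding nat_pow_Suc2[OF g_carrier]
    using A.mem_carrier[OF derivationsD(2)[OF d y(1)]] by (simp add: group_normalize)
  finally show ?case
    unfolding y(2) .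
qed

text \<open>A group acts trivially on its own cohomology. Evaluating the cocycle rule on g^p y = x
  g^p in two ways shows that g^p, an element of M, changes \<open>\<delta>\<close> only by a
  principal derivation.\<close>

lemma conj_der_funpow_p:
  assumes d: "\<delta> \<in> derivations"
  shows "(conj_der ^^ p) \<delta> = principal_der (inv (\<delta> (g [^] p))) \<otimes>\<^bsub>fun_group\<^esub> \<delta>"
proof -
  let ?k = "g [^] p" and ?v = "\<delta> (g [^] p)"
  have v: "?v \<in> A"
    using derivationsD(2)[OF d g_pow_p] .
  have "(conj_der ^^ n) \<delta> \<in> derivations" for n
    using d conj_der_derivation by (induction n) auto
  then have ext: "(conj_der ^^ p) \<delta> \<in> extensional M"
    using derivationsD(1) by (simp add: PiE_def)
  show ?thesis
  proof (rule extensionalityI[OF ext])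
    show "principal_der (inv ?v) \<otimes>\<^bsub>fun_group\<^esub> \<delta> \<in> extensional M"
      by (simp add: mult_fun_group)
    fix x assume x: "x \<in> M"
    let ?y = "inv ?k \<otimes> x \<otimes> ?k"
    have y: "?y \<in> M"
      using x g_pow_p by simp
    have dA: "\<delta> x \<in> A" "\<delta> ?y \<in> A" "x \<otimes> ?v \<otimes> inv x \<in> A"
      using derivationsD(2)[OF d] x y A_conj v by auto
    have "?k \<otimes> ?y = x \<otimes> ?k"
      using x by (simp add: m_assoc)
    then have "?v \<otimes> (?k \<otimes> \<delta> ?y \<otimes> inv ?k) = \<delta> x \<otimes> (x \<otimes> ?v \<otimes> inv x)"
      using derivationsD(3)[OF d g_pow_p y] derivationsD(3)[OF d x g_pow_p] by simp
    then have "inv ?v \<otimes> (?v \<otimes> (?k \<otimes> \<delta> ?y \<otimes> inv ?k)) = inv ?v \<otimes> (\<delta> x \<otimes> (x \<otimes> ?v \<otimes> inv x))"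
      by simp
    then have "?k \<otimes> \<delta> ?y \<otimes> inv ?k = inv ?v \<otimes> (\<delta> x \<otimes> (x \<otimes> ?v \<otimes> inv x))"
      using v dA(2) by simp
    also have "\<dots> = inv ?v \<otimes> (x \<otimes> ?v \<otimes> inv x) \<otimes> \<delta> x"
      using A_comm[OF dA(1,3)] v dA(1) x by (simp add: m_assoc)
    finally show "(conj_der ^^ p) \<delta> x = (principal_der (inv ?v) \<otimes>\<^bsub>fun_group\<^esub> \<delta>) x"
      using x v by (simp add: conj_der_funpow[OF d x] mult_fun_group principal_apply)
  qed
qed

lemma derivation_shift_hom:
  assumes d: "\<delta> \<in> derivations"
  shows "(\<lambda>x. \<delta> x \<otimes> x) \<in> shift_homs M"
proof (rule shift_homsI)
  fix x assume x: "x \<in> M"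
  have dx: "\<delta> x \<in> A"
    using derivationsD(2)[OF d x] .
  then show "\<delta> x \<otimes> x \<in> carrier G" "\<delta> x \<otimes> x \<otimes> inv x \<in> A"
    using x by (simp_all add: m_assoc)
  fix y assume y: "y \<in> M"
  show "\<delta> (x \<otimes> y) \<otimes> (x \<otimes> y) = \<delta> x \<otimes> x \<otimes> (\<delta> y \<otimes> y)"
    using x y dx derivationsD(2)[OF d y] by (simp add: derivationsD(3)[OF d x y] m_assoc)
qed

lemma shift_hom_derivation:
  assumes \<psi>: "\<psi> \<in> shift_homs M" "\<And>a. a \<in> A \<Longrightarrow> \<psi> a = a"
  shows "(\<lambda>x\<in>M. \<psi> x \<otimes> inv x) \<in> derivations"
proof (rule derivationsI)
  fix x assume x: "x \<in> M"
  show "\<psi> x \<otimes> inv x \<in> A"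
    using shift_homsD(3)[OF \<psi>(1) x] .
  fix y assume y: "y \<in> M"
  show "\<psi> (x \<otimes> y) \<otimes> inv (x \<otimes> y) = \<psi> x \<otimes> inv x \<otimes> (x \<otimes> (\<psi> y \<otimes> inv y) \<otimes> inv x)"
    using x y shift_homsD(1)[OF \<psi>(1)] by (simp add: shift_homsD(2)[OF \<psi>(1) x y] group_normalize)
qed (simp add: \<psi>(2))

text \<open>A non-principal derivation of \<open>M\<close> would yield one whose class is fixed by \<open>g\<close>, because \<open>g\<close>
  acts on the \<open>p\<close>-group of derivations modulo principal ones with trivial \<open>p\<close>-th power; such a
  derivation extends to \<open>E\<close>.\<close>

lemma rigid_descend:
  assumes rigid: "rigid E"
  shows "rigid M"
proof (rule ccontr)
  interpret F: p_group fun_group p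
    by (rule p_group_fun_group)
  let ?H = "fun_group\<lparr>carrier := derivations\<rparr>"
  interpret H: p_group ?H p
    by (rule F.p_group_restrict[OF subgroup_derivations])
  assume "\<not> rigid M"
  then obtain \<psi> where \<psi>: "\<psi> \<in> shift_homs M" "\<forall>a\<in>A. \<psi> a = a"
    and not: "\<not> (\<exists>b\<in>A. \<forall>x\<in>M. \<psi> x = b \<otimes> x \<otimes> inv b)"
    unfolding rigid_def by blast
  have not_principal: "(\<lambda>x\<in>M. \<psi> x \<otimes> inv x) \<notin> principal_der ` A"
  proof
    assume "(\<lambda>x\<in>M. \<psi> x \<otimes> inv x) \<in> principal_der ` A"
    then obtain b where b: "b \<in> A" "(\<lambda>x\<in>M. \<psi> x \<otimes> inv x) = principal_der b"
      by blast
    have "\<psi> x = b \<otimes> x \<otimes> inv b" if x: "x \<in> M" for x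
    proof -
      have "\<psi> x \<otimes> inv x = b \<otimes> (x \<otimes> inv b \<otimes> inv x)"
        using fun_cong[OF b(2), of x] x by (simp add: principal_apply)
      then have "\<psi> x \<otimes> inv x \<otimes> x = b \<otimes> (x \<otimes> inv b \<otimes> inv x) \<otimes> x"
        by simp
      then show ?thesis
        using x b(1) shift_homsD(1)[OF \<psi>(1) x] by (simp add: m_assoc)
    qed
    with not b(1) show False
      by blast
  qed
  have sub: "subgroup (principal_der ` A) ?H"
    by (rule F.subgroup_incl[OF subgroup_principal subgroup_derivations])
      (use principal_derivation in blast)
  \<comment> \<open>The values lie in the abelian group A, so derivations commute and every subgroup
    is normal.\<close>
  have normal: "principal_der ` A \<lhd> ?H"
  proof (rule H.normal_invI[OF sub])
    fix \<delta> \<epsilon> assume d: "\<delta> \<in> principal_der ` A" and e: "\<epsilon> \<in> carrier ?H"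
    have "\<epsilon> \<otimes>\<^bsub>?H\<^esub> \<delta> = \<delta> \<otimes>\<^bsub>?H\<^esub> \<epsilon>"
    proof -
      have "\<delta> \<in> derivations" "\<epsilon> \<in> derivations"
        using d e principal_derivation by auto
      then have "\<epsilon> x \<otimes> \<delta> x = \<delta> x \<otimes> \<epsilon> x" if "x \<in> M" for x
        using derivationsD(2) that by (intro A_comm) auto
      then show ?thesis
        by (simp add: mult_fun_group cong: restrict_cong)
    qed
    moreover have "\<delta> \<in> carrier ?H"
      using subgroup.subset[OF sub] d by blast
    ultimately show "\<epsilon> \<otimes>\<^bsub>?H\<^esub> \<delta> \<otimes>\<^bsub>?H\<^esub> inv\<^bsub>?H\<^esub> \<epsilon> \<in> principal_der ` A"
      using d H.m_assoc[OF \<open>\<delta> \<in> carrier ?H\<close> e H.inv_closed[OF e]] H.r_inv[OF e] H.r_one by metis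
  qed
  have ne: "principal_der ` A \<noteq> carrier ?H"
    using shift_hom_derivation[OF \<psi>(1)] \<psi>(2) not_principal by auto
  have hom: "conj_der \<in> hom ?H ?H"
    using conj_der_derivation conj_der_mult by (auto simp: hom_def)
  have closed: "conj_der \<delta> \<in> principal_der ` A" if "\<delta> \<in> principal_der ` A" for \<delta>
    using that conj_der_principal A_conj by auto
  have pow: "\<exists>n\<in>principal_der ` A. (conj_der ^^ (p ^ 1)) \<delta> = n \<otimes>\<^bsub>?H\<^esub> \<delta>" if "\<delta> \<in> carrier ?H" for \<delta>
  proof -
    have "\<delta> (g [^] p) \<in> A"
      using that derivationsD(2)[OF _ g_pow_p] by simp
    then show ?thesis
      using that conj_der_funpow_p[of \<delta>] by (intro bexI[of _ "principal_der (inv (\<delta> (g [^] p)))"]) simp_all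
  qed
  obtain \<delta> \<pi> where "\<delta> \<in> carrier ?H" "\<delta> \<notin> principal_der ` A" "\<pi> \<in> principal_der ` A"
    "conj_der \<delta> = \<pi> \<otimes>\<^bsub>?H\<^esub> \<delta>"
    using H.fixed_coset[OF normal ne hom closed pow] by blast
  then have \<delta>: "\<delta> \<in> derivations" "\<delta> \<notin> principal_der ` A" "\<pi> \<in> principal_der ` A"
    "conj_der \<delta> = \<pi> \<otimes>\<^bsub>fun_group\<^esub> \<delta>"
    by simp_all
  then obtain b where b: "b \<in> A" "\<pi> = principal_der b"
    by blast
  let ?\<psi> = "\<lambda>x. \<delta> x \<otimes> x"
  \<comment> \<open>That g changes \<open>\<delta>\<close> by the principal derivation of b says for
    the encoded homomorphism that conjugation by g is conjugation by b.\<close>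
  have "g \<otimes> ?\<psi> (inv g \<otimes> m \<otimes> g) \<otimes> inv g = b \<otimes> ?\<psi> m \<otimes> inv b" if m: "m \<in> M" for m
  proof -
    let ?m = "inv g \<otimes> m \<otimes> g"
    have A: "\<delta> m \<in> A" "\<delta> ?m \<in> A" "m \<otimes> inv b \<otimes> inv m \<in> A"
      using derivationsD(2)[OF \<delta>(1)] m inv_g_conj[OF m] A_conj b(1) by auto
    have eq: "g \<otimes> \<delta> ?m \<otimes> inv g = b \<otimes> (m \<otimes> inv b \<otimes> inv m) \<otimes> \<delta> m"
      using fun_cong[OF \<delta>(4), of m] m b by (simp add: conj_der_apply mult_fun_group principal_apply)
    have "g \<otimes> ?\<psi> ?m \<otimes> inv g = (g \<otimes> \<delta> ?m \<otimes> inv g) \<otimes> m"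
      using A(2) m by (simp add: m_assoc)
    also have "\<dots> = b \<otimes> ((m \<otimes> inv b \<otimes> inv m) \<otimes> \<delta> m) \<otimes> m"
      unfolding eq using A(1) m b(1) by (simp add: m_assoc)
    also have "\<dots> = b \<otimes> (\<delta> m \<otimes> (m \<otimes> inv b \<otimes> inv m)) \<otimes> m"
      using A_comm[OF A(1,3)] by simp
    also have "\<dots> = b \<otimes> ?\<psi> m \<otimes> inv b"
      using A(1) m b(1) by (simp add: m_assoc)
    finally show ?thesis .
  qed
  then obtain \<psi>' where \<psi>': "\<psi>' \<in> shift_homs E" "\<And>m. m \<in> M \<Longrightarrow> \<psi>' m = \<delta> m \<otimes> m"
    using rigid_extend[OF rigid derivation_shift_hom[OF \<delta>(1)] b(1)] by blast
  \<comment> \<open>The extension fixes A, so rigidity of E makes it conjugation by some c in A;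
    restricting to M exhibits \<open>\<delta>\<close> as principal after all.\<close>
  have "\<psi>' a = a" if "a \<in> A" for a
    using \<psi>'(2)[of a] derivationsD(4)[OF \<delta>(1) that] A_subset_M that by auto
  then obtain c where c: "c \<in> A" "\<And>x. x \<in> E \<Longrightarrow> \<psi>' x = c \<otimes> x \<otimes> inv c"
    using rigidD[OF rigid \<psi>'(1)] by blast
  have "\<delta> x = principal_der c x" if x: "x \<in> M" for x
  proof -
    have "\<delta> x \<otimes> x = c \<otimes> x \<otimes> inv c"
      using \<psi>'(2)[OF x] c(2)[of x] x M_subset_E by auto
    then have "\<delta> x \<otimes> x \<otimes> inv x = c \<otimes> x \<otimes> inv c \<otimes> inv x"
      by simp
    then show ?thesis
      using x c(1) derivationsD(2)[OF \<delta>(1) x] by (simp add: principal_apply m_assoc)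
  qed
  then have "\<delta> = principal_der c"
    using derivationsD(1)[OF \<delta>(1)] derivationsD(1)[OF principal_derivation[OF c(1)]]
    by (intro extensionalityI[of _ M]) (auto simp: PiE_def)
  then show False
    using \<delta>(2) c(1) by blast
qed

end

section \<open>Central series, normalizers and maximal abelian normal subgroups\<close>

context p_group
begin

lemma p_group_stepI: "cyclic_step M g E \<Longrightarrow> p_group_step G p M g E"
  by (simp add: p_group_step_def p_group_step_axioms_def p_group_axioms)

lemma cyclic_stepI:
  assumes "subgroup M G" "g \<in> carrier G" "g \<notin> M" "g [^] p \<in> M"
    and "\<And>m. m \<in> M \<Longrightarrow> g \<otimes> m \<otimes> inv g \<in> M"
  shows "cyclic_step M g {m \<otimes> g [^] (i::nat) |m i. m \<in> M}"
  using assms by (simp add: cyclic_step_def)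

text \<open>Exponents can be reduced modulo p, since M absorbs the powers of g^p.\<close>

lemma card_cyclic_step_le:
  assumes "cyclic_step M g E"
  shows "card E \<le> card M * p"
proof -
  interpret S: p_group_step G p M g E
    by (rule p_group_stepI[OF assms])
  have fin: "finite (M \<times> {..<p})"
    using finite_subset[OF S.M.subset finite_carrier] by simp
  have "E \<subseteq> (\<lambda>(m, i). m \<otimes> g [^] i) ` (M \<times> {..<p})"
  proof
    fix x assume "x \<in> E"
    then obtain m i where x: "m \<in> M" "x = m \<otimes> g [^] (i::nat)"
      unfolding S.E_eq by blast
    let ?m = "m \<otimes> g [^] (p * (i div p))"
    have "g [^] i = g [^] (p * (i div p)) \<otimes> g [^] (i mod p)"
      by (simp add: nat_pow_mult)
    moreover have "g [^] (p * (i div p)) \<in> M"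
      using S.g_pow_mem_iff by simp
    ultimately have "?m \<in> M" "x = ?m \<otimes> g [^] (i mod p)"
      using x by (simp_all add: m_assoc)
    moreover have "i mod p < p"
      using p_gt_1 by simp
    ultimately show "x \<in> (\<lambda>(m, i). m \<otimes> g [^] i) ` (M \<times> {..<p})"
      by (intro rev_image_eqI[of "(?m, i mod p)"]) simp_all
  qed
  then have "card E \<le> card (M \<times> {..<p})"
    using fin by (meson card_image_le card_mono finite_imageI le_trans)
  then show ?thesis
    by (simp add: card_cartesian_product)
qed

lemma cyclic_step_comm:
  assumes "cyclic_step M g E"
    and comm: "\<And>m n. m \<in> M \<Longrightarrow> n \<in> M \<Longrightarrow> m \<otimes> n = n \<otimes> m"
    and g: "\<And>m. m \<in> M \<Longrightarrow> g \<otimes> m = m \<otimes> g"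
    and xy: "x \<in> E" "y \<in> E"
  shows "x \<otimes> y = y \<otimes> x"
proof -
  interpret S: p_group_step G p M g E
    by (rule p_group_stepI[OF assms(1)])
  obtain m i n j where mn: "m \<in> M" "n \<in> M" "x = m \<otimes> g [^] (i::nat)" "y = n \<otimes> g [^] (j::nat)"
    using xy unfolding S.E_eq by blast
  have "g [^] i \<otimes> n = n \<otimes> g [^] i" "g [^] j \<otimes> m = m \<otimes> g [^] j"
    using mn g by (simp_all add: pow_mult_swap)
  then have "x \<otimes> y = m \<otimes> n \<otimes> g [^] (i + j)" "y \<otimes> x = n \<otimes> m \<otimes> g [^] (i + j)"
    using S.step_mult[OF mn(1,2), of i j] S.step_mult[OF mn(2,1), of j i] mn
    by (simp_all add: m_assoc add.commute)
  then show ?thesis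
    using comm[OF mn(1,2)] by simp
qed

text \<open>Modulo N the group E is generated by x, which is central there.\<close>

lemma cyclic_step_commutators:
  assumes step: "cyclic_step N x E" and N: "N \<lhd> G"
    and x: "\<And>y. y \<in> carrier G \<Longrightarrow> y \<otimes> x \<otimes> inv y \<otimes> inv x \<in> N"
    and a: "a \<in> E" and y: "y \<in> carrier G"
  shows "y \<otimes> a \<otimes> inv y \<otimes> inv a \<in> N"
proof -
  interpret S: p_group_step G p N x E
    by (rule p_group_stepI[OF step])
  have conj: "u \<otimes> n \<otimes> inv u \<in> N" if "u \<in> carrier G" "n \<in> N" for u n
    using normal.inv_op_closed2[OF N that] .
  have pow: "y \<otimes> x [^] i \<otimes> inv y \<otimes> inv (x [^] i) \<in> N" for i :: nat
  proof (induction i)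
    case 0
    then show ?case
      using y by simp
  next
    case (Suc i)
    have "y \<otimes> x [^] Suc i \<otimes> inv y \<otimes> inv (x [^] Suc i) =
        (y \<otimes> x [^] i \<otimes> inv y \<otimes> inv (x [^] i)) \<otimes> (x [^] i \<otimes> (y \<otimes> x \<otimes> inv y \<otimes> inv x) \<otimes> inv (x [^] i))"
      using y by (simp add: group_normalize)
    then show ?case
      using Suc.IH conj[OF _ x[OF y], of "x [^] i"] by simp
  qed
  obtain n i where n: "n \<in> N" "a = n \<otimes> x [^] (i::nat)"
    using a unfolding S.E_eq by blast
  have "y \<otimes> a \<otimes> inv y \<otimes> inv a = (y \<otimes> n \<otimes> inv y) \<otimes> (y \<otimes> x [^] i \<otimes> inv y \<otimes> inv (x [^] i)) \<otimes> inv n"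
    using y n by (simp add: group_normalize)
  then show ?thesis
    using conj[OF y n(1)] pow[of i] n(1) by simp
qed

lemma cyclic_step_normal:
  assumes step: "cyclic_step N x E" and N: "N \<lhd> G"
    and x: "\<And>y. y \<in> carrier G \<Longrightarrow> y \<otimes> x \<otimes> inv y \<otimes> inv x \<in> N"
  shows "E \<lhd> G"
proof -
  interpret S: p_group_step G p N x E
    by (rule p_group_stepI[OF step])
  interpret E: subgroup E G
    by (rule S.subgroup_E)
  show ?thesis
  proof (rule normal_invI[OF S.subgroup_E])
    fix a y assume y: "y \<in> carrier G" and a: "a \<in> E"
    have "y \<otimes> a \<otimes> inv y = (y \<otimes> a \<otimes> inv y \<otimes> inv a) \<otimes> a"
      using y a by (simp add: m_assoc)
    moreover have "y \<otimes> a \<otimes> inv y \<otimes> inv a \<in> E"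
      using cyclic_step_commutators[OF step N x a y] S.M_subset_E by blast
    ultimately show "y \<otimes> a \<otimes> inv y \<in> E"
      using E.m_closed[OF _ a] by metis
  qed
qed

text \<open>One more term of a central series of G, kept inside B.\<close>

lemma central_step:
  assumes "N \<lhd> G" "B \<lhd> G" "N \<subset> B"
  obtains x E where "cyclic_step N x E" "E \<lhd> G" "E \<subseteq> B"
    "\<And>y. y \<in> carrier G \<Longrightarrow> y \<otimes> x \<otimes> inv y \<otimes> inv x \<in> N"
proof -
  obtain x where x: "x \<in> B" "x \<notin> N" "x [^] p \<in> N"
    "\<And>y. y \<in> carrier G \<Longrightarrow> y \<otimes> x \<otimes> inv y \<otimes> inv x \<in> N"
    using relative_central_element[OF assms] by blast
  interpret N: normal N G by (rule assms(1))
  interpret B: normal B G by (rule assms(2))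
  have step: "cyclic_step N x {m \<otimes> x [^] (i::nat) |m i. m \<in> N}" (is "cyclic_step N x ?E")
    using x N.inv_op_closed2 by (intro cyclic_stepI N.subgroup_axioms) auto
  have "?E \<subseteq> B"
  proof
    fix y assume "y \<in> ?E"
    then obtain m i where y: "m \<in> N" "y = m \<otimes> x [^] (i::nat)"
      by blast
    then show "y \<in> B"
      using assms(3) subgroup_pow_mem[OF B.subgroup_axioms x(1)] by auto
  qed
  then show ?thesis
    using that[OF step cyclic_step_normal[OF step assms(1) x(4)]] x(4) by blast
qed

text \<open>Normalizers grow in p-groups. Let N be maximal among the normal subgroups of G inside E,
  and x central modulo N. By maximality x lies outside E, and since the commutators of x fall into
  N, x normalizes E.\<close>

lemma normalizer_step:
  assumes E: "subgroup E G" "E \<noteq> carrier G"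
  obtains g E' where "cyclic_step E g E'"
proof -
  let ?N = "{N. N \<lhd> G \<and> N \<subseteq> E}"
  have "finite ?N"
    by (rule finite_subset[of _ "Pow E"]) (use finite_subset[OF subgroup.subset[OF E(1)] finite_carrier] in auto)
  moreover have "{\<one>} \<in> ?N"
    using one_is_normal subgroup.one_closed[OF E(1)] by simp
  ultimately obtain N where N: "N \<in> ?N" and max: "\<forall>N'\<in>?N. N \<subseteq> N' \<longrightarrow> N = N'"
    using finite_has_maximal[of ?N] by auto
  then have "N \<lhd> G" "N \<subseteq> E"
    by simp_all
  moreover have "carrier G \<lhd> G"
    by (rule normal_invI[OF subgroup_self]) simp
  moreover have "N \<subset> carrier G"
    using E subgroup.subset[OF E(1)] \<open>N \<subseteq> E\<close> by blast
  ultimately obtain x F where x: "cyclic_step N x F" "F \<lhd> G"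
    "\<And>y. y \<in> carrier G \<Longrightarrow> y \<otimes> x \<otimes> inv y \<otimes> inv x \<in> N"
    using central_step[of N "carrier G"] by metis
  interpret S: p_group_step G p N x F
    by (rule p_group_stepI[OF x(1)])
  interpret E: subgroup E G
    by (rule E(1))
  have "x \<notin> E"
  proof
    assume "x \<in> E"
    then have "F \<subseteq> E"
      unfolding S.E_eq using \<open>N \<subseteq> E\<close> subgroup_pow_mem[OF E(1)] by auto
    then have "N = F"
      using max x(2) S.M_subset_E by auto
    then show False
      using S.g_in_E S.g_notin by simp
  qed
  have conj: "x \<otimes> e \<otimes> inv x \<in> E" if e: "e \<in> E" for e
  proof -
    have "inv (e \<otimes> x \<otimes> inv e \<otimes> inv x) \<in> N"
      using x(3)[of e] e by simp
    then have "inv (e \<otimes> x \<otimes> inv e \<otimes> inv x) \<in> E"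
      using \<open>N \<subseteq> E\<close> by blast
    moreover have "x \<otimes> e \<otimes> inv x = inv (e \<otimes> x \<otimes> inv e \<otimes> inv x) \<otimes> e"
      using e by (simp add: group_normalize)
    ultimately show ?thesis
      using e by simp
  qed
  have "x [^] p \<in> E"
    using S.g_pow_p \<open>N \<subseteq> E\<close> by blast
  then show ?thesis
    using that[OF cyclic_stepI[OF E(1) S.g_carrier \<open>x \<notin> E\<close> _ conj]] by blast
qed

text \<open>Were A smaller than its centralizer, a central step inside the normal subgroup C_G(A)
  would adjoin an element commuting with A and produce a larger abelian normal subgroup.\<close>

lemma maximal_abelian_normal:
  assumes N: "N \<lhd> G" "\<And>x y. x \<in> N \<Longrightarrow> y \<in> N \<Longrightarrow> x \<otimes> y = y \<otimes> x"
  obtains A where "p_group_module G p A" "N \<subseteq> A" "centralizer (carrier G) A = A"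
proof -
  let ?F = "{A. A \<lhd> G \<and> (\<forall>x\<in>A. \<forall>y\<in>A. x \<otimes> y = y \<otimes> x)}"
  have "finite ?F"
    by (rule finite_subset[of _ "Pow (carrier G)"])
      (use finite_carrier normal_imp_subgroup subgroup.subset in blast)+
  moreover have "N \<in> ?F"
    using N by simp
  ultimately obtain A where A: "A \<in> ?F" "N \<subseteq> A" and max: "\<forall>B\<in>?F. A \<subseteq> B \<longrightarrow> A = B"
    using finite_has_maximal2[of ?F N] by auto
  then have nA: "A \<lhd> G" and cA: "\<And>x y. x \<in> A \<Longrightarrow> y \<in> A \<Longrightarrow> x \<otimes> y = y \<otimes> x"
    by auto
  interpret A: normal A G by (rule nA)
  let ?C = "centralizer (carrier G) A"
  have AC: "A \<subseteq> ?C"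
    using cA A.subset by (auto simp: centralizer_def)
  have "?C \<lhd> G"
  proof (rule normal_invI[OF subgroup_centralizer[OF subgroup_self A.subset]])
    fix c y assume y: "y \<in> carrier G" and c: "c \<in> ?C"
    then have cc: "c \<in> carrier G" "\<And>a. a \<in> A \<Longrightarrow> c \<otimes> a = a \<otimes> c"
      by (auto simp: centralizer_def)
    have "y \<otimes> c \<otimes> inv y \<otimes> a = a \<otimes> (y \<otimes> c \<otimes> inv y)" if a: "a \<in> A" for a
    proof -
      have a': "inv y \<otimes> a \<otimes> y \<in> A"
        using A.inv_op_closed1[OF y a] .
      have "y \<otimes> c \<otimes> inv y \<otimes> a = y \<otimes> (c \<otimes> (inv y \<otimes> a \<otimes> y)) \<otimes> inv y"
        using y cc(1) a by (simp add: m_assoc)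
      also have "\<dots> = a \<otimes> (y \<otimes> c \<otimes> inv y)"
        unfolding cc(2)[OF a'] using y cc(1) a by (simp add: m_assoc)
      finally show ?thesis .
    qed
    then show "y \<otimes> c \<otimes> inv y \<in> ?C"
      using y cc(1) by (simp add: centralizer_def)
  qed
  have "A = ?C"
  proof (rule ccontr)
    assume "A \<noteq> ?C"
    then have "A \<subset> ?C"
      using AC by blast
    then obtain x E where E: "cyclic_step A x E" "E \<lhd> G" "E \<subseteq> ?C"
      using central_step[OF nA \<open>?C \<lhd> G\<close>] by metis
    interpret S: p_group_step G p A x E
      by (rule p_group_stepI[OF E(1)])
    have "x \<otimes> a = a \<otimes> x" if "a \<in> A" for a
      using E(3) S.g_in_E that by (auto simp: centralizer_def)
    then have "x \<otimes> y = y \<otimes> x" if "x \<in> E" "y \<in> E" for x y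
      using cyclic_step_comm[OF E(1) cA _ that] by blast
    then have "A = E"
      using max E(2) S.M_subset_E by auto
    then show False
      using S.g_in_E S.g_notin by simp
  qed
  moreover have "p_group_module G p A"
    by (intro p_group_module.intro p_group_axioms p_group_module_axioms.intro nA cA)
  ultimately show ?thesis
    using that A(2) by metis
qed

end

section \<open>From G to its subgroups containing A, and the splitting over A\<close>

context p_group_module
begin

lemma module_stepI:
  assumes "cyclic_step M g E" "A \<subseteq> M"
  shows "module_step G p A M g E"
  by (intro module_step.intro p_group_module_axioms p_group_stepI module_step_axioms.intro assms)

text \<open>By \<open>normalizer_step\<close> each E is reached from G by descending through steps
  of index p, and each of them preserves rigidity.\<close>

lemma rigid_subgroup:
  assumes rigid: "rigid (carrier G)"
  shows "subgroup E G \<Longrightarrow> A \<subseteq> E \<Longrightarrow> rigid E"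
proof (induction "card (carrier G) - card E" arbitrary: E rule: less_induct)
  case less
  show ?case
  proof (cases "E = carrier G")
    case False
    then obtain g E' where step: "cyclic_step E g E'"
      using normalizer_step[OF less.prems(1)] by blast
    interpret S: module_step G p A E g E'
      by (rule module_stepI[OF step less.prems(2)])
    have "E \<subset> E'"
      using S.M_subset_E S.g_in_E S.g_notin by blast
    moreover have fin: "finite E'"
      using finite_subset[OF S.E_subset finite_carrier] .
    ultimately have "card E < card E'"
      by (simp add: psubset_card_mono)
    moreover have "card E' \<le> card (carrier G)"
      by (rule card_mono[OF finite_carrier S.E_subset])
    ultimately have "rigid E'"
      using S.subgroup_E less.prems(2) S.M_subset_E by (intro less.hyps) auto
    then show ?thesis
      by (rule S.rigid_descend)
  qed (use rigid in simp)
qed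

text \<open>A shift homomorphism trivial on A is a section of G -> G/A. Over A itself the constant
  map to the identity is one; a maximal subgroup carrying a section must be G, because
  \<open>split_extend\<close> lifts it through the next step.\<close>

lemma rigid_split:
  assumes rigid: "rigid (carrier G)"
  obtains \<psi> where "\<psi> \<in> shift_homs (carrier G)" "\<And>a. a \<in> A \<Longrightarrow> \<psi> a = \<one>"
proof -
  let ?F = "{E. subgroup E G \<and> A \<subseteq> E \<and> (\<exists>\<psi>\<in>shift_homs E. \<forall>a\<in>A. \<psi> a = \<one>)}"
  have "(\<lambda>x. \<one>) \<in> shift_homs A"
    by (rule shift_homsI) simp_all
  then have "A \<in> ?F"
    using subgroup_A by auto
  then have "?F \<noteq> {}"
    by (metis empty_iff)
  moreover have "finite ?F"
  proof (rule finite_subset)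
    show "?F \<subseteq> Pow (carrier G)"
      by (auto dest: subgroup.subset)
  qed (simp add: finite_carrier)
  ultimately have "\<exists>E\<in>?F. \<forall>B\<in>?F. E \<subseteq> B \<longrightarrow> E = B"
    by (intro finite_has_maximal)
  then obtain E where E: "E \<in> ?F" and max: "\<forall>B\<in>?F. E \<subseteq> B \<longrightarrow> E = B"
    by (elim bexE)
  then have sE: "subgroup E G" and AE: "A \<subseteq> E"
    by auto
  obtain \<psi> where \<psi>: "\<psi> \<in> shift_homs E" "\<And>a. a \<in> A \<Longrightarrow> \<psi> a = \<one>"
    using E by auto
  have "E = carrier G"
  proof (rule ccontr)
    assume "E \<noteq> carrier G"
    then obtain g E' where step: "cyclic_step E g E'"
      using normalizer_step[OF sE] by blast
    interpret S: module_step G p A E g E'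
      by (rule module_stepI[OF step AE])
    have AE': "A \<subseteq> E'"
      using AE S.M_subset_E by blast
    obtain \<psi>' where "\<psi>' \<in> shift_homs E'" "\<And>a. a \<in> A \<Longrightarrow> \<psi>' a = \<one>"
      using S.split_extend[OF rigid_subgroup[OF rigid S.subgroup_E AE'] rigid_subgroup[OF rigid sE AE] \<psi>] by blast
    then have "E' \<in> ?F"
      using S.subgroup_E AE' by auto
    then have "E = E'"
      using max S.M_subset_E by blast
    then show False
      using S.g_in_E S.g_notin by simp
  qed
  then show ?thesis
    using that \<psi> by blast
qed

end

section \<open>Inner automorphisms\<close>

context group
begin

lemma AutoGroup_pow:
  assumes "\<psi> \<in> auto G"
  shows "\<psi> [^]\<^bsub>AutoGroup G\<^esub> (n::nat) = (\<lambda>x\<in>carrier G. (\<psi> ^^ n) x)"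
proof (induction n)
  case 0
  then show ?case
    by (simp add: AutoGroup_def BijGroup_def nat_pow_def)
next
  case (Suc n)
  interpret A: group "AutoGroup G"
    by (rule AutoGroup)
  have carr: "carrier (AutoGroup G) = auto G"
    by (simp add: AutoGroup_def)
  have "\<psi> [^]\<^bsub>AutoGroup G\<^esub> n \<in> auto G"
    using A.nat_pow_closed[of \<psi> n] assms by (simp add: carr)
  then have "\<psi> [^]\<^bsub>AutoGroup G\<^esub> Suc n = compose (carrier G) (\<psi> [^]\<^bsub>AutoGroup G\<^esub> n) \<psi>"
    using assms by (simp add: AutoGroup_def BijGroup_def auto_def)
  moreover have "\<psi> x \<in> carrier G" if "x \<in> carrier G" for x
    using assms that by (auto simp: auto_def hom_def)
  ultimately show ?case
    unfolding Suc.IH by (auto simp: compose_def funpow_swap1 intro!: restrict_ext)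
qed

lemma hom_funpow_closed:
  assumes "\<phi> \<in> hom G G" "x \<in> carrier G"
  shows "(\<phi> ^^ n) x \<in> carrier G"
  using assms by (induction n) (auto simp: hom_def)

lemma restrict_p_auto:
  assumes p: "Factorial_Ring.prime p" and \<phi>: "\<phi> \<in> hom G G"
    and pow: "\<And>x. x \<in> carrier G \<Longrightarrow> (\<phi> ^^ (p ^ k)) x = x"
  shows "restrict \<phi> (carrier G) \<in> p_auto p G"
proof -
  let ?\<psi> = "restrict \<phi> (carrier G)"
  interpret A: group "AutoGroup G"
    by (rule AutoGroup)
  \<comment> \<open>The iterate one short of the period is the inverse map.\<close>
  obtain n where n: "p ^ k = Suc n"
    using p prime_gt_0_nat[of p] by (metis gr0_implies_Suc zero_less_power)
  have closed: "\<phi> x \<in> carrier G" if "x \<in> carrier G" for x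
    using \<phi> that by (auto simp: hom_def)
  have "bij_betw \<phi> (carrier G) (carrier G)"
  proof (rule bij_betw_byWitness[where f' = "\<phi> ^^ n"])
    show "\<forall>x\<in>carrier G. (\<phi> ^^ n) (\<phi> x) = x" "\<forall>x\<in>carrier G. \<phi> ((\<phi> ^^ n) x) = x"
      using pow unfolding n by (simp_all add: funpow_swap1)
    show "\<phi> ` carrier G \<subseteq> carrier G" "(\<phi> ^^ n) ` carrier G \<subseteq> carrier G"
      using closed hom_funpow_closed[OF \<phi>] by auto
  qed
  then have "?\<psi> \<in> Bij (carrier G)"
    by (simp add: Bij_def bij_betw_def inj_on_def)
  then have auto: "?\<psi> \<in> auto G"
    using \<phi> by (simp add: auto_def hom_def Pi_iff)
  have "(?\<psi> ^^ m) x = (\<phi> ^^ m) x" if "x \<in> carrier G" for x m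
    using that hom_funpow_closed[OF \<phi>] by (induction m) auto
  then have "?\<psi> [^]\<^bsub>AutoGroup G\<^esub> (p ^ k) = (\<lambda>x\<in>carrier G. x)"
    unfolding AutoGroup_pow[OF auto] using pow by (auto intro!: restrict_ext)
  then have "?\<psi> [^]\<^bsub>AutoGroup G\<^esub> (p ^ k) = \<one>\<^bsub>AutoGroup G\<^esub>"
    by (simp add: AutoGroup_def BijGroup_def)
  then have "A.ord ?\<psi> dvd p ^ k"
    using A.pow_eq_id[of ?\<psi> "p ^ k"] auto by (simp add: AutoGroup_def)
  then show ?thesis
    using auto divides_primepow_nat[OF p] by (auto simp: p_auto_def)
qed

lemma conj_pow:
  assumes "x \<in> carrier G" "y \<in> carrier G"
  shows "(y \<otimes> x \<otimes> inv y) [^] (n::nat) = y \<otimes> x [^] n \<otimes> inv y"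
  using assms by (induction n) (simp_all add: m_assoc)

end

text \<open>The consequence of condition (i) that is exploited, joined with the failure of (ii). The
  locale is refuted by \<open>inner_contradiction\<close>.\<close>

locale p_group_inner = p_group +
  assumes inner: "\<And>\<phi>. \<phi> \<in> p_auto p G \<Longrightarrow> p\<^sup>2 \<le> card (fixed_subgroup G \<phi>) \<Longrightarrow> \<phi> \<in> inner_auto G"
    and order_ge: "p ^ 3 \<le> order G"
begin

lemma inner_of_fixing:
  assumes \<phi>: "\<phi> \<in> hom G G" "\<And>x. x \<in> carrier G \<Longrightarrow> (\<phi> ^^ (p ^ k)) x = x"
    and S: "S \<subseteq> carrier G" "p\<^sup>2 \<le> card S" "\<And>x. x \<in> S \<Longrightarrow> \<phi> x = x"
  obtains h where "h \<in> carrier G" "\<And>x. x \<in> carrier G \<Longrightarrow> \<phi> x = h \<otimes> x \<otimes> inv h"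
proof -
  let ?\<psi> = "restrict \<phi> (carrier G)"
  have "S \<subseteq> fixed_subgroup G ?\<psi>"
    using S by (auto simp: fixed_subgroup_def)
  moreover have "finite (fixed_subgroup G ?\<psi>)"
    using finite_carrier by (simp add: fixed_subgroup_def)
  ultimately have "card S \<le> card (fixed_subgroup G ?\<psi>)"
    by (intro card_mono)
  then have "?\<psi> \<in> inner_auto G"
    using S(2) by (intro inner restrict_p_auto[OF prime_p \<phi>]) auto
  then obtain h where h: "h \<in> carrier G" "?\<psi> = (\<lambda>x\<in>carrier G. h \<otimes> x \<otimes> inv h)"
    by (auto simp: inner_auto_def)
  have "\<phi> x = h \<otimes> x \<otimes> inv h" if "x \<in> carrier G" for x
    using fun_cong[OF h(2), of x] that by simp
  then show ?thesis
    using that h(1) by blast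
qed

text \<open>Sending m g^i to m (z g)^i respects the relations of G over M because z is central of
  order dividing p. Its p-th iterate is the identity since iterating n times multiplies m g^i by
  z^(n i); it fixes M, so it is inner.\<close>

lemma central_automorphism_inner:
  assumes step: "cyclic_step M g (carrier G)"
    and z: "z \<in> M" "z [^] p = \<one>" "\<And>y. y \<in> carrier G \<Longrightarrow> z \<otimes> y = y \<otimes> z"
  obtains h where "h \<in> carrier G" "\<And>m. m \<in> M \<Longrightarrow> h \<otimes> m = m \<otimes> h" "h \<otimes> g = z \<otimes> g \<otimes> h"
proof -
  interpret S: p_group_step G p M g "carrier G"
    by (rule p_group_stepI[OF step])
  have zc: "z \<in> carrier G"
    using z(1) by simp
  have zg: "(z \<otimes> g) [^] i = z [^] i \<otimes> g [^] i" for i :: nat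
    using pow_mult_distrib[OF z(3)[OF S.g_carrier] zc S.g_carrier] .
  have "(\<lambda>x. x) \<in> hom (G\<lparr>carrier := M\<rparr>) G"
    by (auto simp: hom_def)
  moreover have "z \<otimes> g \<otimes> m = (g \<otimes> m \<otimes> inv g) \<otimes> (z \<otimes> g)" if m: "m \<in> M" for m
  proof -
    have "(g \<otimes> m \<otimes> inv g) \<otimes> (z \<otimes> g) = z \<otimes> ((g \<otimes> m \<otimes> inv g) \<otimes> g)"
      using z(3)[of "g \<otimes> m \<otimes> inv g"] zc m by (simp flip: m_assoc)
    then show ?thesis
      using zc m by (simp add: m_assoc)
  qed
  moreover have "g [^] p = (z \<otimes> g) [^] p"
    using z(2) by (simp add: zg)
  ultimately obtain \<phi> where \<phi>: "\<phi> \<in> hom (G\<lparr>carrier := carrier G\<rparr>) G"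
    "\<And>m i. m \<in> M \<Longrightarrow> \<phi> (m \<otimes> g [^] (i::nat)) = m \<otimes> (z \<otimes> g) [^] i"
    using S.hom_extension[of "\<lambda>x. x", OF _ m_closed[OF zc S.g_carrier]] by blast
  have hom: "\<phi> \<in> hom G G"
    using \<phi>(1) by simp
  have fix_M: "\<phi> m = m" if "m \<in> M" for m
    using \<phi>(2)[OF that, of 0] that by simp
  have zi: "z [^] i \<in> M" for i :: nat
    using subgroup_pow_mem[OF S.step_subgroup z(1)] .
  have pow: "(\<phi> ^^ n) (m \<otimes> g [^] i) = z [^] (n * i) \<otimes> (m \<otimes> g [^] i)" if m: "m \<in> M" for m n and i :: nat
  proof (induction n)
    case 0
    then show ?case
      using m by simp
  next
    case (Suc n)
    have "m \<otimes> (z [^] i \<otimes> g [^] i) = z [^] i \<otimes> (m \<otimes> g [^] i)"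
      using pow_mult_swap[OF zc S.M.mem_carrier[OF m] z(3)[OF S.M.mem_carrier[OF m]], of i] zc m
      by (simp flip: m_assoc)
    then have "\<phi> (m \<otimes> g [^] i) = z [^] i \<otimes> (m \<otimes> g [^] i)"
      using \<phi>(2)[OF m, of i] by (simp add: zg)
    moreover have "(\<phi> ^^ Suc n) (m \<otimes> g [^] i) = \<phi> (z [^] (n * i)) \<otimes> \<phi> (m \<otimes> g [^] i)"
      using Suc.IH hom zc m by (simp add: hom_mult)
    ultimately show ?case
      using fix_M[OF zi] zc m by (simp add: nat_pow_mult add.commute flip: m_assoc)
  qed
  have "(\<phi> ^^ (p ^ 1)) x = x" if x: "x \<in> carrier G" for x
  proof -
    obtain m i where mi: "m \<in> M" "x = m \<otimes> g [^] (i::nat)"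
      using x S.E_eq by blast
    have "z [^] (p * i) = \<one>"
      using z(2) zc by (simp flip: nat_pow_pow)
    then show ?thesis
      using pow[OF mi(1), of p i] x mi(2) by simp
  qed
  \<comment> \<open>M has index p, so |G| >= p^3 leaves enough fixed points.\<close>
  moreover have "p\<^sup>2 \<le> card M"
  proof -
    have "p\<^sup>2 * p \<le> card M * p"
    proof -
      have "p\<^sup>2 * p = p ^ 3"
        by (simp add: power3_eq_cube power2_eq_square)
      then show ?thesis
        using card_cyclic_step_le[OF step] order_ge unfolding order_def by linarith
    qed
    then show ?thesis
      using p_gt_1 by simp
  qed
  ultimately obtain h where h: "h \<in> carrier G" "\<And>x. x \<in> carrier G \<Longrightarrow> \<phi> x = h \<otimes> x \<otimes> inv h"
    using inner_of_fixing[OF hom _ S.M.subset _ fix_M] by blast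
  have eq: "h \<otimes> x = \<phi> x \<otimes> h" if "x \<in> carrier G" for x
    using h that by (simp add: m_assoc)
  have "h \<otimes> m = m \<otimes> h" if "m \<in> M" for m
    using eq[of m] fix_M[OF that] that by simp
  moreover have "\<phi> g = z \<otimes> g"
    using \<phi>(2)[OF S.M.one_closed, of 1] zc by simp
  then have "h \<otimes> g = z \<otimes> g \<otimes> h"
    using eq[OF S.g_carrier] by simp
  ultimately show ?thesis
    using that h(1) by blast
qed

end

locale self_centralizing_module = p_group_module G p A + p_group_inner G p
  for G (structure) and p A +
  assumes self_centralizing: "centralizer (carrier G) A = A"
    and card_A: "p\<^sup>2 \<le> card A"
begin

lemma memA_iff: "x \<in> carrier G \<Longrightarrow> x \<in> A \<longleftrightarrow> (\<forall>a\<in>A. x \<otimes> a = a \<otimes> x)"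
  using self_centralizing by (auto simp: centralizer_def)

text \<open>Iterating n times multiplies x by u^n with u = psi(x) x^-1 in A, so the order is a power
  of p. The fixed points include A, which has at least p^2 elements, so the map is conjugation by
  some h. Fixing A, h centralizes A and therefore lies in A.\<close>

lemma rigid_carrier: "rigid (carrier G)"
  unfolding rigid_def
proof (intro ballI impI)
  fix \<psi> assume \<psi>: "\<psi> \<in> shift_homs (carrier G)" and fix_A: "\<forall>a\<in>A. \<psi> a = a"
  have hom: "\<psi> \<in> hom G G"
    using \<psi> by (simp add: shift_homs_def)
  have pow: "(\<psi> ^^ n) x = (\<psi> x \<otimes> inv x) [^] n \<otimes> x" if x: "x \<in> carrier G" for x n
  proof (induction n)
    case (Suc n)
    let ?u = "\<psi> x \<otimes> inv x"
    have u: "?u \<in> A" "\<psi> x \<in> carrier G"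
      using shift_homsD[OF \<psi>] x by auto
    have un: "?u [^] n \<in> A"
      by (rule subgroup_pow_mem[OF subgroup_A u(1)])
    then have "(\<psi> ^^ Suc n) x = ?u [^] n \<otimes> \<psi> x"
      using Suc.IH shift_homsD(2)[OF \<psi>, of "?u [^] n" x] x fix_A by simp
    also have "\<psi> x = ?u \<otimes> x"
      using x u(2) by (simp add: m_assoc)
    finally show ?case
      using x u by (simp add: m_assoc)
  qed (use x in simp)
  obtain k where k: "order G = p ^ k"
    using order_power by blast
  have "(\<psi> ^^ (p ^ k)) x = x" if x: "x \<in> carrier G" for x
  proof -
    have "(\<psi> x \<otimes> inv x) [^] (p ^ k) = \<one>"
      using shift_homsD(3)[OF \<psi> x] pow_order_eq_1[of "\<psi> x \<otimes> inv x"] k by simp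
    then show ?thesis
      using pow[OF x] x by simp
  qed
  then obtain h where h: "h \<in> carrier G" "\<And>x. x \<in> carrier G \<Longrightarrow> \<psi> x = h \<otimes> x \<otimes> inv h"
    using inner_of_fixing[OF hom _ A.subset card_A] fix_A by metis
  have "h \<otimes> a = a \<otimes> h" if "a \<in> A" for a
  proof -
    have "h \<otimes> a = \<psi> a \<otimes> h"
      using h(1) h(2)[of a] that by (simp add: m_assoc)
    then show ?thesis
      using fix_A that by simp
  qed
  then have "h \<in> A"
    using memA_iff[OF h(1)] by blast
  then show "\<exists>b\<in>A. \<forall>x\<in>carrier G. \<psi> x = b \<otimes> x \<otimes> inv b"
    using h(2) by blast
qed

end

section \<open>The twist of a self-centralizing subgroup\<close>

text \<open>On A, conjugation by w is a transvection: it centralizes exactly K and moves the other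
  elements by nontrivial powers of z; \<open>p dvd i\<close> expresses that z^i is the identity. The
  clause on (a w)^p records the vanishing of H^1 of the group generated by w on A. The last two
  clauses say that G acts trivially on A/K and make the subgroup generated by z and w
  normal.\<close>

definition (in p_group) twist :: "'a set \<Rightarrow> 'a set \<Rightarrow> 'a \<Rightarrow> 'a \<Rightarrow> bool"
  where "twist A K z w \<longleftrightarrow> subgroup K G \<and> K \<subset> A \<and>
    z \<in> K \<and> z \<noteq> \<one> \<and> z [^] p = \<one> \<and> (\<forall>y\<in>carrier G. z \<otimes> y = y \<otimes> z) \<and>
    w \<in> carrier G \<and> w \<notin> A \<and> w [^] p = \<one> \<and>
    (\<forall>a\<in>A. \<exists>i::nat. w \<otimes> a = z [^] i \<otimes> a \<otimes> w \<and> (p dvd i \<longleftrightarrow> a \<in> K)) \<and>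
    (\<forall>a\<in>A. (a \<otimes> w) [^] p = \<one> \<longrightarrow> (\<exists>i::nat. a = z [^] i)) \<and>
    (\<forall>y\<in>carrier G. \<forall>a\<in>A. y \<otimes> a \<otimes> inv y \<otimes> inv a \<in> K) \<and>
    (\<forall>y\<in>carrier G. \<exists>i::nat. y \<otimes> w \<otimes> inv y = z [^] i \<otimes> w)"

context self_centralizing_module
begin

text \<open>A/K is a chief factor of a p-group, hence of order p and central in G/K. As |A| >= p^2,
  K is nontrivial and has room for a central z.\<close>

lemma maximal_invariant_subgroup:
  obtains K x where "K \<lhd> G" "K \<subset> A" "K \<noteq> {\<one>}" "cyclic_step K x A"
    "\<And>y. y \<in> carrier G \<Longrightarrow> y \<otimes> x \<otimes> inv y \<otimes> inv x \<in> K"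
proof -
  let ?F = "{N. N \<lhd> G \<and> N \<subset> A}"
  have p2: "p < p\<^sup>2"
    using p_gt_1 by (simp add: power2_eq_square)
  have "A \<noteq> {\<one>}"
    using card_A p2 p_gt_1 by auto
  then have "{\<one>} \<in> ?F"
    using one_is_normal A.one_closed by auto
  then have "?F \<noteq> {}"
    by (metis empty_iff)
  moreover have "finite ?F"
  proof (rule finite_subset)
    show "?F \<subseteq> Pow A"
      by auto
    show "finite (Pow A)"
      using finite_subset[OF A.subset finite_carrier] by simp
  qed
  ultimately have "\<exists>K\<in>?F. \<forall>B\<in>?F. K \<subseteq> B \<longrightarrow> K = B"
    by (intro finite_has_maximal)
  then obtain K where "K \<in> ?F" and max: "\<forall>B\<in>?F. K \<subseteq> B \<longrightarrow> K = B"
    by (elim bexE)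
  then have K: "K \<lhd> G" "K \<subset> A"
    by simp_all
  obtain x E where x: "cyclic_step K x E" "E \<lhd> G" "E \<subseteq> A"
    "\<And>y. y \<in> carrier G \<Longrightarrow> y \<otimes> x \<otimes> inv y \<otimes> inv x \<in> K"
    using central_step[OF K(1) normal_A K(2)] by blast
  interpret S: p_group_step G p K x E
    by (rule p_group_stepI[OF x(1)])
  have "E = A"
  proof (rule ccontr)
    assume "E \<noteq> A"
    then have "E \<in> ?F"
      using x(2,3) by blast
    then have "K = E"
      using max S.M_subset_E by blast
    then show False
      using S.g_in_E S.g_notin by simp
  qed
  moreover have "K \<noteq> {\<one>}"
  proof
    assume "K = {\<one>}"
    then have "card A \<le> p"
      using card_cyclic_step_le[OF x(1)] \<open>E = A\<close> by simp
    then show False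
      using card_A p2 by simp
  qed
  ultimately show ?thesis
    using that K x(1,4) by blast
qed

text \<open>The image of a section is a complement C of A in G. Then M = K C is a subgroup of index
  p that meets A in K, and x generates G over it, so the automorphism fixing M and moving x by z is
  available.\<close>

lemma central_shift:
  assumes K: "K \<lhd> G" "K \<subset> A" and x: "cyclic_step K x A"
    and comm: "\<And>y a. y \<in> carrier G \<Longrightarrow> a \<in> A \<Longrightarrow> y \<otimes> a \<otimes> inv y \<otimes> inv a \<in> K"
    and z: "z \<in> K" "z [^] p = \<one>" "\<And>y. y \<in> carrier G \<Longrightarrow> z \<otimes> y = y \<otimes> z"
  obtains h where "h \<in> carrier G" "\<And>k. k \<in> K \<Longrightarrow> h \<otimes> k = k \<otimes> h" "h \<otimes> x = z \<otimes> x \<otimes> h"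
proof -
  interpret K: normal K G
    by (rule K(1))
  interpret S: p_group_step G p K x A
    by (rule p_group_stepI[OF x])
  obtain \<psi> where \<psi>: "\<psi> \<in> shift_homs (carrier G)" and \<psi>_A: "\<And>a. a \<in> A \<Longrightarrow> \<psi> a = \<one>"
    using rigid_split[OF rigid_carrier] by blast
  \<comment> \<open>The A-component of y in the factorization of G as A C; M becomes the preimage of
    K under it.\<close>
  define \<pi> where "\<pi> y = y \<otimes> inv (\<psi> y)" for y
  have \<psi>_closed: "\<psi> y \<in> carrier G" if "y \<in> carrier G" for y
    using shift_homsD(1)[OF \<psi> that] .
  have \<pi>_mem: "\<pi> y \<in> A" if y: "y \<in> carrier G" for y
  proof -
    have "\<pi> y = inv (\<psi> y \<otimes> inv y)"
      using y \<psi>_closed by (simp add: \<pi>_def inv_mult_group)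
    then show ?thesis
      using shift_homsD(3)[OF \<psi> y] by simp
  qed
  have \<pi>_A: "\<pi> a = a" if "a \<in> A" for a
    using that \<psi>_A by (simp add: \<pi>_def)
  have \<pi>_mult: "\<pi> (u \<otimes> v) = (u \<otimes> \<pi> v \<otimes> inv u) \<otimes> \<pi> u" if uv: "u \<in> carrier G" "v \<in> carrier G" for u v
    unfolding \<pi>_def shift_homsD(2)[OF \<psi> uv]
    using uv \<psi>_closed[OF uv(1)] \<psi>_closed[OF uv(2)] by (simp add: group_normalize)
  define M where "M = {y \<in> carrier G. \<pi> y \<in> K}"
  have K_M: "K \<subseteq> M"
  proof
    fix k assume k: "k \<in> K"
    then have "k \<in> A"
      using K(2) by blast
    then show "k \<in> M"
      using \<pi>_A k by (simp add: M_def)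
  qed
  have sub: "subgroup M G"
  proof (rule subgroupI)
    show "M \<subseteq> carrier G"
      by (auto simp: M_def)
    show "M \<noteq> {}"
      using K_M z(1) by blast
  next
    fix u assume "u \<in> M"
    then have u: "u \<in> carrier G" "\<pi> u \<in> K"
      by (simp_all add: M_def)
    have "\<pi> (inv u \<otimes> u) = (inv u \<otimes> \<pi> u \<otimes> inv (inv u)) \<otimes> \<pi> (inv u)"
      using u by (intro \<pi>_mult) auto
    then have "(inv u \<otimes> \<pi> u \<otimes> u) \<otimes> \<pi> (inv u) = \<one>"
      using u \<pi>_A[of \<one>] by simp
    then have "\<pi> (inv u) = inv (inv u \<otimes> \<pi> u \<otimes> u)"
      using u A.mem_carrier[OF \<pi>_mem[OF inv_closed[OF u(1)]]] inv_equality[of "\<pi> (inv u)" "inv u \<otimes> \<pi> u \<otimes> u"]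
        inv_comm[of "inv u \<otimes> \<pi> u \<otimes> u" "\<pi> (inv u)"] by simp
    then show "inv u \<in> M"
      using u K.inv_op_closed1 by (simp add: M_def)
    fix v assume "v \<in> M"
    then have v: "v \<in> carrier G" "\<pi> v \<in> K"
      by (simp_all add: M_def)
    show "u \<otimes> v \<in> M"
      using u v \<pi>_mult K.inv_op_closed2 by (simp add: M_def)
  qed
  have xA: "x \<in> A"
    by (rule S.g_in_E)
  have "x \<notin> M"
    using \<pi>_A[OF xA] S.g_notin by (simp add: M_def)
  moreover have "x [^] p \<in> M"
    using S.g_pow_p K_M by blast
  \<comment> \<open>Conjugation by x changes the A-component of m only by a conjugate of the
    commutator of m and x^-1, which lies in K.\<close>
  moreover have "x \<otimes> m \<otimes> inv x \<in> M" if m: "m \<in> M" for m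
  proof -
    have mc: "m \<in> carrier G" "\<pi> m \<in> K"
      using m by (simp_all add: M_def)
    have "\<pi> (x \<otimes> (m \<otimes> inv x)) = (x \<otimes> (m \<otimes> inv x \<otimes> inv m \<otimes> \<pi> m) \<otimes> inv x) \<otimes> x"
      using \<pi>_mult[of x "m \<otimes> inv x"] \<pi>_mult[of m "inv x"] \<pi>_A[OF xA] \<pi>_A[of "inv x"] mc(1) xA by simp
    also have "\<dots> = x \<otimes> (m \<otimes> inv x \<otimes> inv m \<otimes> inv (inv x)) \<otimes> inv x \<otimes> \<pi> m"
    proof -
      have "\<pi> m \<otimes> (inv x \<otimes> x) = inv x \<otimes> (\<pi> m \<otimes> x)"
        using A_comm_left[of "\<pi> m" "inv x" x] mc xA K(2) by auto
      then show ?thesis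
        using A_comm[of "\<pi> m" x] A_comm[of "\<pi> m" "inv x"] mc xA K(2) by (simp add: m_assoc)
    qed
    finally have "\<pi> (x \<otimes> m \<otimes> inv x) = x \<otimes> (m \<otimes> inv x \<otimes> inv m \<otimes> inv (inv x)) \<otimes> inv x \<otimes> \<pi> m"
      using mc by (simp add: m_assoc)
    moreover have "x \<otimes> (m \<otimes> inv x \<otimes> inv m \<otimes> inv (inv x)) \<otimes> inv x \<in> K"
      using comm[OF mc(1), of "inv x"] xA K.inv_op_closed2[OF S.g_carrier] by simp
    ultimately show ?thesis
      using mc by (simp add: M_def)
  qed
  ultimately have step: "cyclic_step M x {m \<otimes> x [^] (i::nat) |m i. m \<in> M}"
    using sub by (intro cyclic_stepI) auto
  have "{m \<otimes> x [^] (i::nat) |m i. m \<in> M} = carrier G"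
  proof
    show "{m \<otimes> x [^] (i::nat) |m i. m \<in> M} \<subseteq> carrier G"
      using sub by (auto dest: subgroup.mem_carrier)
    show "carrier G \<subseteq> {m \<otimes> x [^] (i::nat) |m i. m \<in> M}"
    proof
      fix y assume y: "y \<in> carrier G"
      obtain k i where k: "k \<in> K" "\<pi> y = k \<otimes> x [^] (i::nat)"
        using \<pi>_mem[OF y] unfolding S.E_eq by blast
      let ?m = "y \<otimes> inv (x [^] i)"
      have xi: "inv (x [^] i) \<in> A"
        using subgroup_pow_mem[OF subgroup_A xA] by simp
      have "\<pi> ?m = (y \<otimes> inv (x [^] i) \<otimes> inv y) \<otimes> (k \<otimes> x [^] i)"
        using \<pi>_mult[OF y, of "inv (x [^] i)"] \<pi>_A[OF xi] k(2) by simp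
      also have "\<dots> = (y \<otimes> inv (x [^] i) \<otimes> inv y \<otimes> inv (inv (x [^] i))) \<otimes> (inv (x [^] i) \<otimes> k \<otimes> x [^] i)"
        using y k(1) by (simp add: m_assoc)
      finally have "\<pi> ?m \<in> K"
        using comm[OF y xi] K.inv_op_closed1[of "x [^] i" k] k(1) by simp
      then have "?m \<in> M"
        using y by (simp add: M_def)
      moreover have "y = ?m \<otimes> x [^] i"
        using y by (simp add: m_assoc)
      ultimately show "y \<in> {m \<otimes> x [^] (i::nat) |m i. m \<in> M}"
        by blast
    qed
  qed
  then have "cyclic_step M x (carrier G)"
    using step by simp
  moreover have "z \<in> M"
    using K_M z(1) by blast
  ultimately obtain h where "h \<in> carrier G" "\<And>m. m \<in> M \<Longrightarrow> h \<otimes> m = m \<otimes> h" "h \<otimes> x = z \<otimes> x \<otimes> h"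
    using central_automorphism_inner[OF _ _ z(2,3)] by blast
  then show ?thesis
    using that K_M by blast
qed

text \<open>Since z^p is the identity, h^p centralizes A and so lies in A. Rigidity of the group
  generated by A and h is used through the norm to correct h to w = b h of order p; rigidity of the
  group generated by A and w then confines the elements c with (c w)^p trivial.\<close>

lemma twist_exists:
  obtains K z w where "twist A K z w"
proof -
  obtain K x where K: "K \<lhd> G" "K \<subset> A" "K \<noteq> {\<one>}" and x: "cyclic_step K x A"
    "\<And>y. y \<in> carrier G \<Longrightarrow> y \<otimes> x \<otimes> inv y \<otimes> inv x \<in> K"
    using maximal_invariant_subgroup by blast
  interpret K: normal K G
    by (rule K(1))
  interpret S: p_group_step G p K x A
    by (rule p_group_stepI[OF x(1)])
  have comm: "y \<otimes> a \<otimes> inv y \<otimes> inv a \<in> K" if "y \<in> carrier G" "a \<in> A" for y a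
    using cyclic_step_commutators[OF x(1) K(1) x(2) that(2,1)] .
  obtain z where z: "z \<in> K" "z \<noteq> \<one>" "z [^] p = \<one>" "\<And>y. y \<in> carrier G \<Longrightarrow> z \<otimes> y = y \<otimes> z"
    using central_element[OF K(1,3)] by blast
  obtain h where h: "h \<in> carrier G" "\<And>k. k \<in> K \<Longrightarrow> h \<otimes> k = k \<otimes> h" "h \<otimes> x = z \<otimes> x \<otimes> h"
    using central_shift[OF K(1,2) x(1) comm z(1,3,4)] by blast
  have zc: "z \<in> carrier G" and zA: "z \<in> A"
    using z(1) K(2) by auto
  have xA: "x \<in> A"
    by (rule S.g_in_E)
  have z_pow: "z [^] i \<in> A" "z [^] i \<in> carrier G" for i :: nat
    using subgroup_pow_mem[OF subgroup_A zA] zc by auto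
  have z_pow_comm: "z [^] i \<otimes> y = y \<otimes> z [^] i" if "y \<in> carrier G" for y and i :: nat
    using pow_mult_swap[OF zc that z(4)[OF that]] .
  have h_pow: "h \<otimes> x [^] i = z [^] i \<otimes> x [^] i \<otimes> h" for i :: nat
  proof (induction i)
    case (Suc i)
    have "h \<otimes> x [^] Suc i = z [^] i \<otimes> x [^] i \<otimes> (h \<otimes> x)"
      using Suc h(1) z_pow(2) by (simp flip: m_assoc)
    also have "\<dots> = z [^] i \<otimes> (x [^] i \<otimes> z) \<otimes> x \<otimes> h"
      using h(1,3) z_pow(2) zc by (simp add: m_assoc)
    also have "x [^] i \<otimes> z = z \<otimes> x [^] i"
      using z(4)[of "x [^] i"] by simp
    finally show ?case
      using h(1) z_pow(2) zc by (simp add: m_assoc)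
  qed (use h in simp)
  have h_act: "h \<otimes> (k \<otimes> x [^] i) = z [^] i \<otimes> (k \<otimes> x [^] i) \<otimes> h" if k: "k \<in> K" for k and i :: nat
  proof -
    have "h \<otimes> (k \<otimes> x [^] i) = k \<otimes> (h \<otimes> x [^] i)"
      using h(1) h(2)[OF k] k by (simp flip: m_assoc)
    also have "\<dots> = k \<otimes> z [^] i \<otimes> (x [^] i \<otimes> h)"
      unfolding h_pow using h(1) k z_pow(2) by (simp add: m_assoc)
    also have "k \<otimes> z [^] i = z [^] i \<otimes> k"
      using z_pow_comm[of k i] k by simp
    finally show ?thesis
      using h(1) k z_pow(2) by (simp add: m_assoc)
  qed
  have act: "\<exists>i::nat. h \<otimes> a = z [^] i \<otimes> a \<otimes> h \<and> (p dvd i \<longleftrightarrow> a \<in> K)" if a: "a \<in> A" for a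
  proof -
    obtain k i where k: "k \<in> K" "a = k \<otimes> x [^] (i::nat)"
      using a unfolding S.E_eq by blast
    have "a \<in> K \<longleftrightarrow> x [^] i \<in> K"
    proof
      assume "a \<in> K"
      then have "inv k \<otimes> a \<in> K"
        using k(1) by simp
      then show "x [^] i \<in> K"
        using k by simp
    qed (use k in simp)
    then show ?thesis
      using h_act[OF k(1), of i] S.g_pow_mem_iff[of i] k(2) by blast
  qed
  have "h \<notin> A"
  proof
    assume "h \<in> A"
    then have "z \<otimes> x \<otimes> h = x \<otimes> h"
      using A_comm[OF _ xA] h(3) by simp
    then show False
      using z(2) h(1) zc by simp
  qed
  have h_pow_act: "h [^] n \<otimes> a = z [^] (i * n) \<otimes> a \<otimes> h [^] n"
    if a: "a \<in> A" and i: "h \<otimes> a = z [^] i \<otimes> a \<otimes> h" for a and i n :: nat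
  proof (induction n)
    case (Suc n)
    have "h [^] Suc n \<otimes> a = h [^] n \<otimes> z [^] i \<otimes> (a \<otimes> h)"
      using i a h(1) z_pow(2) by (simp add: m_assoc)
    also have "h [^] n \<otimes> z [^] i = z [^] i \<otimes> h [^] n"
      using z_pow_comm[of "h [^] n" i] h(1) by simp
    also have "z [^] i \<otimes> h [^] n \<otimes> (a \<otimes> h) = z [^] i \<otimes> (h [^] n \<otimes> a) \<otimes> h"
      using a h(1) z_pow(2) by (simp add: m_assoc)
    also have "\<dots> = z [^] (i * Suc n) \<otimes> a \<otimes> h [^] Suc n"
      unfolding Suc.IH using a h(1) z_pow(2) zc by (simp add: m_assoc flip: nat_pow_mult)
    finally show ?case .
  qed (use a in simp)
  have "h [^] p \<otimes> a = a \<otimes> h [^] p" if a: "a \<in> A" for a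
  proof -
    obtain i :: nat where i: "h \<otimes> a = z [^] i \<otimes> a \<otimes> h"
      using act[OF a] by blast
    have "z [^] (i * p) = \<one>"
      using z(3) zc by (simp add: mult.commute[of i] flip: nat_pow_pow)
    then show ?thesis
      using h_pow_act[OF a i, of p] a by simp
  qed
  then have hp: "h [^] p \<in> A"
    using memA_iff[of "h [^] p"] h(1) by blast
  have step_h: "cyclic_step A h {m \<otimes> h [^] (i::nat) |m i. m \<in> A}" (is "cyclic_step A h ?E")
    using hp h(1) \<open>h \<notin> A\<close> A_conj by (intro cyclic_stepI subgroup_A) auto
  interpret H: module_step G p A A h ?E
    by (rule module_stepI[OF step_h order_refl])
  have CA: "centralizer A A = A"
    using A_comm by (auto simp: centralizer_def)
  have "rigid ?E"
    by (rule rigid_subgroup[OF rigid_carrier H.subgroup_E H.M_subset_E])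
  moreover have "inv (h [^] p) \<otimes> h = h \<otimes> inv (h [^] p)"
  proof -
    have "inv (h [^] p) \<otimes> (h [^] p \<otimes> h) \<otimes> inv (h [^] p) = inv (h [^] p) \<otimes> (h \<otimes> h [^] p) \<otimes> inv (h [^] p)"
      using pow_mult_swap[OF h(1) h(1), of p] by simp
    then show ?thesis
      using h(1) by (simp add: m_assoc)
  qed
  \<comment> \<open>The step starts at M = A, whose centralizer in A is A itself. Norm h^-p is what
    makes (b h)^p trivial.\<close>
  ultimately obtain b where b: "b \<in> A" "pnorm h p b = inv (h [^] p)"
    using H.rigid_norm_surj[of "inv (h [^] p)"] hp unfolding CA by blast
  define w where "w = b \<otimes> h"
  have wc: "w \<in> carrier G"
    using b(1) h(1) by (simp add: w_def)
  have wp: "w [^] p = \<one>"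
    unfolding w_def pnorm_pow_eq[OF A.mem_carrier[OF b(1)] h(1)] b(2) using h(1) by simp
  have "w \<notin> A"
  proof
    assume "w \<in> A"
    then have "inv b \<otimes> w \<in> A"
      using b(1) by simp
    then show False
      using \<open>h \<notin> A\<close> b(1) h(1) by (simp add: w_def)
  qed
  have w_act: "w \<otimes> a = z [^] i \<otimes> a \<otimes> w" if a: "a \<in> A" and i: "h \<otimes> a = z [^] i \<otimes> a \<otimes> h" for a and i :: nat
  proof -
    have "w \<otimes> a = b \<otimes> (z [^] i \<otimes> a) \<otimes> h"
      using a i b(1) h(1) z_pow(2) by (simp add: w_def m_assoc)
    also have "b \<otimes> (z [^] i \<otimes> a) = z [^] i \<otimes> a \<otimes> b"
      using A_comm[of b "z [^] i \<otimes> a"] z_pow(1) a b(1) by simp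
    finally show ?thesis
      using a b(1) h(1) z_pow(2) by (simp add: w_def m_assoc)
  qed
  have act_w: "\<exists>i::nat. w \<otimes> a = z [^] i \<otimes> a \<otimes> w \<and> (p dvd i \<longleftrightarrow> a \<in> K)" if "a \<in> A" for a
    using act[OF that] w_act[OF that] by blast
  have step_w: "cyclic_step A w {m \<otimes> w [^] (i::nat) |m i. m \<in> A}" (is "cyclic_step A w ?F")
    using wc wp \<open>w \<notin> A\<close> A_conj by (intro cyclic_stepI subgroup_A) auto
  interpret W: module_step G p A A w ?F
    by (rule module_stepI[OF step_w order_refl])
  have rigid_F: "rigid ?F"
    by (rule rigid_subgroup[OF rigid_carrier W.subgroup_E W.M_subset_E])
  \<comment> \<open>As w^p is trivial, c has norm one and is a commutator of some d in A with w;
    such commutators are powers of z.\<close>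
  have ker: "\<exists>i::nat. c = z [^] i" if c: "c \<in> A" "(c \<otimes> w) [^] p = \<one>" for c
  proof -
    have "pnorm w p c = \<one>"
      unfolding pnorm_def c(2) wp by simp
    then obtain d where d: "d \<in> A" "c = d \<otimes> w \<otimes> inv d \<otimes> inv w"
      using W.rigid_norm_kernel[OF rigid_F, of c] c(1) unfolding CA by blast
    obtain i :: nat where "w \<otimes> inv d = z [^] i \<otimes> inv d \<otimes> w"
      using act_w[of "inv d"] d(1) by auto
    then have "c = d \<otimes> z [^] i \<otimes> inv d"
      unfolding d(2) using d(1) wc z_pow(2) by (simp add: m_assoc)
    also have "\<dots> = z [^] i"
      using A_comm[OF d(1) z_pow(1), of i] d(1) z_pow(2) by (simp add: m_assoc)
    finally show ?thesis
      by blast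
  qed
  \<comment> \<open>The power of z by which w moves a depends only on a modulo K, and y acts
    trivially on A/K and on z. So w and its conjugate act alike on A, and their quotient centralizes
    A and lies in A. Conjugates of w have trivial p-th power, so the quotient is a power of z by the
    previous step.\<close>
  have conj_w: "\<exists>i::nat. y \<otimes> w \<otimes> inv y = z [^] i \<otimes> w" if y: "y \<in> carrier G" for y
  proof -
    let ?c = "y \<otimes> w \<otimes> inv y \<otimes> inv w"
    have "?c \<otimes> a = a \<otimes> ?c" if a: "a \<in> A" for a
    proof -
      let ?a = "inv w \<otimes> a \<otimes> w"
      have a': "?a \<in> A"
        using A_conj'[OF wc a] .
      define b where "b = inv y \<otimes> ?a \<otimes> y"
      have bA: "b \<in> A"
        unfolding b_def using A_conj'[OF y a'] .
      define k where "k = inv y \<otimes> ?a \<otimes> inv (inv y) \<otimes> inv ?a"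
      have kK: "k \<in> K"
        unfolding k_def using comm[OF inv_closed[OF y] a'] .
      have kA: "k \<in> A"
        using kK K(2) by blast
      have bk: "b = k \<otimes> ?a"
        unfolding b_def k_def using y wc a by (simp add: group_normalize)
      obtain i :: nat where i: "w \<otimes> ?a = z [^] i \<otimes> ?a \<otimes> w"
        using act_w[OF a'] by blast
      obtain j :: nat where j: "w \<otimes> k = z [^] j \<otimes> k \<otimes> w" "p dvd j"
        using act_w[OF kA] kK by blast
      obtain q where q: "j = p * q"
        using j(2) by blast
      have "z [^] j = \<one>"
        unfolding q using z(3) zc by (simp flip: nat_pow_pow)
      then have wk: "w \<otimes> k = k \<otimes> w"
        using j(1) kA by simp
      have "w \<otimes> b = k \<otimes> (w \<otimes> ?a)"
        unfolding bk using wk kA a' wc by (simp flip: m_assoc)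
      also have "\<dots> = k \<otimes> z [^] i \<otimes> (?a \<otimes> w)"
        unfolding i using kA a' wc z_pow(2) by (simp add: m_assoc)
      also have "k \<otimes> z [^] i = z [^] i \<otimes> k"
        using A_comm[OF kA z_pow(1)] .
      finally have wb: "w \<otimes> b = z [^] i \<otimes> b \<otimes> w"
        unfolding bk using kA a' wc z_pow(2) by (simp add: m_assoc)
      have wa: "a = z [^] i \<otimes> ?a"
      proof -
        have "w \<otimes> ?a \<otimes> inv w = a"
          using a wc by (simp add: m_assoc)
        moreover have "w \<otimes> ?a \<otimes> inv w = z [^] i \<otimes> ?a"
          unfolding i using A.mem_carrier[OF a'] wc z_pow(2) by (simp add: m_assoc)
        ultimately show ?thesis
          by simp
      qed
      have "?c \<otimes> a = y \<otimes> (w \<otimes> b) \<otimes> inv y \<otimes> inv w"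
        unfolding b_def using y wc a by (simp add: m_assoc)
      also have "\<dots> = (y \<otimes> z [^] i) \<otimes> b \<otimes> w \<otimes> inv y \<otimes> inv w"
        unfolding wb using y wc A.mem_carrier[OF bA] z_pow(2) by (simp add: m_assoc)
      also have "y \<otimes> z [^] i = z [^] i \<otimes> y"
        using z_pow_comm[OF y, of i] by simp
      also have "z [^] i \<otimes> y \<otimes> b \<otimes> w \<otimes> inv y \<otimes> inv w = (z [^] i \<otimes> ?a) \<otimes> ?c"
        unfolding b_def using y wc a z_pow(2) by (simp add: m_assoc)
      also have "\<dots> = a \<otimes> ?c"
        unfolding wa[symmetric] ..
      finally show ?thesis .
    qed
    then have cA: "?c \<in> A"
      using memA_iff[of ?c] y wc by simp
    have eq: "y \<otimes> w \<otimes> inv y = ?c \<otimes> w"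
      using y wc by (simp add: m_assoc)
    have "(?c \<otimes> w) [^] p = \<one>"
      unfolding eq[symmetric] conj_pow[OF wc y] wp using y by simp
    then obtain i :: nat where "?c = z [^] i"
      using ker[OF cA] by blast
    then show ?thesis
      using eq by auto
  qed
  have "twist A K z w"
    unfolding twist_def
    using K.subgroup_axioms K(2) z wc \<open>w \<notin> A\<close> wp act_w ker comm conj_w by simp
  then show ?thesis
    using that by blast
qed

end

section \<open>The contradiction\<close>

text \<open>Collecting all w to the right produces c once for every w moved past an a, n(n-1)/2
  times in total. For n = p prime this number is divisible by p exactly when p is odd.\<close>

lemma (in group) mult_pow_twisted:
  assumes "a \<in> carrier G" "w \<in> carrier G" "c \<in> carrier G"
    and c: "\<And>y. y \<in> carrier G \<Longrightarrow> c \<otimes> y = y \<otimes> c" and twist: "w \<otimes> a = c \<otimes> a \<otimes> w"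
  shows "(a \<otimes> w) [^] (n::nat) = c [^] (\<Sum>i<n. i) \<otimes> a [^] n \<otimes> w [^] n"
proof (induction n)
  case (Suc n)
  have cn: "c [^] m \<otimes> y = y \<otimes> c [^] m" if "y \<in> carrier G" for m :: nat and y
    using pow_mult_swap[OF assms(3) that c[OF that]] .
  have wn: "w [^] n \<otimes> a = c [^] n \<otimes> a \<otimes> w [^] n" for n :: nat
  proof (induction n)
    case (Suc n)
    have "w [^] Suc n \<otimes> a = (w [^] n \<otimes> c) \<otimes> (a \<otimes> w)"
      using assms(1-3) twist by (simp add: m_assoc)
    also have "w [^] n \<otimes> c = c \<otimes> w [^] n"
      using c[of "w [^] n"] assms(2) by simp
    also have "c \<otimes> w [^] n \<otimes> (a \<otimes> w) = c \<otimes> (w [^] n \<otimes> a) \<otimes> w"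
      using assms(1-3) by (simp add: m_assoc)
    also have "\<dots> = (c \<otimes> c [^] n) \<otimes> a \<otimes> w [^] Suc n"
      unfolding Suc using assms(1-3) by (simp add: m_assoc)
    finally show ?case
      unfolding nat_pow_Suc2[OF assms(3)] .
  qed (use assms in simp)
  have "(a \<otimes> w) [^] Suc n = c [^] (\<Sum>i<n. i) \<otimes> a [^] n \<otimes> (w [^] n \<otimes> a) \<otimes> w"
    using assms(1-3) by (simp add: Suc m_assoc)
  also have "\<dots> = c [^] (\<Sum>i<n. i) \<otimes> (a [^] n \<otimes> c [^] n) \<otimes> (a \<otimes> (w [^] n \<otimes> w))"
    unfolding wn using assms(1-3) by (simp add: m_assoc)
  also have "a [^] n \<otimes> c [^] n = c [^] n \<otimes> a [^] n"
    using cn[of "a [^] n" n] assms(1) by simp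
  also have "c [^] (\<Sum>i<n. i) \<otimes> (c [^] n \<otimes> a [^] n) \<otimes> (a \<otimes> (w [^] n \<otimes> w)) =
      (c [^] (\<Sum>i<n. i) \<otimes> c [^] n) \<otimes> (a [^] n \<otimes> a) \<otimes> (w [^] n \<otimes> w)"
    using assms(1-3) by (simp add: m_assoc)
  finally show ?case
    using assms(3) by (simp add: nat_pow_mult)
qed simp

lemma (in group) pow_2: "x \<in> carrier G \<Longrightarrow> x [^] (2::nat) = x \<otimes> x"
  by (simp add: numeral_2_eq_2)

context p_group
begin

lemma
  assumes "twist A K z w"
  shows twist_K: "subgroup K G" "K \<subset> A"
    and twist_z: "z \<in> K" "z \<noteq> \<one>" "z [^] p = \<one>" "\<And>y. y \<in> carrier G \<Longrightarrow> z \<otimes> y = y \<otimes> z"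
    and twist_w: "w \<in> carrier G" "w \<notin> A" "w [^] p = \<one>"
    and twist_act: "\<And>a. a \<in> A \<Longrightarrow> \<exists>i::nat. w \<otimes> a = z [^] i \<otimes> a \<otimes> w \<and> (p dvd i \<longleftrightarrow> a \<in> K)"
    and twist_kernel: "\<And>a. a \<in> A \<Longrightarrow> (a \<otimes> w) [^] p = \<one> \<Longrightarrow> \<exists>i::nat. a = z [^] i"
    and twist_commutator: "\<And>y a. y \<in> carrier G \<Longrightarrow> a \<in> A \<Longrightarrow> y \<otimes> a \<otimes> inv y \<otimes> inv a \<in> K"
    and twist_conj: "\<And>y. y \<in> carrier G \<Longrightarrow> \<exists>i::nat. y \<otimes> w \<otimes> inv y = z [^] i \<otimes> w"
  using assms unfolding twist_def by simp_all

lemma pow_dvd_eq_one: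
  assumes "z \<in> carrier G" "z [^] p = \<one>" "p dvd i"
  shows "z [^] i = \<one>"
proof -
  obtain q where "i = p * q"
    using assms(3) by blast
  then show ?thesis
    using assms(1,2) by (simp flip: nat_pow_pow)
qed

text \<open>Two cyclic steps: z is central, and w is central modulo the powers of z by the
  conjugation clause of \<open>twist\<close>.\<close>

lemma twist_normal_subgroup:
  assumes tw: "twist A K z w"
  obtains W where "W \<lhd> G" "\<And>x y. x \<in> W \<Longrightarrow> y \<in> W \<Longrightarrow> x \<otimes> y = y \<otimes> x" "z \<in> W" "w \<in> W"
proof -
  have zK: "z \<in> K" and wc: "w \<in> carrier G"
    using twist_z(1)[OF tw] twist_w(1)[OF tw] by auto
  then have zc: "z \<in> carrier G"
    using subgroup.mem_carrier[OF twist_K(1)[OF tw]] by blast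
  have step1: "cyclic_step {\<one>} z {m \<otimes> z [^] (i::nat) |m i. m \<in> {\<one>}}" (is "cyclic_step _ z ?Z")
    using zc twist_z[OF tw] by (intro cyclic_stepI triv_subgroup) auto
  interpret Z: p_group_step G p "{\<one>}" z ?Z
    by (rule p_group_stepI[OF step1])
  have Zn: "?Z \<lhd> G"
  proof (rule cyclic_step_normal[OF step1 one_is_normal])
    fix y assume y: "y \<in> carrier G"
    then have "y \<otimes> z \<otimes> inv y \<otimes> inv z = z \<otimes> y \<otimes> inv y \<otimes> inv z"
      using twist_z(4)[OF tw] by simp
    then show "y \<otimes> z \<otimes> inv y \<otimes> inv z \<in> {\<one>}"
      using y zc by (simp add: m_assoc)
  qed
  have Z_K: "?Z \<subseteq> K"
    using subgroup_pow_mem[OF twist_K(1)[OF tw] zK] zc by auto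
  have Z_comm: "x \<otimes> y = y \<otimes> x" if "x \<in> ?Z" "y \<in> carrier G" for x y
    using that pow_mult_swap[OF zc that(2) twist_z(4)[OF tw that(2)]] zc by auto
  have "w \<notin> ?Z"
    using Z_K twist_K(2)[OF tw] twist_w(2)[OF tw] by blast
  moreover have "w [^] p \<in> ?Z"
    unfolding twist_w(3)[OF tw] using subgroup.one_closed[OF Z.subgroup_E] .
  moreover have "w \<otimes> m \<otimes> inv w \<in> ?Z" if "m \<in> ?Z" for m
    using normal.inv_op_closed2[OF Zn wc that] .
  ultimately have step2: "cyclic_step ?Z w {m \<otimes> w [^] (i::nat) |m i. m \<in> ?Z}" (is "cyclic_step _ w ?W")
    using wc by (intro cyclic_stepI Z.subgroup_E)
  interpret W: p_group_step G p ?Z w ?W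
    by (rule p_group_stepI[OF step2])
  have "?W \<lhd> G"
  proof (rule cyclic_step_normal[OF step2 Zn])
    fix y assume y: "y \<in> carrier G"
    obtain i :: nat where i: "y \<otimes> w \<otimes> inv y = z [^] i \<otimes> w"
      using twist_conj[OF tw y] by blast
    have "y \<otimes> w \<otimes> inv y \<otimes> inv w = z [^] i"
      unfolding i using wc zc by (simp add: m_assoc)
    then show "y \<otimes> w \<otimes> inv y \<otimes> inv w \<in> ?Z"
      using subgroup_pow_mem[OF Z.subgroup_E Z.g_in_E, of i] by simp
  qed
  moreover have "x \<otimes> y = y \<otimes> x" if "x \<in> ?W" "y \<in> ?W" for x y
  proof (rule cyclic_step_comm[OF step2 _ _ that])
    show "m \<otimes> n = n \<otimes> m" if "m \<in> ?Z" "n \<in> ?Z" for m n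
      using Z_comm[OF that(1)] that(2) Z.E_subset by blast
    show "w \<otimes> m = m \<otimes> w" if "m \<in> ?Z" for m
      using Z_comm[OF that wc] by simp
  qed
  moreover have "z \<in> ?W"
    using Z.g_in_E W.M_subset_E by blast
  ultimately show ?thesis
    using that W.g_in_E by blast
qed

end

section \<open>Elements of order p under a twist, for odd p and for p = 2\<close>

context p_group_inner
begin

text \<open>A normal subgroup of order at most p is central, so a self-centralizing one would be all
  of G, against |G| >= p^3.\<close>

lemma self_centralizing_moduleI:
  assumes "p_group_module G p A" "centralizer (carrier G) A = A"
  shows "self_centralizing_module G p A"
proof -
  interpret p_group_module G p A
    by (rule assms(1))
  have "p\<^sup>2 \<le> card A"
  proof (rule ccontr)
    assume "\<not> p\<^sup>2 \<le> card A"
    moreover obtain n where n: "card A = p ^ n"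
      using card_subgroup[OF subgroup_A] .
    ultimately have "n < 2"
      using p_gt_1 by (metis not_le power_increasing less_imp_le)
    then have "card A \<le> p ^ 1"
      unfolding n using p_gt_1 by (intro power_increasing) auto
    then have card: "card A \<le> p"
      by simp
    let ?Z = "centralizer A (carrier G)"
    have Z: "subgroup ?Z G"
      by (rule subgroup_centralizer[OF subgroup_A order_refl])
    have fin: "finite A"
      by (rule finite_subset[OF A.subset finite_carrier])
    have ZA: "?Z \<subseteq> A"
      by (auto simp: centralizer_def)
    have "?Z = A"
    proof (cases "A = {\<one>}")
      case True
      then show ?thesis
        by (auto simp: centralizer_def)
    next
      case False
      then obtain z where z: "z \<in> A" "z \<noteq> \<one>" "\<And>y. y \<in> carrier G \<Longrightarrow> z \<otimes> y = y \<otimes> z"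
        using central_element[OF normal_A] by metis
      then have "z \<in> ?Z"
        by (simp add: centralizer_def)
      obtain m where m: "card ?Z = p ^ m"
        using card_subgroup[OF Z] .
      have "m \<noteq> 0"
      proof
        assume "m = 0"
        then obtain u where "?Z = {u}"
          using m card_1_singletonE[of ?Z] by auto
        then show False
          using \<open>z \<in> ?Z\<close> subgroup.one_closed[OF Z] z(2) by simp
      qed
      then have "p ^ 1 \<le> card ?Z"
        unfolding m using p_gt_1 by (intro power_increasing) auto
      then show ?thesis
        using card by (intro card_seteq[OF fin ZA]) simp
    qed
    then have "a \<otimes> y = y \<otimes> a" if "a \<in> A" "y \<in> carrier G" for a y
      using that unfolding centralizer_def by blast
    then have "carrier G \<subseteq> centralizer (carrier G) A"
      unfolding centralizer_def by auto
    then have "carrier G \<subseteq> A"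
      using assms(2) by simp
    then have "order G \<le> p"
      unfolding order_def using card card_mono[OF fin \<open>carrier G \<subseteq> A\<close>] by linarith
    moreover have "p ^ 1 < p ^ 3"
      using p_gt_1 by (intro power_strict_increasing) auto
    ultimately show False
      using order_ge by simp
  qed
  then show ?thesis
    by (intro self_centralizing_module.intro self_centralizing_module_axioms.intro
        p_group_module_axioms p_group_inner_axioms assms(2))
qed

lemma twist_over:
  assumes "N \<lhd> G" "\<forall>x\<in>N. \<forall>y\<in>N. x \<otimes> y = y \<otimes> x"
  obtains A K z w where "self_centralizing_module G p A" "N \<subseteq> A" "twist A K z w"
proof -
  obtain A where A: "p_group_module G p A" "N \<subseteq> A" "centralizer (carrier G) A = A"
    using maximal_abelian_normal[OF assms(1) assms(2)[rule_format]] by blast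
  then interpret self_centralizing_module G p A
    by (intro self_centralizing_moduleI)
  show ?thesis
    using twist_exists that[OF self_centralizing_module_axioms A(2)] by blast
qed

text \<open>For odd p the collected power of z vanishes, so a^p = 1 gives (a w)^p = 1 and a is a
  power of z. Hence A has a single subgroup of order p.\<close>

lemma odd_contradiction:
  assumes odd: "odd p" and A: "p_group_module G p A" and tw: "twist A K z w"
    and uv: "u \<in> A" "v \<in> A" "u [^] p = \<one>" "v [^] p = \<one>" "u \<noteq> \<one>"
  shows "\<exists>i::nat. v = u [^] i"
proof -
  interpret p_group_module G p A
    by (rule A)
  have zc: "z \<in> carrier G"
    using twist_z(1)[OF tw] subgroup.mem_carrier[OF twist_K(1)[OF tw]] by blast
  have "2 * (\<Sum>i<Suc n. i) = Suc n * n" for n :: nat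
    by (induction n) auto
  from this[of "p - 1"] have "p dvd 2 * (\<Sum>i<p. i)"
    using p_gt_1 by simp
  moreover have "coprime p 2"
    using odd by simp
  ultimately have dvd: "p dvd (\<Sum>i<p. i)"
    by (simp add: coprime_dvd_mult_right_iff)
  have root: "\<exists>i::nat. a = z [^] i" if a: "a \<in> A" "a [^] p = \<one>" for a
  proof -
    obtain i :: nat where i: "w \<otimes> a = z [^] i \<otimes> a \<otimes> w"
      using twist_act[OF tw a(1)] by blast
    have "(a \<otimes> w) [^] p = (z [^] i) [^] (\<Sum>i<p. i) \<otimes> a [^] p \<otimes> w [^] p"
      using twist_w(1)[OF tw] a(1) zc pow_mult_swap[OF zc _ twist_z(4)[OF tw]]
      by (intro mult_pow_twisted i) auto
    also have "(z [^] i) [^] (\<Sum>i<p. i) = \<one>"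
      using zc pow_dvd_eq_one[OF zc twist_z(3)[OF tw], of "i * (\<Sum>i<p. i)"] dvd by (simp add: nat_pow_pow)
    finally have "(a \<otimes> w) [^] p = \<one>"
      using a(2) twist_w(3)[OF tw] by simp
    then show ?thesis
      by (rule twist_kernel[OF tw a(1)])
  qed
  obtain i j :: nat where ij: "u = z [^] i" "v = z [^] j"
    using root uv(1-4) by meson
  have "\<not> p dvd i"
    using uv(5) ij(1) pow_dvd_eq_one[OF zc twist_z(3)[OF tw]] by blast
  \<comment> \<open>The exponent i is invertible modulo p, which expresses z as a power of
    u.\<close>
  then have "coprime i p" "i \<noteq> 0"
    using prime_p prime_imp_coprime coprime_commute by (blast, metis dvd_0_right)
  then obtain s t where st: "i * s = p * t + 1"
    using bezout_nat[of i p] by (auto simp: coprime_iff_gcd_eq_1)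
  have "u [^] s = z [^] (p * t) \<otimes> z"
    using zc by (simp add: ij(1) nat_pow_pow st)
  also have "\<dots> = z"
    using zc pow_dvd_eq_one[OF zc twist_z(3)[OF tw], of "p * t"] by simp
  finally have "v = u [^] (s * j)"
    using uv(1) ij(2) by (simp flip: nat_pow_pow)
  then show ?thesis
    by blast
qed

text \<open>For a outside K, (a w)^2 = z a^2. If a^2 were z this would be trivial, and a would be a
  power of z, hence in K.\<close>

lemma even_twist_square:
  assumes p: "p = 2" and A: "p_group_module G p A" and tw: "twist A K z w"
    and a: "a \<in> A" "a \<notin> K"
  shows "w \<otimes> a = z \<otimes> a \<otimes> w" "a \<otimes> a \<noteq> z"
proof -
  interpret p_group_module G p A
    by (rule A)
  have zc: "z \<in> carrier G"
    using twist_z(1)[OF tw] subgroup.mem_carrier[OF twist_K(1)[OF tw]] by blast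
  have wc: "w \<in> carrier G"
    by (rule twist_w(1)[OF tw])
  have zz: "z \<otimes> z = \<one>" and ww: "w \<otimes> w = \<one>"
    using twist_z(3)[OF tw] twist_w(3)[OF tw] zc wc by (simp_all add: p pow_2)
  obtain i :: nat where i: "w \<otimes> a = z [^] i \<otimes> a \<otimes> w" "\<not> p dvd i"
    using twist_act[OF tw a(1)] a(2) by blast
  then obtain j where "i = Suc (2 * j)"
    unfolding p by (metis oddE Suc_eq_plus1)
  then have "z [^] i = z"
    using zc pow_dvd_eq_one[OF zc twist_z(3)[OF tw], of "2 * j"] by (simp add: p)
  then show wa: "w \<otimes> a = z \<otimes> a \<otimes> w"
    using i(1) by simp
  show "a \<otimes> a \<noteq> z"
  proof
    assume aa: "a \<otimes> a = z"
    have "(a \<otimes> w) [^] p = a \<otimes> (w \<otimes> a) \<otimes> w"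
      using a(1) wc by (simp add: p pow_2 m_assoc)
    also have "\<dots> = (a \<otimes> z) \<otimes> a \<otimes> (w \<otimes> w)"
      unfolding wa using a(1) wc zc by (simp add: m_assoc)
    also have "a \<otimes> z = z \<otimes> a"
      using twist_z(4)[OF tw, of a] a(1) by simp
    also have "z \<otimes> a \<otimes> a \<otimes> (w \<otimes> w) = \<one>"
      using a(1) zc ww zz aa by (simp add: m_assoc)
    finally obtain i :: nat where "a = z [^] i"
      using twist_kernel[OF tw a(1)] by blast
    then have "a \<in> K"
      using subgroup_pow_mem[OF twist_K(1)[OF tw] twist_z(1)[OF tw]] by simp
    then show False
      using a(2) by simp
  qed
qed

text \<open>Elements of K commute with w, so a^2 = 1 gives (a w)^2 = 1 and a is a power of
  z.\<close>

lemma even_twist_kernel: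
  assumes p: "p = 2" and A: "p_group_module G p A" and tw: "twist A K z w"
    and a: "a \<in> K" "a \<otimes> a = \<one>"
  shows "a = \<one> \<or> a = z"
proof -
  interpret p_group_module G p A
    by (rule A)
  have zc: "z \<in> carrier G"
    using twist_z(1)[OF tw] subgroup.mem_carrier[OF twist_K(1)[OF tw]] by blast
  have wc: "w \<in> carrier G"
    by (rule twist_w(1)[OF tw])
  have aA: "a \<in> A"
    using a(1) twist_K(2)[OF tw] by blast
  obtain i :: nat where i: "w \<otimes> a = z [^] i \<otimes> a \<otimes> w" "p dvd i"
    using twist_act[OF tw aA] a(1) by blast
  then have wa: "w \<otimes> a = a \<otimes> w"
    using pow_dvd_eq_one[OF zc twist_z(3)[OF tw] i(2)] aA by simp
  have "(a \<otimes> w) [^] p = a \<otimes> (w \<otimes> a) \<otimes> w"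
    using aA wc by (simp add: p pow_2 m_assoc)
  also have "\<dots> = (a \<otimes> a) \<otimes> w [^] p"
    unfolding wa using aA wc by (simp add: p pow_2 m_assoc)
  finally have "(a \<otimes> w) [^] p = \<one>"
    using a(2) twist_w(3)[OF tw] by simp
  then obtain i :: nat where i: "a = z [^] i"
    using twist_kernel[OF tw aA] by blast
  show ?thesis
  proof (cases "even i")
    case True
    then show ?thesis
      using i pow_dvd_eq_one[OF zc twist_z(3)[OF tw], of i] p by simp
  next
    case False
    then obtain j where "i = Suc (2 * j)"
      by (metis oddE Suc_eq_plus1)
    then show ?thesis
      using i zc pow_dvd_eq_one[OF zc twist_z(3)[OF tw], of "2 * j"] by (simp add: p)
  qed
qed

text \<open>A larger K would contain some l with l^2 = z, its only involution being z. Then l v lies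
  outside K and also has square z, which \<open>even_twist_square\<close> excludes.\<close>

lemma even_kernel_trivial:
  assumes p: "p = 2" and A: "p_group_module G p A" and tw: "twist A K z w"
    and v: "v \<in> A" "v \<notin> K" "v \<otimes> v = \<one>"
  shows "K = {\<one>, z}"
proof (rule ccontr)
  interpret p_group_module G p A
    by (rule A)
  interpret K: subgroup K G
    by (rule twist_K(1)[OF tw])
  have zK: "z \<in> K" and zc: "z \<in> carrier G"
    using twist_z(1)[OF tw] by auto
  have zz: "z \<otimes> z = \<one>"
    using twist_z(3)[OF tw] zc by (simp add: p pow_2)
  have inv_z: "inv z = z"
    using inv_equality[OF zz zc zc] .
  have sub: "subgroup {\<one>, z} G"
    using zc zz inv_z by (intro subgroupI) auto
  assume "K \<noteq> {\<one>, z}"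
  then obtain k where k: "k \<in> K" "k \<notin> {\<one>, z}"
    using zK K.one_closed by blast
  obtain j where j: "k [^] (p ^ j) \<notin> {\<one>, z}" "k [^] (p ^ Suc j) \<in> {\<one>, z}"
    using exists_last_power_not_mem[OF sub K.mem_carrier[OF k(1)] k(2)] by blast
  define l where "l = k [^] (p ^ j)"
  have l: "l \<in> K" "l \<notin> {\<one>, z}"
    using subgroup_pow_mem[OF K.subgroup_axioms k(1)] j(1) by (simp_all add: l_def)
  have "l \<otimes> l = k [^] (p ^ Suc j)"
    using k(1) by (simp add: l_def p nat_pow_mult mult_2)
  then have "l \<otimes> l \<in> {\<one>, z}"
    using j(2) by simp
  moreover have "l \<otimes> l \<noteq> \<one>"
    using even_twist_kernel[OF p A tw l(1)] l(2) by blast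
  ultimately have ll: "l \<otimes> l = z"
    by simp
  have lA: "l \<in> A"
    using l(1) twist_K(2)[OF tw] by blast
  have "l \<otimes> v \<notin> K"
  proof
    assume "l \<otimes> v \<in> K"
    then have "inv l \<otimes> (l \<otimes> v) \<in> K"
      using l(1) by simp
    then show False
      using v l(1) by simp
  qed
  then have "(l \<otimes> v) \<otimes> (l \<otimes> v) \<noteq> z"
    using even_twist_square(2)[OF p A tw, of "l \<otimes> v"] lA v(1) by simp
  moreover have "(l \<otimes> v) \<otimes> (l \<otimes> v) = (l \<otimes> l) \<otimes> (v \<otimes> v)"
    using A_comm_left[OF v(1) lA, of v] lA v(1) by (simp add: m_assoc)
  ultimately show False
    using ll v(3) zc by simp
qed

text \<open>Here \<open>G\<close> is forced to be dihedral of order 8, with \<open>A\<close> a four-group; the contradiction comes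
  from the cyclic subgroup of order 4.\<close>

lemma even_contradiction:
  assumes p: "p = 2" and sc: "self_centralizing_module G p A" and tw: "twist A K z w"
    and v: "v \<in> A" "v \<notin> K" "v \<otimes> v = \<one>"
  shows False
proof -
  interpret self_centralizing_module G p A
    by (rule sc)
  have A: "p_group_module G p A"
    by (rule p_group_module_axioms)
  have K: "K = {\<one>, z}"
    by (rule even_kernel_trivial[OF p A tw v])
  have zc: "z \<in> carrier G" and zA: "z \<in> A" and z1: "z \<noteq> \<one>"
    using twist_z(1,2)[OF tw] twist_K(2)[OF tw] A.subset by auto
  have z: "z \<otimes> y = y \<otimes> z" if "y \<in> carrier G" for y
    using twist_z(4)[OF tw that] .
  have wc: "w \<in> carrier G" and wA: "w \<notin> A" and vc: "v \<in> carrier G"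
    using twist_w(1,2)[OF tw] v(1) by auto
  have zz: "z \<otimes> z = \<one>" and ww: "w \<otimes> w = \<one>"
    using twist_z(3)[OF tw] twist_w(3)[OF tw] zc wc by (simp_all add: p pow_2)
  have cancel: "z \<otimes> (z \<otimes> y) = y" "w \<otimes> (w \<otimes> y) = y" "v \<otimes> (v \<otimes> y) = y" if "y \<in> carrier G" for y
    using that zc wc vc zz ww v(3) by (simp_all flip: m_assoc)
  have zy_ne: "z \<otimes> y \<noteq> y" if "y \<in> carrier G" for y
    using that zc z1 by simp
  have wv: "w \<otimes> v = z \<otimes> v \<otimes> w"
    by (rule even_twist_square(1)[OF p A tw v(1,2)])
  \<comment> \<open>If a lies outside K, then w moves both a and v by z, so it commutes with a v,
    which is therefore in K.\<close>
  have A_eq: "a \<in> {\<one>, z, v, z \<otimes> v}" if a: "a \<in> A" for a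
  proof (cases "a \<in> K")
    case False
    have ac: "a \<in> carrier G"
      using a by simp
    have wa: "w \<otimes> a = z \<otimes> a \<otimes> w"
      by (rule even_twist_square(1)[OF p A tw a False])
    have "w \<otimes> (a \<otimes> v) = z \<otimes> a \<otimes> (w \<otimes> v)"
      using wa ac vc wc zc by (simp flip: m_assoc)
    also have "\<dots> = z \<otimes> (a \<otimes> z) \<otimes> (v \<otimes> w)"
      unfolding wv using ac vc wc zc by (simp add: m_assoc)
    also have "a \<otimes> z = z \<otimes> a"
      using z[OF ac] by simp
    also have "z \<otimes> (z \<otimes> a) \<otimes> (v \<otimes> w) = a \<otimes> v \<otimes> w"
      using ac vc wc zc cancel by (simp add: m_assoc)
    finally have eq: "w \<otimes> (a \<otimes> v) = a \<otimes> v \<otimes> w" .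
    have "a \<otimes> v \<in> K"
    proof (rule ccontr)
      assume "a \<otimes> v \<notin> K"
      then have "w \<otimes> (a \<otimes> v) = z \<otimes> (a \<otimes> v \<otimes> w)"
        using even_twist_square(1)[OF p A tw, of "a \<otimes> v"] a v(1) ac vc wc zc by (simp add: m_assoc)
      then show False
        using eq zy_ne[of "a \<otimes> v \<otimes> w"] ac vc wc by simp
    qed
    then have "a \<otimes> v = \<one> \<or> a \<otimes> v = z"
      by (simp add: K)
    moreover have "a = a \<otimes> v \<otimes> v"
      using v(3) ac vc by (simp add: m_assoc)
    ultimately show ?thesis
      using vc by auto
  qed (use K in auto)
  \<comment> \<open>v and w are involutions with commutator z, so their product has square z and
    order 4.\<close>
  define c where "c = v \<otimes> w"
  have cc: "c \<in> carrier G"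
    using vc wc by (simp add: c_def)
  have cz: "c \<otimes> c = z"
  proof -
    have "c \<otimes> c = v \<otimes> (w \<otimes> v) \<otimes> w"
      unfolding c_def using vc wc by (simp add: m_assoc)
    also have "\<dots> = (v \<otimes> z) \<otimes> v \<otimes> (w \<otimes> w)"
      unfolding wv using vc wc zc by (simp add: m_assoc)
    also have "\<dots> = z"
      using z[OF vc] vc zc ww cancel(3)[OF zc] by (simp add: m_assoc)
    finally show ?thesis .
  qed
  have vcz: "v \<otimes> c = z \<otimes> c \<otimes> v" and wcz: "w \<otimes> c = z \<otimes> c \<otimes> w"
  proof -
    have "z \<otimes> c \<otimes> v = z \<otimes> v \<otimes> (w \<otimes> v)"
      unfolding c_def using vc wc zc by (simp add: m_assoc)
    also have "\<dots> = z \<otimes> (v \<otimes> z) \<otimes> (v \<otimes> w)"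
      unfolding wv using vc wc zc by (simp add: m_assoc)
    also have "v \<otimes> z = z \<otimes> v"
      using z[OF vc] by simp
    also have "z \<otimes> (z \<otimes> v) \<otimes> (v \<otimes> w) = w"
      using vc wc zc cancel by (simp add: m_assoc)
    finally show "v \<otimes> c = z \<otimes> c \<otimes> v"
      unfolding c_def using vc wc cancel by simp
    have "w \<otimes> c = (w \<otimes> v) \<otimes> w"
      unfolding c_def using vc wc by (simp add: m_assoc)
    then show "w \<otimes> c = z \<otimes> c \<otimes> w"
      unfolding wv c_def using vc wc zc by (simp add: m_assoc)
  qed
  have cA: "c \<notin> A"
  proof
    assume "c \<in> A"
    then have "inv v \<otimes> c \<in> A"
      using v(1) by simp
    then show False
      using wA vc wc by (simp add: c_def)
  qed
  \<comment> \<open>A is the centralizer of v, and v has only the conjugates v and z v, so A and w A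
    exhaust G.\<close>
  have v_split: "y \<in> A \<or> (\<exists>a\<in>A. y = w \<otimes> a)" if y: "y \<in> carrier G" for y
  proof -
    have in_A: "u \<in> A" if u: "u \<in> carrier G" "u \<otimes> v = v \<otimes> u" for u
    proof -
      have "u \<otimes> a = a \<otimes> u" if "a \<in> A" for a
      proof -
        have "u \<otimes> (z \<otimes> v) = z \<otimes> (u \<otimes> v)"
          using z[OF u(1)] u(1) zc vc by (simp flip: m_assoc)
        then have "u \<otimes> (z \<otimes> v) = z \<otimes> v \<otimes> u"
          using u zc vc by (simp add: m_assoc)
        then show ?thesis
          using A_eq[OF that] z[OF u(1)] u by auto
      qed
      then show ?thesis
        using memA_iff[OF u(1)] by blast
    qed
    have "y \<otimes> v \<otimes> inv y \<otimes> inv v \<in> {\<one>, z}"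
      using twist_commutator[OF tw y v(1)] K by simp
    moreover have "y \<otimes> v = (y \<otimes> v \<otimes> inv y \<otimes> inv v) \<otimes> v \<otimes> y"
      using y vc by (simp add: m_assoc)
    ultimately consider "y \<otimes> v = v \<otimes> y" | "y \<otimes> v = z \<otimes> v \<otimes> y"
      using vc y by auto
    then show ?thesis
    proof cases
      case 1
      then show ?thesis
        using in_A y by blast
    next
      case 2
      have "w \<otimes> y \<otimes> v = (w \<otimes> z) \<otimes> (v \<otimes> y)"
        using 2 y vc wc zc by (simp add: m_assoc)
      also have "w \<otimes> z = z \<otimes> w"
        using z[OF wc] by simp
      also have "z \<otimes> w \<otimes> (v \<otimes> y) = z \<otimes> (w \<otimes> v) \<otimes> y"
        using y vc wc zc by (simp add: m_assoc)
      also have "\<dots> = v \<otimes> (w \<otimes> y)"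
        unfolding wv using y vc wc zc cancel by (simp add: m_assoc)
      finally have "w \<otimes> y \<in> A"
        using in_A[of "w \<otimes> y"] y wc by simp
      moreover have "y = w \<otimes> (w \<otimes> y)"
        using cancel(2)[OF y] by simp
      ultimately show ?thesis
        by blast
    qed
  qed
  have A_c: "a \<otimes> c = c \<otimes> a \<or> a \<otimes> c = z \<otimes> c \<otimes> a" if a: "a \<in> A" for a
  proof -
    have "z \<otimes> v \<otimes> c = z \<otimes> c \<otimes> (z \<otimes> v)"
    proof -
      have "z \<otimes> v \<otimes> c = z \<otimes> (v \<otimes> c)"
        using vc cc zc by (simp add: m_assoc)
      also have "\<dots> = z \<otimes> (z \<otimes> c) \<otimes> v"
        unfolding vcz using vc cc zc by (simp add: m_assoc)
      also have "z \<otimes> (z \<otimes> c) \<otimes> v = z \<otimes> (c \<otimes> z) \<otimes> v"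
        by (simp only: z[OF cc])
      also have "\<dots> = z \<otimes> c \<otimes> (z \<otimes> v)"
        using vc cc zc by (simp add: m_assoc)
      finally show ?thesis .
    qed
    then show ?thesis
      using A_eq[OF a] z[OF cc] vcz cc by auto
  qed
  have conj_c: "y \<otimes> c \<otimes> inv y \<otimes> inv c \<in> {\<one>, z}" if y: "y \<in> carrier G" for y
  proof -
    have "y \<otimes> c = c \<otimes> y \<or> y \<otimes> c = z \<otimes> c \<otimes> y"
      using v_split[OF y]
    proof
      assume "\<exists>a\<in>A. y = w \<otimes> a"
      then obtain a where a: "a \<in> A" "y = w \<otimes> a"
        by blast
      have ac: "a \<in> carrier G"
        using a(1) by simp
      show ?thesis
        using A_c[OF a(1)]
      proof
        assume "a \<otimes> c = c \<otimes> a"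
        then have "y \<otimes> c = (w \<otimes> c) \<otimes> a"
          using a(2) ac cc wc by (simp add: m_assoc)
        then show ?thesis
          unfolding wcz a(2) using ac cc wc zc by (simp add: m_assoc)
      next
        assume 1: "a \<otimes> c = z \<otimes> c \<otimes> a"
        have "y \<otimes> c = (w \<otimes> z) \<otimes> c \<otimes> a"
          using a(2) 1 ac cc wc zc by (simp add: m_assoc)
        also have "w \<otimes> z = z \<otimes> w"
          using z[OF wc] by simp
        also have "z \<otimes> w \<otimes> c \<otimes> a = z \<otimes> (w \<otimes> c) \<otimes> a"
          using ac cc wc zc by (simp add: m_assoc)
        also have "\<dots> = c \<otimes> y"
          unfolding wcz a(2) using ac cc wc zc cancel by (simp add: m_assoc)
        finally show ?thesis
          by simp
      qed
    qed (rule A_c)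
    then show ?thesis
    proof
      assume "y \<otimes> c = c \<otimes> y"
      then show ?thesis
        using y cc by (simp add: m_assoc)
    next
      assume "y \<otimes> c = z \<otimes> c \<otimes> y"
      then show ?thesis
        using y cc zc by (simp add: m_assoc)
    qed
  qed
  have "inv z = z"
    by (rule inv_equality[OF zz zc zc])
  then have sub: "subgroup {\<one>, z} G"
    using zc zz by (intro subgroupI) auto
  have nz: "{\<one>, z} \<lhd> G"
  proof (rule normal_invI[OF sub])
    fix u y assume u: "u \<in> {\<one>, z}" and y: "y \<in> carrier G"
    have "y \<otimes> u = u \<otimes> y"
      using u z[OF y] y by auto
    then have "y \<otimes> u \<otimes> inv y = u"
      using u y zc by (auto simp: m_assoc)
    then show "y \<otimes> u \<otimes> inv y \<in> {\<one>, z}"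
      using u by simp
  qed
  have "c \<notin> {\<one>, z}"
    using cA zA by auto
  then have "cyclic_step {\<one>, z} c {m \<otimes> c [^] (i::nat) |m i. m \<in> {\<one>, z}}"
    using cc cz normal.inv_op_closed2[OF nz cc] by (intro cyclic_stepI sub) (simp_all add: p pow_2)
  then obtain M where step: "cyclic_step {\<one>, z} c M"
    by blast
  interpret C: p_group_step G p "{\<one>, z}" c M
    by (rule p_group_stepI[OF step])
  interpret M: subgroup M G
    by (rule C.subgroup_E)
  have M_comm: "x \<otimes> y = y \<otimes> x" if "x \<in> M" "y \<in> M" for x y
  proof (rule cyclic_step_comm[OF step _ _ that])
    show "m \<otimes> n = n \<otimes> m" if "m \<in> {\<one>, z}" "n \<in> {\<one>, z}" for m n
      using that zc by auto
    show "c \<otimes> m = m \<otimes> c" if "m \<in> {\<one>, z}" for m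
      using that z[OF cc] cc by auto
  qed
  have M: "p_group_module G p M"
    by (intro p_group_module.intro p_group_axioms p_group_module_axioms.intro
        cyclic_step_normal[OF step nz conj_c] M_comm)
  have c_pow: "c [^] i \<in> {\<one>, z, c, z \<otimes> c}" for i :: nat
  proof (induction i)
    case (Suc i)
    have "z \<otimes> c \<otimes> c = \<one>"
      using zc cc cz zz by (simp add: m_assoc)
    then show ?case
      using Suc cz cc by auto
  qed simp
  have M_sub: "x \<in> {\<one>, z, c, z \<otimes> c}" if x: "x \<in> M" for x
  proof -
    obtain m i where mi: "m \<in> {\<one>, z}" "x = m \<otimes> c [^] (i::nat)"
      using x unfolding C.E_eq by blast
    have "z \<otimes> \<one> = z"
      using zc by simp
    then have z_mult: "z \<otimes> c [^] i \<in> {\<one>, z, c, z \<otimes> c}"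
      using c_pow[of i] zz cancel(1)[OF cc] by (elim insertE emptyE) simp_all
    show ?thesis
    proof (cases "m = z")
      case True
      show ?thesis
        unfolding mi(2) True by (rule z_mult)
    next
      case False
      then have "m = \<one>"
        using mi(1) by simp
      then have "x = c [^] i"
        using mi(2) cc by simp
      then show ?thesis
        using c_pow[of i] by simp
    qed
  qed
  have zM: "z \<in> M" and cM: "c \<in> M"
    using C.M_subset_E C.g_in_E by blast+
  have "y \<in> M" if y: "y \<in> centralizer (carrier G) M" for y
  proof -
    have yc: "y \<in> carrier G" "y \<otimes> c = c \<otimes> y"
      using y cM unfolding centralizer_def by blast+
    have cyne: "z \<otimes> (c \<otimes> y) \<noteq> c \<otimes> y"
      using zy_ne[of "c \<otimes> y"] yc(1) cc by simp
    have nv: "v \<otimes> c \<noteq> c \<otimes> v" and nw: "w \<otimes> c \<noteq> c \<otimes> w"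
      unfolding vcz wcz using zy_ne[of "c \<otimes> v"] zy_ne[of "c \<otimes> w"] zc cc vc wc by (simp_all add: m_assoc)
    have strip: "u \<otimes> c = c \<otimes> u" if "u \<in> carrier G" "z \<otimes> u \<otimes> c = c \<otimes> (z \<otimes> u)" for u
    proof -
      have "c \<otimes> (z \<otimes> u) = z \<otimes> (c \<otimes> u)"
        using z[OF cc] cc zc that(1) by (simp flip: m_assoc)
      then have "z \<otimes> (u \<otimes> c) = z \<otimes> (c \<otimes> u)"
        using that cc zc by (simp add: m_assoc)
      then show ?thesis
        using that(1) cc zc by simp
    qed
    have wz: "w \<otimes> z = z \<otimes> w" and wvz: "w \<otimes> v = z \<otimes> c" and wzv: "w \<otimes> (z \<otimes> v) = c"
    proof -
      show wz: "w \<otimes> z = z \<otimes> w"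
        using z[OF wc] by simp
      show wvz: "w \<otimes> v = z \<otimes> c"
        unfolding wv c_def using vc wc zc by (simp add: m_assoc)
      have "w \<otimes> (z \<otimes> v) = z \<otimes> (w \<otimes> v)"
        using wz vc wc zc by (simp flip: m_assoc)
      then show "w \<otimes> (z \<otimes> v) = c"
        unfolding wvz using cancel(1)[OF cc] by simp
    qed
    \<comment> \<open>Up to the central factor z, the elements of A and w A are the identity, v, w
      and c, and neither v nor w commutes with c.\<close>
    show ?thesis
      using v_split[OF yc(1)]
    proof
      assume "y \<in> A"
      then have "y \<in> {\<one>, z}"
        using A_eq[of y] yc nv strip[of v] vc by auto
      then show ?thesis
        using zM M.one_closed by auto
    next
      assume "\<exists>a\<in>A. y = w \<otimes> a"
      then obtain a where a: "a \<in> A" "y = w \<otimes> a"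
        by blast
      then have "y \<in> {w, z \<otimes> w, z \<otimes> c, c}"
        using A_eq[OF a(1)] wz wvz wzv wc by auto
      then have "y \<in> {z \<otimes> c, c}"
        using yc nw strip[of w] wc by auto
      then show ?thesis
        using zM cM by auto
    qed
  qed
  moreover have "M \<subseteq> centralizer (carrier G) M"
    unfolding centralizer_def using M_comm M.subset by blast
  ultimately have "centralizer (carrier G) M = M"
    by blast
  then interpret M: self_centralizing_module G p M
    by (intro self_centralizing_moduleI M)
  obtain L z' w' where tw': "twist M L z' w'"
    using M.twist_exists by blast
  interpret L: subgroup L G
    by (rule twist_K(1)[OF tw'])
  have LM: "L \<subset> M"
    by (rule twist_K(2)[OF tw'])
  have zc_sq: "(z \<otimes> c) \<otimes> (z \<otimes> c) = z"
  proof -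
    have "(z \<otimes> c) \<otimes> (z \<otimes> c) = z \<otimes> (c \<otimes> z) \<otimes> c"
      using zc cc by (simp add: m_assoc)
    also have "c \<otimes> z = z \<otimes> c"
      using z[OF cc] by simp
    also have "z \<otimes> (z \<otimes> c) \<otimes> c = z"
      using cancel(1)[OF cc] cz by simp
    finally show ?thesis .
  qed
  have "z' \<otimes> z' = \<one>"
    using twist_z(3)[OF tw'] twist_z(1)[OF tw'] by (simp add: p pow_2)
  moreover have "z' \<in> {\<one>, z, c, z \<otimes> c}"
    using M_sub twist_z(1)[OF tw'] LM by blast
  \<comment> \<open>c and z c have square z, so z is the only involution of M. As L is a proper
    subgroup it misses the generator c, whose square is nevertheless \<open>z'\<close>.\<close>
  ultimately have "z' = z"
    using twist_z(2)[OF tw'] cz zc_sq z1 by auto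
  have "c \<notin> L"
  proof
    assume "c \<in> L"
    then have "z \<in> L"
      using cz L.m_closed by metis
    have "M \<subseteq> L"
    proof
      fix x assume "x \<in> M"
      then have "x \<in> {\<one>, z, c, z \<otimes> c}"
        by (rule M_sub)
      then show "x \<in> L"
        using \<open>c \<in> L\<close> \<open>z \<in> L\<close> by auto
    qed
    then show False
      using LM by blast
  qed
  then have "c \<otimes> c \<noteq> z'"
    using even_twist_square(2)[OF p M tw' cM] by blast
  then show False
    using cz \<open>z' = z\<close> by simp
qed

text \<open>The first twist supplies z0 in A0 and w0 outside A0, both of order p and lying in one
  abelian normal subgroup W. The twist of a self-centralizing A containing W does not tolerate such
  a pair.\<close>

lemma inner_contradiction: False
proof -
  have comm: "\<forall>x\<in>{\<one>}. \<forall>y\<in>{\<one>}. x \<otimes> y = y \<otimes> x"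
    by simp
  obtain A0 K0 z0 w0 where A0: "self_centralizing_module G p A0" and "{\<one>} \<subseteq> A0"
    and tw0: "twist A0 K0 z0 w0"
    by (rule twist_over[OF one_is_normal comm]) (rule that)
  interpret A0: self_centralizing_module G p A0
    by (rule A0)
  obtain W where W: "W \<lhd> G" "\<And>x y. x \<in> W \<Longrightarrow> y \<in> W \<Longrightarrow> x \<otimes> y = y \<otimes> x" "z0 \<in> W" "w0 \<in> W"
    using twist_normal_subgroup[OF tw0] by blast
  then have "\<forall>x\<in>W. \<forall>y\<in>W. x \<otimes> y = y \<otimes> x"
    by simp
  then obtain A K z w where A: "self_centralizing_module G p A" "W \<subseteq> A" and tw: "twist A K z w"
    using twist_over[OF W(1)] by blast
  interpret self_centralizing_module G p A
    by (rule A(1))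
  have zA: "z0 \<in> A" and wA: "w0 \<in> A"
    using W(3,4) A(2) by auto
  have z0A0: "z0 \<in> A0"
    using twist_z(1)[OF tw0] twist_K(2)[OF tw0] by blast
  note facts = twist_z(2,3)[OF tw0] twist_w(2,3)[OF tw0]
  show False
  proof (cases "odd p")
    case True
    then obtain i :: nat where "w0 = z0 [^] i"
      using odd_contradiction[OF True p_group_module_axioms tw zA wA facts(2,4,1)] by blast
    then have "w0 \<in> A0"
      using subgroup_pow_mem[OF A0.subgroup_A z0A0] by simp
    then show False
      using facts(3) by simp
  next
    case False
    then have p: "p = 2"
      using prime_p prime_odd_nat p_gt_1 by (metis Suc_1 Suc_lessI One_nat_def)
    have sq: "z0 \<otimes> z0 = \<one>" "w0 \<otimes> w0 = \<one>"
      using facts(2,4) zA wA by (simp_all add: p pow_2)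
    \<comment> \<open>z0 and w0 are distinct involutions while K has only one, so at least one of
      them lies outside K.\<close>
    have "z0 \<noteq> w0" "w0 \<noteq> \<one>"
      using z0A0 facts(3) A0.A.one_closed by auto
    then have "\<not> (z0 \<in> K \<and> w0 \<in> K)"
      using even_twist_kernel[OF p p_group_module_axioms tw] sq facts(1) by metis
    then show False
      using even_contradiction[OF p A(1) tw] zA wA sq by blast
  qed
qed

end

section \<open>Small groups and the equivalence\<close>

lemma (in p_group) p_auto_fixed_card:
  assumes \<phi>: "\<phi> \<in> outer_auto G" "\<phi> \<in> p_auto p G" and order: "order G \<le> p\<^sup>2"
  shows "card (fixed_subgroup G \<phi>) = p"
proof -
  let ?F = "fixed_subgroup G \<phi>"
  have auto: "\<phi> \<in> auto G"
    using \<phi>(2) by (simp add: p_auto_def)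
  have sub: "subgroup ?F G"
    by (rule subgroup_fixed_subgroup[OF auto])
  interpret A: group "AutoGroup G"
    by (rule AutoGroup)
  obtain k where "A.ord \<phi> = p ^ k"
    using \<phi>(2) by (auto simp: p_auto_def)
  then have "\<phi> [^]\<^bsub>AutoGroup G\<^esub> (p ^ k) = \<one>\<^bsub>AutoGroup G\<^esub>"
    using A.pow_eq_id[of \<phi> "p ^ k"] auto by (simp add: AutoGroup_def)
  then have eq: "(\<lambda>x\<in>carrier G. (\<phi> ^^ (p ^ k)) x) = (\<lambda>x\<in>carrier G. x)"
    unfolding AutoGroup_pow[OF auto] by (simp add: AutoGroup_def BijGroup_def)
  have pow: "(\<phi> ^^ (p ^ k)) x = x" if "x \<in> carrier G" for x
    using fun_cong[OF eq, of x] that by simp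
  have "\<phi> x \<in> carrier G" if "x \<in> carrier G" for x
    using auto that by (auto simp: auto_def hom_def)
  then have cong: "[card (carrier G) = card ?F] (mod p)"
    unfolding fixed_subgroup_def
    by (intro card_fixed_points_funpow_cong[OF prime_p finite_carrier _ pow])
  \<comment> \<open>An automorphism fixing everything is conjugation by the identity, hence inner;
    extensionality is needed to equate the two functions.\<close>
  have proper: "?F \<noteq> carrier G"
  proof
    assume "?F = carrier G"
    then have id: "\<phi> x = x" if "x \<in> carrier G" for x
      using that by (auto simp: fixed_subgroup_def)
    have "\<phi> \<in> extensional (carrier G)"
      using auto by (simp add: auto_def Bij_def)
    then have "\<phi> = (\<lambda>x\<in>carrier G. \<one> \<otimes> x \<otimes> inv \<one>)"
      by (intro extensionalityI[of _ "carrier G"]) (auto simp: id)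
    then have "\<phi> \<in> inner_auto G"
      unfolding inner_auto_def by blast
    then show False
      using \<phi>(1) by (simp add: outer_auto_def)
  qed
  have FG: "?F \<subseteq> carrier G"
    using subgroup.subset[OF sub] .
  obtain m where m: "card ?F = p ^ m"
    using card_subgroup[OF sub] .
  obtain n where n: "card (carrier G) = p ^ n"
    using order_power by (auto simp: order_def)
  have "card ?F < card (carrier G)"
    using FG proper finite_carrier by (intro psubset_card_mono) auto
  then have mn: "m < n"
    unfolding m n using p_gt_1 power_less_imp_less_exp by blast
  have "p ^ n \<le> p\<^sup>2"
    using order n by (simp add: order_def)
  then have "n \<le> 2"
    using p_gt_1 power_le_imp_le_exp by blast
  \<comment> \<open>m < n rules out the trivial group, so p divides |G| and by the congruence also
    the number of fixed points; this leaves 0 < m < n <= 2.\<close>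
  have "p dvd p ^ n"
    using mn by simp
  then have "p dvd card ?F"
    using cong_dvd_iff[OF cong] n by simp
  then have "m \<noteq> 0"
    using m p_gt_1 by (metis nat_dvd_1_iff_1 nat_neq_iff power_0)
  then have "m = 1"
    using mn \<open>n \<le> 2\<close> by linarith
  then show ?thesis
    using m by simp
qed

theorem theorem1p1:
  fixes p :: nat and G :: "('a, 'b) monoid_scheme"
  assumes "Factorial_Ring.prime p"
    and "finite_p_group p G"
  shows "(\<forall>\<phi> \<in> outer_auto G \<inter> p_auto p G. card (fixed_subgroup G \<phi>) = p) \<longleftrightarrow>
    order G \<le> p ^ 2"
proof -
  interpret p_group G p
    using assms by (simp add: finite_p_group_def p_group_def p_group_axioms_def)
  show ?thesis
  proof
    assume fixed: "\<forall>\<phi> \<in> outer_auto G \<inter> p_auto p G. card (fixed_subgroup G \<phi>) = p"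
    show "order G \<le> p ^ 2"
    proof (rule ccontr)
      assume large: "\<not> order G \<le> p ^ 2"
      obtain n where n: "order G = p ^ n"
        using order_power by blast
      have "2 < n"
      proof (rule ccontr)
        assume "\<not> 2 < n"
        then have "p ^ n \<le> p ^ 2"
          using p_gt_1 by (intro power_increasing) auto
        then show False
          using large n by simp
      qed
      then have "p ^ 3 \<le> order G"
        unfolding n using p_gt_1 by (intro power_increasing) auto
      moreover have "\<phi> \<in> inner_auto G" if "\<phi> \<in> p_auto p G" "p\<^sup>2 \<le> card (fixed_subgroup G \<phi>)" for \<phi>
      proof (rule ccontr)
        assume "\<phi> \<notin> inner_auto G"
        then have "\<phi> \<in> outer_auto G \<inter> p_auto p G"
          using that(1) by (simp add: outer_auto_def p_auto_def)
        then have "p\<^sup>2 \<le> p"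
          using fixed that(2) by auto
        then show False
          using p_gt_1 by (simp add: power2_eq_square)
      qed
      ultimately interpret p_group_inner G p
        by unfold_locales auto
      show False
        by (rule inner_contradiction)
    qed
  next
    assume "order G \<le> p ^ 2"
    then show "\<forall>\<phi> \<in> outer_auto G \<inter> p_auto p G. card (fixed_subgroup G \<phi>) = p"
      using p_auto_fixed_card by blast
  qed
qed

end
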